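(* Let $n\ge 1$ be an integer. If $2^{\aleph_i}=\aleph_{i+1}$ for $i=0,\dots,n-1$, then there exists a strongly $\aleph_n$-free abelian group $G$ of cardinality $\aleph_n$ with trivial dual, i.e. $\operatorname{Hom}(G,\mathbb{Z})=0$.
   Context: For a cardinal $\kappa>\aleph_0$, an abelian group $G$ of cardinality $\kappa$ is strongly $\kappa$-free if it has a $\kappa$-filtration, i.e. an ascending continuous chain of subgroups $\{G_\nu:\nu<\kappa\}$ with $|G_\nu|<\kappa$ and $\bigcup_{\nu<\kappa}G_\nu=G$, such that (a) every $G_\nu$ is a free abelian group, and (b) if $\nu$ is a successor ordinal and $\nu<\rho<\kappa$, then $G_\rho/G_\nu$ is free. *)

theory Defs
  imports "HOL-Algebra.Free_Abelian_Groups"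
begin

unbundle cardinal_syntax

text \<open>
  Cardinals are relations satisfying \<^const>\<open>card_order_on\<close> on their field; the ordinals below
  a cardinal \<open>\<kappa>\<close> are the elements of \<open>Field \<kappa>\<close>.

  \<open>is_aleph n \<kappa>\<close> says that \<open>\<kappa>\<close> is a cardinal equal to aleph-n. A function from \<open>n\<close> to
  cardinals is impossible, because \<^const>\<open>cardSuc\<close> changes the type of its argument.
  Nothing is lost by taking the predecessor \<open>\<mu>\<close> on the same type as \<open>\<kappa>\<close>, since a smaller cardinal
  can always be realised inside a larger one; see \<open>is_aleph_ordIso\<close> and \<open>is_aleph_unique\<close>.
\<close>

primrec is_aleph :: "nat \<Rightarrow> 'a rel \<Rightarrow> bool" where
  "is_aleph 0 \<kappa> \<longleftrightarrow> Card_order \<kappa> \<and> \<kappa> =o natLeq"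
| "is_aleph (Suc n) \<kappa> \<longleftrightarrow>
     Card_order \<kappa> \<and> (\<exists>\<mu> :: 'a rel. is_aleph n \<mu> \<and> \<kappa> =o cardSuc \<mu>)"

definition succ_elem :: "'k rel \<Rightarrow> 'k \<Rightarrow> bool" where
  "succ_elem \<kappa> \<nu> \<longleftrightarrow> (\<exists>\<mu> \<in> Field \<kappa>. underS \<kappa> \<nu> = under \<kappa> \<mu>)"

text \<open>The least element of \<open>\<kappa>\<close>, i.e. the ordinal 0, is neither a successor nor a limit.\<close>

definition limit_elem :: "'k rel \<Rightarrow> 'k \<Rightarrow> bool" where
  "limit_elem \<kappa> \<nu> \<longleftrightarrow> \<nu> \<in> Field \<kappa> \<and> underS \<kappa> \<nu> \<noteq> {} \<and> \<not> succ_elem \<kappa> \<nu>"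

text \<open>A basis of a group can be taken inside the group, so quantifying over \<open>B :: 'a set\<close> only
  is no restriction.\<close>

definition free_abelian :: "('a, 'm) monoid_scheme \<Rightarrow> bool" where
  "free_abelian G \<longleftrightarrow> (\<exists>B :: 'a set. G \<cong> free_Abelian_group B)"

definition filtration ::
  "'k rel \<Rightarrow> ('a, 'm) monoid_scheme \<Rightarrow> ('k \<Rightarrow> 'a set) \<Rightarrow> bool" where
  "filtration \<kappa> G F \<longleftrightarrow>
     (\<forall>\<nu> \<in> Field \<kappa>. subgroup (F \<nu>) G \<and> |F \<nu>| <o \<kappa>) \<and>
     (\<forall>\<mu> \<nu>. (\<mu>, \<nu>) \<in> \<kappa> \<longrightarrow> F \<mu> \<subseteq> F \<nu>) \<and>
     (\<forall>\<nu>. limit_elem \<kappa> \<nu> \<longrightarrow> F \<nu> = (\<Union>\<mu> \<in> underS \<kappa> \<nu>. F \<mu>)) \<and>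
     (\<Union>\<nu> \<in> Field \<kappa>. F \<nu>) = carrier G"

definition strongly_free :: "'k rel \<Rightarrow> ('a, 'm) monoid_scheme \<Rightarrow> bool" where
  "strongly_free \<kappa> G \<longleftrightarrow>
     Card_order \<kappa> \<and> natLeq <o \<kappa> \<and> comm_group G \<and> |carrier G| =o \<kappa> \<and>
     (\<exists>F. filtration \<kappa> G F \<and>
        (\<forall>\<nu> \<in> Field \<kappa>. free_abelian (G\<lparr>carrier := F \<nu>\<rparr>)) \<and>
        (\<forall>\<nu> \<rho>. succ_elem \<kappa> \<nu> \<and> \<nu> \<in> underS \<kappa> \<rho> \<longrightarrow>
           free_abelian (G\<lparr>carrier := F \<rho>\<rparr> Mod F \<nu>)))"

definition trivial_dual :: "('a, 'm) monoid_scheme \<Rightarrow> bool" where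
  "trivial_dual G \<longleftrightarrow> (\<forall>h \<in> hom G integer_group. \<forall>x \<in> carrier G. h x = 0)"

lemma is_aleph_Card_order: "is_aleph n \<kappa> \<Longrightarrow> Card_order \<kappa>"
  by (cases n) auto

lemma is_aleph_unique:
  fixes \<kappa> :: "'a rel" and \<mu> :: "'b rel"
  shows "is_aleph n \<kappa> \<Longrightarrow> is_aleph n \<mu> \<Longrightarrow> \<kappa> =o \<mu>"
proof (induction n arbitrary: \<kappa> \<mu>)
  case 0
  then show ?case using ordIso_transitive[OF _ ordIso_symmetric, of \<kappa> natLeq \<mu>] by simp
next
  case (Suc n)
  then obtain \<kappa>' :: "'a rel" and \<mu>' :: "'b rel"
    where *: "is_aleph n \<kappa>'" "\<kappa> =o cardSuc \<kappa>'" "is_aleph n \<mu>'" "\<mu> =o cardSuc \<mu>'"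
    by auto
  then have "cardSuc \<kappa>' =o cardSuc \<mu>'"
    using Suc.IH[of \<kappa>' \<mu>'] cardSuc_invar_ordIso[of \<kappa>' \<mu>']
      is_aleph_Card_order[of n \<kappa>'] is_aleph_Card_order[of n \<mu>'] by simp
  then show ?case
    using ordIso_transitive[OF ordIso_transitive[OF *(2)] ordIso_symmetric[OF *(4)]] by simp
qed

lemma is_aleph_ordIso:
  fixes \<kappa> :: "'a rel" and \<mu> :: "'b rel"
  shows "is_aleph n \<kappa> \<Longrightarrow> \<mu> =o \<kappa> \<Longrightarrow> is_aleph n \<mu>"
proof (induction n arbitrary: \<kappa> \<mu>)
  case 0
  then show ?case using Card_order_ordIso[of \<kappa> \<mu>] ordIso_transitive[of \<mu> \<kappa> natLeq] by simp
next
  case (Suc n)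
  then obtain \<kappa>' :: "'a rel" where *: "is_aleph n \<kappa>'" "\<kappa> =o cardSuc \<kappa>'" by auto
  have co: "Card_order \<kappa>'" "Card_order \<kappa>" "Card_order \<mu>"
    using is_aleph_Card_order[OF *(1)] is_aleph_Card_order[OF Suc.prems(1)]
      Card_order_ordIso[OF _ Suc.prems(2)] by simp_all
  have "\<kappa>' \<le>o \<mu>"
    by (rule ordLeq_ordIso_trans[OF cardSuc_ordLeq[OF co(1)]
          ordIso_symmetric[OF ordIso_transitive[OF Suc.prems(2) *(2)]]])
  then have "|Field \<kappa>'| \<le>o |Field \<mu>|"
    using co card_of_mono2 by blast
  then obtain f where f: "inj_on f (Field \<kappa>')" "f ` Field \<kappa>' \<subseteq> Field \<mu>"
    using card_of_ordLeq[of "Field \<kappa>'" "Field \<mu>"] by blast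
  have "|f ` Field \<kappa>'| =o |Field \<kappa>'|"
    using card_of_ordIsoI[OF inj_on_imp_bij_betw[OF f(1)]] by (rule ordIso_symmetric)
  then have iso: "|f ` Field \<kappa>'| =o \<kappa>'"
    by (rule ordIso_transitive[OF _ card_of_Field_ordIso[OF co(1)]])
  then have "is_aleph n |f ` Field \<kappa>'|"
    by (rule Suc.IH[OF *(1)])
  moreover have "\<mu> =o cardSuc |f ` Field \<kappa>'|"
    using cardSuc_invar_ordIso[OF co(1) card_of_Card_order, of "f ` Field \<kappa>'"]
      ordIso_symmetric[OF iso] ordIso_transitive[OF ordIso_transitive[OF Suc.prems(2) *(2)]]
    by simp
  ultimately show ?case using co(3) is_aleph.simps(2) by blast
qed

text \<open>Every aleph-n is realised on some type: iterate the power type, starting from \<^typ>\<open>nat\<close>.\<close>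

lemma is_aleph_0_natLeq: "is_aleph 0 natLeq"
  by (simp add: natLeq_Card_order ordIso_reflexive natLeq_Well_order)

lemma is_aleph_Suc_cardSuc:
  fixes \<kappa> :: "'a rel"
  assumes "is_aleph n \<kappa>"
  shows "is_aleph (Suc n) (cardSuc \<kappa>)"
proof -
  let ?m = "|(\<lambda>x. {x}) ` Field \<kappa>| :: 'a set rel"
  have co: "Card_order \<kappa>" by (rule is_aleph_Card_order[OF assms])
  have "|Field \<kappa>| =o ?m"
    by (rule card_of_ordIsoI[OF inj_on_imp_bij_betw]) (simp add: inj_on_def)
  then have m: "?m =o \<kappa>"
    by (rule ordIso_transitive[OF ordIso_symmetric card_of_Field_ordIso[OF co]])
  have "cardSuc \<kappa> =o cardSuc ?m"
    by (rule iffD2[OF cardSuc_invar_ordIso[OF co card_of_Card_order] ordIso_symmetric[OF m]])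
  then show ?thesis
    using is_aleph_ordIso[OF assms m] cardSuc_Card_order[OF co] is_aleph.simps(2) by blast
qed

end

theory Submission
  imports Defs Complex_Main "HOL-Library.Function_Algebras" "HOL-Library.Countable_Set_Type"
begin

text \<open>
  The group is generated inside a rational vector space by basis vectors \<open>e x\<close> and, for every tuple
  \<open>\<eta>\<close> of \<open>n\<close> branches (sequences), by elements \<open>y \<eta> k\<close> subject to \<open>y \<eta> k = (k + 2) y \<eta> (k + 1) + t \<eta> k\<close>.
  Here \<open>t \<eta> k\<close> is the sum of those \<open>e x\<close> whose index \<open>x\<close> arises from \<open>\<eta>\<close> by cutting one of the branches
  at \<open>k\<close>, plus possibly one further generator \<open>e (a \<eta>)\<close>; a Boolean \<open>g \<eta>\<close> decides whether it is added.
  A homomorphism into the integers can satisfy these relations for at most one value of \<open>g \<eta>\<close> unless it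
  kills \<open>e (a \<eta>)\<close>. So the dual is trivial if \<open>g\<close> predicts, for every function on the indices and every
  \<open>x\<close>, the wrong answer at some \<open>\<eta>\<close> with \<open>a \<eta> = x\<close>. For \<open>n \<ge> 2\<close> this is Shelah's \<open>n\<close>-dimensional black
  box: later entries of a branch encode the values at its shorter cuts. For \<open>n = 1\<close> one branch is attached
  per limit ordinal and point, and the prediction is the weak diamond of Devlin and Shelah.

  Freeness holds because any aleph-\<open>(n - 1)\<close> many tuples can be ordered so that each tuple has a
  coordinate whose cuts are eventually not used by earlier tuples: one coordinate is given up at each
  cardinal step, and the remaining one settles the countable case.
\<close>

section \<open>Free abelian groups\<close>

text \<open>Two demands pull against each other: there must be enough tuples to answer every
  function on the indices, yet a stage of the filtration may contain fewer than aleph-n of them. For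
  \<open>n \<ge> 2\<close> even all sequences below a given bound are affordable, because the
  hypothesis at \<open>n - 2\<close> makes aleph-(n - 1) stable under countable powers. For
  \<open>n = 1\<close> a countable bound already carries aleph-1 many sequences; branches must then
  be chosen so sparsely that they cannot encode values, and what remains is to guess one bit per
  limit ordinal. The filtration measures a tuple by the size of its last branch alone. A branch that
  is cofinal in a limit ordinal enters only after that limit. This keeps the chain continuous, and
  it is the reason why quotients are controlled over successor stages only, which is just what
  strong freeness asks for.\<close>

lemma free_abelianI:
  assumes "group G" and "\<psi> \<in> iso (free_Abelian_group I) G"
  shows "free_abelian G"
proof -
  \<comment> \<open>\<open>free_abelian\<close> wants an index set on the type of the group itself,
    whereas later bases are indexed by pairs and points; the images of the generators serve as their
    names.\<close>
  let ?B = "(\<psi> \<circ> frag_of) ` I"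
  have "inj_on (\<psi> \<circ> frag_of) I"
  proof (rule inj_onI)
    fix x y assume "x \<in> I" "y \<in> I" "(\<psi> \<circ> frag_of) x = (\<psi> \<circ> frag_of) y"
    then have "frag_of x = frag_of y"
      using assms(2) by (auto simp: iso_def bij_betw_def dest: inj_onD)
    then show "x = y" by (simp add: frag_of_eq)
  qed
  then have "I \<approx> ?B"
    using eqpoll_def inj_on_imp_bij_betw by blast
  then have "free_Abelian_group I \<cong> free_Abelian_group ?B"
    by (simp add: isomorphic_free_Abelian_groups)
  moreover have "G \<cong> free_Abelian_group I"
    using assms group.iso_sym[OF group_free_Abelian_group] by (auto simp: is_iso_def)
  ultimately show ?thesis
    unfolding free_abelian_def using iso_trans by blast
qed

lemma free_abelian_ModI:
  assumes "comm_group H" and N: "subgroup N H" and \<phi>: "\<phi> \<in> hom (free_Abelian_group I) H"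
    and gen: "\<And>h. h \<in> carrier H \<Longrightarrow> \<exists>p \<in> carrier (free_Abelian_group I). \<exists>u \<in> N. h = u \<otimes>\<^bsub>H\<^esub> \<phi> p"
    and ind: "\<And>p. p \<in> carrier (free_Abelian_group I) \<Longrightarrow> \<phi> p \<in> N \<Longrightarrow> p = 0"
  shows "free_abelian (H Mod N)"
proof -
  interpret H: comm_group H by fact
  have nN: "N \<lhd> H"
    using N by (rule H.subgroup_imp_normal)
  interpret Q: group "H Mod N"
    using nN by (rule normal.factorgroup_is_group)
  let ?\<psi> = "(\<lambda>h. N #>\<^bsub>H\<^esub> h) \<circ> \<phi>"
  have hom: "?\<psi> \<in> hom (free_Abelian_group I) (H Mod N)"
    by (rule hom_compose[OF \<phi> normal.r_coset_hom_Mod[OF nN]])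
  interpret h: group_hom "free_Abelian_group I" "H Mod N" ?\<psi>
    by (rule group_hom.intro[OF group_free_Abelian_group Q.is_group group_hom_axioms.intro[OF hom]])
  have \<phi>c: "\<phi> p \<in> carrier H" if "p \<in> carrier (free_Abelian_group I)" for p
    using \<phi> that by (auto simp: hom_def)
  have "inj_on ?\<psi> (carrier (free_Abelian_group I))"
    unfolding h.inj_iff_trivial_ker
  proof
    show "kernel (free_Abelian_group I) (H Mod N) ?\<psi> \<subseteq> {\<one>\<^bsub>free_Abelian_group I\<^esub>}"
    proof
      fix p assume "p \<in> kernel (free_Abelian_group I) (H Mod N) ?\<psi>"
      then have p: "p \<in> carrier (free_Abelian_group I)" and "N #>\<^bsub>H\<^esub> \<phi> p = N"
        by (auto simp: kernel_def FactGroup_def)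
      then have "\<phi> p \<in> N"
        using H.rcos_self[OF \<phi>c[OF p] N] by simp
      then show "p \<in> {\<one>\<^bsub>free_Abelian_group I\<^esub>}"
        using ind p by simp
    qed
  qed (use h.hom_one in \<open>simp add: kernel_def\<close>)
  moreover have "?\<psi> ` carrier (free_Abelian_group I) = carrier (H Mod N)"
  proof
    show "carrier (H Mod N) \<subseteq> ?\<psi> ` carrier (free_Abelian_group I)"
    proof
      fix X assume "X \<in> carrier (H Mod N)"
      then obtain h where h: "h \<in> carrier H" "X = N #>\<^bsub>H\<^esub> h"
        by (auto simp: FactGroup_def RCOSETS_def)
      then obtain p u where p: "p \<in> carrier (free_Abelian_group I)" "u \<in> N" "h = u \<otimes>\<^bsub>H\<^esub> \<phi> p"
        using gen by blast
      have uc: "u \<in> carrier H" using p(2) N subgroup.mem_carrier by fast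
      have "X = N #>\<^bsub>H\<^esub> u #>\<^bsub>H\<^esub> \<phi> p"
        unfolding h(2) p(3) using H.coset_mult_assoc[OF subgroup.subset[OF N] uc \<phi>c[OF p(1)]] by simp
      also have "N #>\<^bsub>H\<^esub> u = N"
        using N p(2) by (simp add: H.coset_join2 uc)
      finally show "X \<in> ?\<psi> ` carrier (free_Abelian_group I)"
        using p(1) by auto
    qed
  qed (use h.hom_closed in blast)
  ultimately have "?\<psi> \<in> iso (free_Abelian_group I) (H Mod N)"
    using hom by (simp add: iso_def bij_betw_def)
  then show ?thesis
    using free_abelianI Q.is_group by blast
qed

section \<open>Divisibility recursions over the integers\<close>

definition solvable :: "(nat \<Rightarrow> int) \<Rightarrow> bool" where
  "solvable u \<longleftrightarrow> (\<exists>y. \<forall>k. y k = (int k + 2) * y (Suc k) + u k)"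

text \<open>Multipliers of at least 2 keep \<open>\<bar>y k\<bar>\<close> bounded by
  \<open>\<bar>y 0\<bar> + \<bar>z\<bar>\<close>. As the multipliers also grow without bound, a
  nonzero value at a late place would make its predecessor too large.\<close>

lemma solution_eventually_zero:
  fixes y :: "nat \<Rightarrow> int"
  assumes y: "\<And>k. y k = (int k + 2) * y (Suc k) + z"
  shows "\<exists>k. y k = 0 \<and> y (Suc k) = 0"
proof -
  have b: "\<bar>y k\<bar> \<le> \<bar>y 0\<bar> + \<bar>z\<bar>" for k
  proof (induction k)
    case (Suc k)
    have "2 * \<bar>y (Suc k)\<bar> \<le> (int k + 2) * \<bar>y (Suc k)\<bar>" by (intro mult_right_mono) auto
    also have "\<dots> = \<bar>y k - z\<bar>" using y[of k] by (simp add: abs_mult)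
    also have "\<dots> \<le> 2 * (\<bar>y 0\<bar> + \<bar>z\<bar>)" using Suc by (smt (verit))
    finally show ?case by simp
  qed simp
  have zero: "y (Suc k) = 0" if k: "int k \<ge> \<bar>y 0\<bar> + 2 * \<bar>z\<bar>" for k
  proof (rule ccontr)
    assume "y (Suc k) \<noteq> 0"
    then have "(int k + 2) * 1 \<le> (int k + 2) * \<bar>y (Suc k)\<bar>" by (intro mult_left_mono) auto
    also have "\<dots> = \<bar>y k - z\<bar>" using y[of k] by (simp add: abs_mult)
    also have "\<dots> \<le> \<bar>y 0\<bar> + 2 * \<bar>z\<bar>" using b[of k] abs_triangle_ineq4[of "y k" z] abs_ge_zero[of "y 0"]
      by linarith
    finally show False using k by simp
  qed
  define m where "m = nat (\<bar>y 0\<bar> + 2 * \<bar>z\<bar>)"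
  have "y (Suc m) = 0" "y (Suc (Suc m)) = 0"
    by (rule zero; simp add: m_def)+
  then show ?thesis by blast
qed

text \<open>Two consecutive zeros give \<open>z = 0\<close>. After that a zero spreads upwards
  because \<open>k + 2\<close> is nonzero, and downwards by the recursion itself.\<close>

lemma const_solution_zero:
  fixes y :: "nat \<Rightarrow> int"
  assumes y: "\<And>k. y k = (int k + 2) * y (Suc k) + z"
  shows "z = 0" "y k = 0"
proof -
  obtain j where j: "y j = 0" "y (Suc j) = 0"
    using solution_eventually_zero[of y z, OF y] by blast
  show z: "z = 0"
    using y[of j] j by simp
  have *: "y k = 0" if "y (k + j) = 0" for j k
    using that
  proof (induction j arbitrary: k)
    case (Suc j)
    then show ?case using Suc.IH[of "Suc k"] y[of k] z by simp
  qed simp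
  show "y k = 0"
  proof -
    have "\<exists>i. y (k + i) = 0 \<and> y (Suc (k + i)) = 0"
    proof -
      have up: "y (j + i) = 0" for i
      proof (induction i)
        case (Suc i)
        then show ?case using y[of "j + i"] z by (simp add: add_nonneg_pos)
      qed (use j in simp)
      show ?thesis using up[of k] up[of "Suc k"] by (intro exI[of _ j]) (simp add: add.commute)
    qed
    then show ?thesis using * by blast
  qed
qed

text \<open>Subtracting two solutions cancels \<open>u\<close> and leaves a recursion with constant
  term \<open>z\<close>. In the application \<open>z\<close> is the value of a homomorphism at
  \<open>e (a \<eta>)\<close>.\<close>

lemma not_both_solvable:
  assumes "solvable u" "solvable (\<lambda>k. u k + z)"
  shows "z = 0"
proof -
  obtain y y' where y: "\<And>k. y k = (int k + 2) * y (Suc k) + u k"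
    and y': "\<And>k. y' k = (int k + 2) * y' (Suc k) + (u k + z)"
    using assms unfolding solvable_def by blast
  have "y' k - y k = (int k + 2) * (y' (Suc k) - y (Suc k)) + z" for k
    using y[of k] y'[of k] by (simp add: algebra_simps)
  then show ?thesis by (rule const_solution_zero(1))
qed

section \<open>Integer combinations of rational-valued functions\<close>

definition zscale :: "int \<Rightarrow> ('z \<Rightarrow> rat) \<Rightarrow> 'z \<Rightarrow> rat" where
  "zscale c v = (\<lambda>z. of_int c * v z)"

text \<open>With integers as scalars, \<open>Z.subspace\<close> means subgroup and
  \<open>Z.span\<close> the subgroup generated. Rational values are there so that the recursion
  between the generators can be solved by division.\<close>

interpretation Z: module zscale
  by unfold_locales (auto simp: zscale_def fun_eq_iff algebra_simps)

lemma sum_fun_apply: "(\<Sum>i\<in>A. f i) z = (\<Sum>i\<in>A. f i z)" for f :: "'i \<Rightarrow> 'z \<Rightarrow> 'b::comm_monoid_add"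
  by (induction A rule: infinite_finite_induct) auto

definition lincomb :: "('i \<Rightarrow> 'z \<Rightarrow> rat) \<Rightarrow> ('i \<Rightarrow>\<^sub>0 int) \<Rightarrow> 'z \<Rightarrow> rat" where
  "lincomb v p = (\<Sum>i\<in>Poly_Mapping.keys p. zscale (Poly_Mapping.lookup p i) (v i))"

lemma lincomb_superset:
  assumes "finite A" "Poly_Mapping.keys p \<subseteq> A"
  shows "lincomb v p = (\<Sum>i\<in>A. zscale (Poly_Mapping.lookup p i) (v i))"
  unfolding lincomb_def
  by (rule sum.mono_neutral_left) (use assms in \<open>auto simp: in_keys_iff\<close>)

lemma lincomb_add: "lincomb v (p + q) = lincomb v p + lincomb v q"
proof -
  let ?A = "Poly_Mapping.keys p \<union> Poly_Mapping.keys q"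
  have "lincomb v (p + q) = (\<Sum>i\<in>?A. zscale (Poly_Mapping.lookup (p + q) i) (v i))"
    by (rule lincomb_superset) (auto simp: keys_add)
  also have "\<dots> = (\<Sum>i\<in>?A. zscale (Poly_Mapping.lookup p i) (v i)) + (\<Sum>i\<in>?A. zscale (Poly_Mapping.lookup q i) (v i))"
    by (simp add: lookup_add Z.scale_left_distrib sum.distrib)
  also have "\<dots> = lincomb v p + lincomb v q"
    by (simp flip: lincomb_superset)
  finally show ?thesis .
qed

lemma lincomb_frag_of [simp]: "lincomb v (frag_of i) = v i"
  by (simp add: lincomb_def)

lemma lincomb_0 [simp]: "lincomb v 0 = 0"
  by (simp add: lincomb_def)

lemma lincomb_frag_cmul: "lincomb v (frag_cmul c p) = zscale c (lincomb v p)"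
proof -
  have "lincomb v (frag_cmul c p) = (\<Sum>i\<in>Poly_Mapping.keys p. zscale (Poly_Mapping.lookup (frag_cmul c p) i) (v i))"
    by (rule lincomb_superset) (auto simp: keys_cmul)
  then show ?thesis
    by (simp add: lincomb_def Z.scale_sum_right)
qed

lemma lincomb_apply: "lincomb v p z = (\<Sum>i\<in>Poly_Mapping.keys p. of_int (Poly_Mapping.lookup p i) * v i z)"
  by (simp add: lincomb_def sum_fun_apply zscale_def)

lemma lincomb_in_subspace:
  assumes "Z.subspace W" "\<And>i. i \<in> I \<Longrightarrow> v i \<in> W" "Poly_Mapping.keys p \<subseteq> I"
  shows "lincomb v p \<in> W"
  unfolding lincomb_def using assms by (intro Z.subspace_sum Z.subspace_scale) auto

section \<open>Root systems\<close>

text \<open>\<open>X m \<eta> k\<close> stands for the cut of branch \<open>m\<close> of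
  \<open>\<eta>\<close> at \<open>k\<close>. Injectivity is asked within a single
  \<open>\<eta>\<close> only: distinct tuples may share indices, and freeness depends on controlling
  this sharing.\<close>

locale root_system =
  fixes n :: nat and X :: "nat \<Rightarrow> 'l \<Rightarrow> nat \<Rightarrow> 'x" and a :: "'l \<Rightarrow> 'x" and g :: "'l \<Rightarrow> bool"
  assumes X_inj: "\<And>m m' \<eta> k k'. m < n \<Longrightarrow> m' < n \<Longrightarrow> X m \<eta> k = X m' \<eta> k' \<Longrightarrow> m = m' \<and> k = k'"
begin

definition e :: "'x \<Rightarrow> 'x + 'l \<Rightarrow> rat" where
  "e x = (\<lambda>z. of_bool (z = Inl x))"

definition t :: "'l \<Rightarrow> nat \<Rightarrow> 'x + 'l \<Rightarrow> rat" where
  "t \<eta> k = (\<Sum>m<n. e (X m \<eta> k)) + (if g \<eta> then e (a \<eta>) else 0)"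

text \<open>Closed form of the recursion, solved for the next element and started at the unit vector
  of \<open>Inr \<eta>\<close>. This coordinate is private to \<open>\<eta>\<close>, so different
  tuples can be told apart.\<close>

definition y :: "'l \<Rightarrow> nat \<Rightarrow> 'x + 'l \<Rightarrow> rat" where
  "y \<eta> k = (\<lambda>z. (of_bool (z = Inr \<eta>) - (\<Sum>j<k. fact (Suc j) * t \<eta> j z)) / fact (Suc k))"

definition supp :: "'l \<Rightarrow> 'x set" where
  "supp \<eta> = insert (a \<eta>) {X m \<eta> k | m k. m < n}"

definition span_of :: "'l set \<Rightarrow> ('x + 'l \<Rightarrow> rat) set" where
  "span_of U = Z.span (e ` (\<Union>(supp ` U)) \<union> {y \<eta> k | \<eta> k. \<eta> \<in> U})"

lemma X_supp: "m < n \<Longrightarrow> X m \<eta> k \<in> supp \<eta>"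
  by (auto simp: supp_def)

lemma a_supp: "a \<eta> \<in> supp \<eta>"
  by (auto simp: supp_def)

lemma subspace_span_of: "Z.subspace (span_of U)"
  by (simp add: span_of_def)

lemma e_span_of: "x \<in> supp \<eta> \<Longrightarrow> \<eta> \<in> U \<Longrightarrow> e x \<in> span_of U"
  unfolding span_of_def by (intro Z.span_base) auto

lemma y_span_of: "\<eta> \<in> U \<Longrightarrow> y \<eta> k \<in> span_of U"
  unfolding span_of_def by (intro Z.span_base) auto

lemma span_of_least:
  assumes "Z.subspace W" "\<And>x \<eta>. \<eta> \<in> U \<Longrightarrow> x \<in> supp \<eta> \<Longrightarrow> e x \<in> W" "\<And>\<eta> k. \<eta> \<in> U \<Longrightarrow> y \<eta> k \<in> W"
  shows "span_of U \<subseteq> W"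
  unfolding span_of_def by (rule Z.span_minimal) (use assms in auto)

lemma span_of_mono: "U \<subseteq> V \<Longrightarrow> span_of U \<subseteq> span_of V"
  by (rule span_of_least[OF subspace_span_of]) (auto intro: e_span_of y_span_of)

lemma y_rec: "y \<eta> k = zscale (int k + 2) (y \<eta> (Suc k)) + t \<eta> k"
proof
  fix z
  have pos: "(of_nat k + 2 :: rat) \<noteq> 0" "(fact (Suc k) :: rat) \<noteq> 0"
    by (metis add.commute of_nat_numeral of_nat_add of_nat_eq_0_iff add_is_0 zero_neq_numeral) simp
  have f: "(fact (Suc (Suc k)) :: rat) = (of_nat k + 2) * fact (Suc k)"
    by (simp add: algebra_simps)
  have "of_int (int k + 2) * (u / fact (Suc (Suc k))) = u / fact (Suc k)" for u :: rat
    unfolding f using nonzero_mult_divide_mult_cancel_left[OF pos(1), of u "fact (Suc k)"]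
    by (simp del: fact_Suc)
  then have "zscale (int k + 2) (y \<eta> (Suc k)) z
      = (of_bool (z = Inr \<eta>) - (\<Sum>j<Suc k. fact (Suc j) * t \<eta> j z)) / fact (Suc k)"
    by (simp only: zscale_def y_def)
  then show "y \<eta> k z = (zscale (int k + 2) (y \<eta> (Suc k)) + t \<eta> k) z"
    using pos(2) by (simp add: y_def field_simps del: fact_Suc)
qed

lemma e_Inr [simp]: "e x (Inr \<eta>) = 0"
  by (simp add: e_def)

lemma e_Inl: "e x (Inl x') = of_bool (x' = x)"
  by (simp add: e_def)

lemma t_Inr [simp]: "t \<eta> k (Inr \<eta>') = 0"
  by (simp add: t_def sum_fun_apply)

lemma t_outside: "x \<notin> supp \<eta> \<Longrightarrow> t \<eta> k (Inl x) = 0"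
  using X_supp a_supp by (auto simp: t_def sum_fun_apply e_Inl intro!: sum.neutral)

lemma t_X:
  assumes "m < n" "X m \<eta> j \<noteq> a \<eta>"
  shows "t \<eta> k (Inl (X m \<eta> j)) = of_bool (k = j)"
proof -
  have "(\<Sum>m'<n. e (X m' \<eta> k) (Inl (X m \<eta> j))) = (\<Sum>m'<n. if m' = m then of_bool (k = j) else 0)"
  proof (rule sum.cong)
    fix m' assume "m' \<in> {..<n}"
    then show "e (X m' \<eta> k) (Inl (X m \<eta> j)) = (if m' = m then of_bool (k = j) else 0)"
      using X_inj[of m m' \<eta> j k] assms(1) by (auto simp: e_Inl)
  qed simp
  then show ?thesis
    using assms by (simp add: t_def sum_fun_apply e_Inl)
qed

lemma y_Inr: "y \<eta> k (Inr \<eta>') = of_bool (\<eta>' = \<eta>) / fact (Suc k)"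
  by (simp add: y_def)

lemma y_outside: "x \<notin> supp \<eta> \<Longrightarrow> y \<eta> k (Inl x) = 0"
  by (simp add: y_def t_outside)

text \<open>The index occurs in \<open>t \<eta> j\<close> only, with coefficient 1. It is thus
  visible in \<open>y \<eta> k\<close> exactly for \<open>k > j\<close>, which separates the
  elements belonging to one \<open>\<eta>\<close> in the independence proof.\<close>

lemma y_X:
  assumes "m < n" "X m \<eta> j \<noteq> a \<eta>"
  shows "y \<eta> k (Inl (X m \<eta> j)) = (if j < k then - fact (Suc j) / fact (Suc k) else 0)"
proof -
  have "(\<Sum>i<k. fact (Suc i) * t \<eta> i (Inl (X m \<eta> j))) = (\<Sum>i<k. if i = j then fact (Suc j) else 0 :: rat)"
    using assms by (intro sum.cong) (auto simp: t_X)
  then show ?thesis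
    by (simp add: y_def del: fact_Suc)
qed

lemma span_of_Inr: "v \<in> span_of U \<Longrightarrow> \<eta> \<notin> U \<Longrightarrow> v (Inr \<eta>) = 0"
  unfolding span_of_def
  by (induction rule: Z.span_induct_alt) (auto simp: zscale_def y_Inr)

lemma span_of_Inl: "v \<in> span_of U \<Longrightarrow> x \<notin> \<Union>(supp ` U) \<Longrightarrow> v (Inl x) = 0"
  unfolding span_of_def
  by (induction rule: Z.span_induct_alt) (auto simp: zscale_def y_outside e_Inl)

text \<open>From length \<open>K \<eta>\<close> on, the cuts of branch \<open>M \<eta>\<close>
  belong to \<open>\<eta>\<close>: they avoid everything used by \<open>U\<close>, and any other new
  tuple using one of them has to come after \<open>\<eta>\<close> in a well-founded order.\<close>

definition root_free :: "'l set \<Rightarrow> 'l set \<Rightarrow> bool" where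
  "root_free U V \<longleftrightarrow> (\<exists>M K. (\<forall>\<eta>\<in>V - U. M \<eta> < n \<and> (\<forall>k\<ge>K \<eta>. X (M \<eta>) \<eta> k \<notin> insert (a \<eta>) (\<Union>(supp ` U)))) \<and>
    wf {(\<eta>, \<eta>'). \<eta> \<in> V - U \<and> \<eta>' \<in> V - U \<and> \<eta> \<noteq> \<eta>' \<and> (\<exists>k\<ge>K \<eta>. X (M \<eta>) \<eta> k \<in> supp \<eta>')})"

text \<open>
  The basis of \<^term>\<open>span_of V\<close> over \<^term>\<open>span_of U\<close> consists of the \<^term>\<open>y \<eta> k\<close> with
  \<^term>\<open>k \<ge> K \<eta>\<close>, which make the generators \<^term>\<open>e (X (M \<eta>) \<eta> k)\<close> redundant, and of the other
  new \<^term>\<open>e x\<close>.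
\<close>

lemma root_free_basis:
  assumes UV: "U \<subseteq> V" and "root_free U V"
  shows "\<exists>(I :: ('l \<times> nat + 'x) set) v. (\<forall>i\<in>I. v i \<in> span_of V) \<and>
    (\<forall>u\<in>span_of V. \<exists>p. Poly_Mapping.keys p \<subseteq> I \<and> (\<exists>w\<in>span_of U. u = w + lincomb v p)) \<and>
    (\<forall>p. Poly_Mapping.keys p \<subseteq> I \<longrightarrow> lincomb v p \<in> span_of U \<longrightarrow> p = 0)"
proof -
  let ?D = "V - U"
  obtain M K where M: "\<And>\<eta>. \<eta> \<in> ?D \<Longrightarrow> M \<eta> < n"
    and fresh: "\<And>\<eta> k. \<eta> \<in> ?D \<Longrightarrow> k \<ge> K \<eta> \<Longrightarrow> X (M \<eta>) \<eta> k \<notin> \<Union>(supp ` U)"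
    and aK: "\<And>\<eta> k. \<eta> \<in> ?D \<Longrightarrow> k \<ge> K \<eta> \<Longrightarrow> X (M \<eta>) \<eta> k \<noteq> a \<eta>"
    and wf: "wf {(\<eta>, \<eta>'). \<eta> \<in> ?D \<and> \<eta>' \<in> ?D \<and> \<eta> \<noteq> \<eta>' \<and> (\<exists>k\<ge>K \<eta>. X (M \<eta>) \<eta> k \<in> supp \<eta>')}" (is "wf ?Q")
  proof -
    obtain M K where *: "\<forall>\<eta>\<in>V - U. M \<eta> < n \<and> (\<forall>k\<ge>K \<eta>. X (M \<eta>) \<eta> k \<notin> insert (a \<eta>) (\<Union>(supp ` U)))"
      and wf: "wf {(\<eta>, \<eta>'). \<eta> \<in> V - U \<and> \<eta>' \<in> V - U \<and> \<eta> \<noteq> \<eta>' \<and> (\<exists>k\<ge>K \<eta>. X (M \<eta>) \<eta> k \<in> supp \<eta>')}"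
      using assms(2) unfolding root_free_def by blast
    show ?thesis
      by (rule that[OF _ _ _ wf]) (use * in blast)+
  qed
  define R where "R = {X (M \<eta>) \<eta> k | \<eta> k. \<eta> \<in> ?D \<and> k \<ge> K \<eta>}"
  define I :: "('l \<times> nat + 'x) set"
    where "I = Inl ` {(\<eta>, k). \<eta> \<in> ?D \<and> k \<ge> K \<eta>} \<union> Inr ` (\<Union>(supp ` V) - \<Union>(supp ` U) - R)"
  define v where "v = case_sum (\<lambda>(\<eta>, k). y \<eta> k) e"
  have v: "v (Inl (\<eta>, k)) = y \<eta> k" "v (Inr x) = e x" for \<eta> k x
    by (simp_all add: v_def)
  have vV: "v i \<in> span_of V" if "i \<in> I" for i
    using that unfolding I_def by (auto simp: v intro: y_span_of e_span_of)
  define S where "S = {w + lincomb v p | w p. w \<in> span_of U \<and> Poly_Mapping.keys p \<subseteq> I}"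
  have subS: "Z.subspace S"
  proof (rule Z.subspaceI)
    show "0 \<in> S"
      unfolding S_def using Z.subspace_0[OF subspace_span_of]
      by (intro CollectI exI[of _ "0 :: _ \<Rightarrow> rat"] exI[of _ "0 :: _ \<Rightarrow>\<^sub>0 int"]) simp
  next
    fix u u' assume "u \<in> S" "u' \<in> S"
    then obtain w p w' p' where *: "w \<in> span_of U" "Poly_Mapping.keys p \<subseteq> I" "u = w + lincomb v p"
      "w' \<in> span_of U" "Poly_Mapping.keys p' \<subseteq> I" "u' = w' + lincomb v p'"
      unfolding S_def by blast
    have "u + u' = (w + w') + lincomb v (p + p')"
      using * by (simp add: lincomb_add algebra_simps)
    moreover have "w + w' \<in> span_of U" using * Z.subspace_add[OF subspace_span_of] by blast
    moreover have "Poly_Mapping.keys (p + p') \<subseteq> I" using * keys_add[of p p'] by blast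
    ultimately show "u + u' \<in> S" unfolding S_def by blast
  next
    fix c u assume "u \<in> S"
    then obtain w p where *: "w \<in> span_of U" "Poly_Mapping.keys p \<subseteq> I" "u = w + lincomb v p"
      unfolding S_def by blast
    have "zscale c u = zscale c w + lincomb v (frag_cmul c p)"
      using * by (simp add: lincomb_frag_cmul Z.scale_right_distrib)
    moreover have "zscale c w \<in> span_of U" using * Z.subspace_scale[OF subspace_span_of] by blast
    moreover have "Poly_Mapping.keys (frag_cmul c p) \<subseteq> I" using * keys_cmul[of c p] by blast
    ultimately show "zscale c u \<in> S" unfolding S_def by blast
  qed
  have US: "w \<in> S" if "w \<in> span_of U" for w
    unfolding S_def using that by (intro CollectI exI[of _ w] exI[of _ "0 :: _ \<Rightarrow>\<^sub>0 int"]) simp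
  have vS: "v i \<in> S" if "i \<in> I" for i
    unfolding S_def using that Z.subspace_0[OF subspace_span_of]
    by (intro CollectI exI[of _ "0 :: _ \<Rightarrow> rat"] exI[of _ "frag_of i"]) simp
  have yS: "y \<eta> k \<in> S" if "\<eta> \<in> ?D" "k \<ge> K \<eta>" for \<eta> k
    using vS[of "Inl (\<eta>, k)"] that by (auto simp: I_def v)
  \<comment> \<open>An index of \<open>\<eta>\<close> that belongs to another new tuple
    \<open>\<eta>'\<close> is covered by the induction hypothesis, since \<open>\<eta>'\<close> then
    precedes \<open>\<eta>\<close>.\<close>
  have gen: "(\<forall>x\<in>supp \<eta>. e x \<in> S) \<and> (\<forall>k. y \<eta> k \<in> S)" if "\<eta> \<in> ?D" for \<eta>
    using wf that
  proof (induction \<eta> rule: wf_induct_rule)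
    case (less \<eta>)
    have other: "e x \<in> S" if x: "x \<in> supp \<eta>" "\<And>k. k \<ge> K \<eta> \<Longrightarrow> x \<noteq> X (M \<eta>) \<eta> k" for x
    proof -
      consider "x \<in> \<Union>(supp ` U)" | "x \<in> R" | "x \<notin> \<Union>(supp ` U)" "x \<notin> R" by blast
      then show ?thesis
      proof cases
        case 1
        then show ?thesis by (auto intro: US e_span_of)
      next
        case 2
        then obtain \<eta>' k where "x = X (M \<eta>') \<eta>' k" "\<eta>' \<in> ?D" "k \<ge> K \<eta>'"
          unfolding R_def by blast
        moreover from this have "(\<eta>', \<eta>) \<in> ?Q" "x \<in> supp \<eta>'"
          using x less.prems M X_supp by auto
        ultimately show ?thesis using less.IH by blast
      next
        case 3
        then have "Inr x \<in> I" unfolding I_def using x less.prems by auto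
        then show ?thesis using vS[of "Inr x"] by (simp add: v)
      qed
    qed
    have aS: "e (a \<eta>) \<in> S"
      using other[OF a_supp] aK[OF less.prems] by metis
    \<comment> \<open>The generator has coefficient 1 in \<open>t \<eta> k\<close>, so the recursion
      at \<open>k\<close> can be solved for it.\<close>
    have main: "e (X (M \<eta>) \<eta> k) \<in> S" if k: "k \<ge> K \<eta>" for k
    proof -
      have m: "M \<eta> \<in> {..<n}" using M less.prems by simp
      have *: "e (X m \<eta> k) \<in> S" if "m \<in> {..<n} - {M \<eta>}" for m
      proof (rule other)
        show "X m \<eta> k \<in> supp \<eta>" using that X_supp by simp
        show "X m \<eta> k \<noteq> X (M \<eta>) \<eta> k'" for k' using X_inj[of m "M \<eta>" \<eta> k k'] that m by auto
      qed
      have "e (X (M \<eta>) \<eta> k) = y \<eta> k - zscale (int k + 2) (y \<eta> (Suc k))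
          - (\<Sum>m\<in>{..<n} - {M \<eta>}. e (X m \<eta> k)) - (if g \<eta> then e (a \<eta>) else 0)"
        using y_rec[of \<eta> k] sum.remove[OF _ m, of "\<lambda>m. e (X m \<eta> k)"]
        by (simp add: t_def algebra_simps)
      also have "\<dots> \<in> S"
        using aS yS[OF less.prems] k *
        by (intro Z.subspace_diff[OF subS] Z.subspace_scale[OF subS] Z.subspace_sum[OF subS])
          (auto intro: Z.subspace_0[OF subS])
      finally show ?thesis .
    qed
    have eS: "e x \<in> S" if "x \<in> supp \<eta>" for x
      using other[OF that] main by metis
    have "t \<eta> k \<in> S" for k
      unfolding t_def using eS X_supp a_supp
      by (intro Z.subspace_add[OF subS] Z.subspace_sum[OF subS]) (auto intro: Z.subspace_0[OF subS])
    then have step: "y \<eta> (Suc k) \<in> S \<Longrightarrow> y \<eta> k \<in> S" for k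
      using y_rec[of \<eta> k] Z.subspace_add[OF subS] Z.subspace_scale[OF subS] by metis
    have "y \<eta> k \<in> S" for k
    proof (cases "k \<ge> K \<eta>")
      case False
      then have "k \<le> K \<eta>" by simp
      then show ?thesis
        by (induction k rule: inc_induct) (use yS[OF less.prems] step in auto)
    qed (use yS less.prems in blast)
    then show ?case using eS by blast
  qed
  have VS: "span_of V \<subseteq> S"
  proof (rule span_of_least[OF subS])
    show "e x \<in> S" if "\<eta> \<in> V" "x \<in> supp \<eta>" for x \<eta>
      using gen[of \<eta>] US e_span_of that by blast
    show "y \<eta> k \<in> S" if "\<eta> \<in> V" for \<eta> k
      using gen[of \<eta>] US y_span_of that by blast
  qed
  have indep: "p = 0" if p: "Poly_Mapping.keys p \<subseteq> I" "lincomb v p \<in> span_of U" for p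
  proof -
    define c where "c = Poly_Mapping.lookup p"
    define E where "E = {\<eta>. \<exists>k. Inl (\<eta>, k) \<in> Poly_Mapping.keys p}"
    have finE: "finite E"
      by (rule finite_subset[OF _ finite_imageI[OF finite_keys, of "fst \<circ> projl" p]])
        (force simp: E_def)
    have ED: "\<eta> \<in> ?D \<and> k \<ge> K \<eta>" if "Inl (\<eta>, k) \<in> Poly_Mapping.keys p" for \<eta> k
      using that p(1) unfolding I_def by auto
    have "E = {}"
    proof (rule ccontr)
      assume "E \<noteq> {}"
      \<comment> \<open>As \<open>E\<close> is finite, the converse of the restricted relation is
        well-founded too. It yields a tuple \<open>\<eta>\<close> whose own late cuts occur in no
        other tuple of \<open>E\<close>.\<close>
      have "wf (?Q \<inter> E \<times> E)" by (rule wf_subset[OF wf]) simp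
      then have "wf ((?Q \<inter> E \<times> E)\<inverse>)"
        using finE by (intro finite_acyclic_wf_converse wf_acyclic) auto
      then obtain \<eta> where \<eta>: "\<eta> \<in> E" and max: "\<And>\<eta>'. (\<eta>, \<eta>') \<in> ?Q \<Longrightarrow> \<eta>' \<notin> E"
        using \<open>E \<noteq> {}\<close> unfolding wf_eq_minimal by (smt (verit) Int_iff SigmaI converse_iff all_not_in_conv)
      define S where "S = {k. Inl (\<eta>, k) \<in> Poly_Mapping.keys p}"
      have finS: "finite S"
        by (rule finite_subset[OF _ finite_imageI[OF finite_keys, of "snd \<circ> projl" p]])
          (force simp: S_def)
      have neS: "S \<noteq> {}" using \<eta> by (auto simp: S_def E_def)
      have \<eta>D: "\<eta> \<in> ?D" using \<eta> ED unfolding E_def by blast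
      define k1 where "k1 = Max S"
      have k1: "k1 \<in> S" "\<And>k. k \<in> S \<Longrightarrow> k \<le> k1" using finS neS by (auto simp: k1_def)
      have c1: "c (Inl (\<eta>, k1)) \<noteq> 0" using k1(1) by (simp add: S_def c_def in_keys_iff)
      show False
      \<comment> \<open>One coordinate reveals the coefficient of \<open>y \<eta> k1\<close>. If
        \<open>k1\<close> is the least admissible length, no other \<open>y \<eta> k\<close> occurs
        and \<open>Inr \<eta>\<close> shows it. Otherwise the cut at \<open>k1 - 1\<close> does: it
        is invisible to the shorter \<open>y \<eta> k\<close>, to the other tuples by maximality,
        and to the \<open>e x\<close> of the basis because it lies in \<open>R\<close>.\<close>
      proof (cases "k1 = K \<eta>")
        case True
        have S1: "k = k1" if "k \<in> S" for k using that k1(2) ED[of \<eta> k] True by (auto simp: S_def intro: antisym)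
        have "lincomb v p (Inr \<eta>) = (\<Sum>i\<in>Poly_Mapping.keys p. if i = Inl (\<eta>, k1) then of_int (c i) / fact (Suc k1) else 0)"
          unfolding lincomb_apply c_def
        proof (rule sum.cong)
          fix i assume "i \<in> Poly_Mapping.keys p"
          then show "of_int (Poly_Mapping.lookup p i) * v i (Inr \<eta>)
              = (if i = Inl (\<eta>, k1) then of_int (Poly_Mapping.lookup p i) / fact (Suc k1) else 0)"
            using S1 by (cases i) (auto simp: v_def y_Inr S_def)
        qed simp
        also have "\<dots> = of_int (c (Inl (\<eta>, k1))) / fact (Suc k1)"
          using k1(1) by (simp add: S_def)
        finally show False
          using span_of_Inr[OF p(2), of \<eta>] \<eta>D c1 by simp
      next
        case False
        then obtain j where j: "k1 = Suc j" "j \<ge> K \<eta>"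
          using ED[of \<eta> k1] k1(1) by (cases k1) (auto simp: S_def)
        let ?x = "X (M \<eta>) \<eta> j"
        have "lincomb v p (Inl ?x) = (\<Sum>i\<in>Poly_Mapping.keys p. if i = Inl (\<eta>, k1) then - of_int (c i) * fact (Suc j) / fact (Suc k1) else 0)"
          unfolding lincomb_apply c_def
        proof (rule sum.cong)
          fix i assume i: "i \<in> Poly_Mapping.keys p"
          show "of_int (Poly_Mapping.lookup p i) * v i (Inl ?x)
              = (if i = Inl (\<eta>, k1) then - of_int (Poly_Mapping.lookup p i) * fact (Suc j) / fact (Suc k1) else 0)"
          proof (cases i)
            case (Inr x)
            have "x \<notin> R" using i p(1) Inr by (auto simp: I_def)
            then have "x \<noteq> ?x" using \<eta>D j(2) unfolding R_def by blast
            then show ?thesis using Inr by (auto simp: v e_Inl)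
          next
            case (Inl q)
            obtain \<eta>' k where q: "q = (\<eta>', k)" by (cases q)
            show ?thesis
            proof (cases "\<eta>' = \<eta>")
              case True
              have "k \<le> k1" using k1(2)[of k] i Inl q True by (auto simp: S_def)
              then show ?thesis
                using Inl q True y_X[OF M[OF \<eta>D] aK[OF \<eta>D j(2)], of k] j(1) by (auto simp: v)
            next
              case False
              have \<eta>': "\<eta>' \<in> ?D" "\<eta>' \<in> E" using ED[of \<eta>' k] i Inl q by (auto simp: E_def)
              have "?x \<notin> supp \<eta>'" using max[of \<eta>'] False \<eta>' \<eta>D j(2) by blast
              then show ?thesis using Inl q False by (auto simp: v y_outside)
            qed
          qed
        qed simp
        also have "\<dots> = - of_int (c (Inl (\<eta>, k1))) * fact (Suc j) / fact (Suc k1)"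
          using k1(1) by (simp add: S_def)
        finally show False
          using span_of_Inl[OF p(2), of ?x] fresh[OF \<eta>D j(2)] c1 by simp
      qed
    qed
    then have noInl: "Inl q \<notin> Poly_Mapping.keys p" for q
      by (cases q) (auto simp: E_def)
    have "i \<notin> Poly_Mapping.keys p" for i
    proof
      assume i: "i \<in> Poly_Mapping.keys p"
      then obtain x where x: "i = Inr x" using noInl by (cases i) auto
      have "lincomb v p (Inl x) = (\<Sum>i'\<in>Poly_Mapping.keys p. if i' = i then of_int (c i') else 0)"
        unfolding lincomb_apply c_def
      proof (rule sum.cong)
        fix i' assume "i' \<in> Poly_Mapping.keys p"
        then show "of_int (Poly_Mapping.lookup p i') * v i' (Inl x) = (if i' = i then of_int (Poly_Mapping.lookup p i') else 0)"
          using noInl x by (cases i') (auto simp: v e_Inl)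
      qed simp
      also have "\<dots> = of_int (c i)" using i by simp
      finally have "lincomb v p (Inl x) \<noteq> 0" using i by (simp add: c_def in_keys_iff)
      moreover have "x \<notin> \<Union>(supp ` U)" using i x p(1) by (auto simp: I_def)
      ultimately show False using span_of_Inl[OF p(2)] by blast
    qed
    then show "p = 0" by (metis all_not_in_conv keys_eq_empty)
  qed
  have "\<exists>p. Poly_Mapping.keys p \<subseteq> I \<and> (\<exists>w\<in>span_of U. u = w + lincomb v p)" if "u \<in> span_of V" for u
    using VS that unfolding S_def by blast
  then show ?thesis using vV indep by blast
qed

text \<open>
  Under a homomorphism the relations between the \<^term>\<open>y \<eta> k\<close> make a sequence \<^const>\<open>solvable\<close>, and
  \<^term>\<open>g \<eta>\<close> is chosen so that this forces the value at \<^term>\<open>a \<eta>\<close> to vanish.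
\<close>

lemma hom_vanishes:
  fixes h :: "('x + 'l \<Rightarrow> rat) \<Rightarrow> int"
  assumes add: "\<And>u v. u \<in> span_of L \<Longrightarrow> v \<in> span_of L \<Longrightarrow> h (u + v) = h u + h v"
    and pred: "\<And>f \<eta> x. \<eta> \<in> L \<Longrightarrow> x \<in> supp \<eta> \<Longrightarrow>
      \<exists>\<eta>'\<in>L. a \<eta>' = x \<and> (g \<eta>' \<longleftrightarrow> solvable (\<lambda>k. \<Sum>m<n. f (X m \<eta>' k)))"
    and v: "v \<in> span_of L"
  shows "h v = 0"
proof -
  note sub = subspace_span_of[of L]
  have h0: "h 0 = 0"
    using add[of 0 0] Z.subspace_0[OF sub] by simp
  have hneg: "h (- u) = - h u" if "u \<in> span_of L" for u
    using add[OF that Z.subspace_neg[OF sub that]] h0 by simp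
  have hnat: "h (zscale (int k) u) = int k * h u" if "u \<in> span_of L" for k u
  proof (induction k)
    case (Suc k)
    have "zscale (int (Suc k)) u = zscale (int k) u + u"
      by (simp add: zscale_def fun_eq_iff algebra_simps)
    then have "h (zscale (int (Suc k)) u) = int k * h u + h u"
      using Suc add[OF Z.subspace_scale[OF sub that, of "int k"] that] by (simp only:)
    also have "\<dots> = int (Suc k) * h u" by (simp add: algebra_simps)
    finally show ?case .
  next
    case 0
    have "zscale (int 0) u = 0" by (simp add: zscale_def fun_eq_iff)
    then show ?case by (simp only: h0)
  qed
  have hint: "h (zscale c u) = c * h u" if "u \<in> span_of L" for c u
  proof (cases "c \<ge> 0")
    case True
    then show ?thesis using hnat[OF that, of "nat c"] by simp
  next
    case False
    then have "h (zscale c u) = h (- zscale (int (nat (- c))) u)" by simp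
    also have "\<dots> = - h (zscale (int (nat (- c))) u)"
      by (rule hneg[OF Z.subspace_scale[OF sub that]])
    also have "\<dots> = c * h u" using hnat[OF that, of "nat (- c)"] False by simp
    finally show ?thesis .
  qed
  have hsum: "h (\<Sum>i\<in>A. u i) = (\<Sum>i\<in>A. h (u i))" if "\<And>i. i \<in> A \<Longrightarrow> u i \<in> span_of L" "finite A"
    for u :: "nat \<Rightarrow> _" and A
    using that(2,1)
  proof (induction A rule: finite_induct)
    case (insert i A)
    then have "h (u i + sum u A) = h (u i) + (\<Sum>i\<in>A. h (u i))"
      using add[of "u i" "sum u A"] Z.subspace_sum[OF sub, of A u] by simp
    then show ?case by (simp only: sum.insert[OF insert.hyps])
  qed (simp add: h0)
  have eL: "e (X m \<eta> k) \<in> span_of L" "e (a \<eta>) \<in> span_of L" if "\<eta> \<in> L" "m < n" for m \<eta> k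
    using that by (auto intro: e_span_of[OF X_supp] e_span_of[OF a_supp])
  have rec: "h (y \<eta> k) = (int k + 2) * h (y \<eta> (Suc k)) + ((\<Sum>m<n. h (e (X m \<eta> k))) + (if g \<eta> then h (e (a \<eta>)) else 0))"
    if \<eta>: "\<eta> \<in> L" for \<eta> k
  proof -
    have s: "(\<Sum>m<n. e (X m \<eta> k)) \<in> span_of L"
      using eL[OF \<eta>] by (intro Z.subspace_sum[OF sub]) auto
    have a': "(if g \<eta> then e (a \<eta>) else 0) \<in> span_of L"
      using e_span_of[OF a_supp \<eta>] Z.subspace_0[OF sub] by simp
    have "h (t \<eta> k) = (\<Sum>m<n. h (e (X m \<eta> k))) + (if g \<eta> then h (e (a \<eta>)) else 0)"
      unfolding t_def add[OF s a'] using hsum[of "{..<n}" "\<lambda>m. e (X m \<eta> k)"] eL[OF \<eta>] h0 by simp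
    moreover have "t \<eta> k \<in> span_of L"
      unfolding t_def by (rule Z.subspace_add[OF sub s a'])
    then have "h (zscale (int k + 2) (y \<eta> (Suc k)) + t \<eta> k) = (int k + 2) * h (y \<eta> (Suc k)) + h (t \<eta> k)"
      using add[OF Z.subspace_scale[OF sub y_span_of[OF \<eta>]]] hint[OF y_span_of[OF \<eta>]] by simp
    then have "h (y \<eta> k) = (int k + 2) * h (y \<eta> (Suc k)) + h (t \<eta> k)"
      using y_rec[of \<eta> k] by metis
    ultimately show ?thesis by simp
  qed
  have he: "h (e x) = 0" if x: "\<eta> \<in> L" "x \<in> supp \<eta>" for \<eta> x
  proof -
    obtain \<eta>' where \<eta>': "\<eta>' \<in> L" "a \<eta>' = x" "g \<eta>' \<longleftrightarrow> solvable (\<lambda>k. \<Sum>m<n. h (e (X m \<eta>' k)))"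
      using pred[OF x, of "\<lambda>x. h (e x)"] by blast
    have *: "solvable (\<lambda>k. (\<Sum>m<n. h (e (X m \<eta>' k))) + (if g \<eta>' then h (e x) else 0))"
      unfolding solvable_def
    proof (intro exI allI)
      show "h (y \<eta>' k) = (int k + 2) * h (y \<eta>' (Suc k))
          + ((\<Sum>m<n. h (e (X m \<eta>' k))) + (if g \<eta>' then h (e x) else 0))" for k
        using rec[OF \<eta>'(1), of k] unfolding \<eta>'(2) .
    qed
    show ?thesis
    \<comment> \<open>If \<open>g \<eta>'\<close> holds, the sequence is solvable both with and
      without the added constant \<open>h (e x)\<close>, which must be 0. If it fails,
      \<open>*\<close> solves a sequence that was predicted to be unsolvable.\<close>
    proof (cases "g \<eta>'")
      case True
      then show ?thesis using not_both_solvable * \<eta>'(3) by simp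
    next
      case False
      then show ?thesis using * \<eta>'(3) by simp
    qed
  qed
  have hy: "h (y \<eta> k) = 0" if \<eta>: "\<eta> \<in> L" for \<eta> k
  \<comment> \<open>With all \<open>e x\<close> killed the recursion is homogeneous, and over the
    integers it has only the zero solution.\<close>
  proof (rule const_solution_zero(2)[where z = 0])
    fix k
    have "(\<Sum>m<n. h (e (X m \<eta> k))) + (if g \<eta> then h (e (a \<eta>)) else 0) = 0"
      using he[OF \<eta>] X_supp a_supp by simp
    then show "h (y \<eta> k) = (int k + 2) * h (y \<eta> (Suc k)) + 0"
      using rec[OF \<eta>, of k] by simp
  qed
  have "span_of L \<subseteq> {u \<in> span_of L. h u = 0}"
  proof (rule span_of_least)
    show "Z.subspace {u \<in> span_of L. h u = 0}"
      by (rule Z.subspaceI)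
        (auto simp: h0 add hint Z.subspace_0[OF sub] Z.subspace_add[OF sub] Z.subspace_scale[OF sub])
  qed (use he hy e_span_of y_span_of in auto)
  then show ?thesis using v by blast
qed

end

section \<open>Cardinal bounds and well-founded relations\<close>

lemma is_aleph_Cinfinite: "is_aleph n \<kappa> \<Longrightarrow> Cinfinite \<kappa>"
proof (induction n arbitrary: \<kappa>)
  case 0
  then show ?case using Cinfinite_cong[OF ordIso_symmetric natLeq_Cinfinite, of \<kappa>] by simp
next
  case (Suc n)
  then obtain \<mu> :: "'a rel" where "is_aleph n \<mu>" "\<kappa> =o cardSuc \<mu>" by auto
  then show ?case
    using Suc.IH Cinfinite_cong[OF ordIso_symmetric Cinfinite_cardSuc] by blast
qed

lemma nat_ordLeq_Cinfinite: "Cinfinite r \<Longrightarrow> |A :: 'c :: countable set| \<le>o r"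
proof -
  assume r: "Cinfinite r"
  have "|A| \<le>o |UNIV :: nat set|"
    using card_of_ordLeqI[of to_nat A UNIV] by simp
  also have "|UNIV :: nat set| \<le>o r"
    using card_of_nat natLeq_ordLeq_cinfinite[OF r] ordIso_ordLeq_trans by blast
  finally show ?thesis .
qed

lemma finite_ordLeq_Cinfinite:
  assumes "Cinfinite r" "finite A" shows "|A| \<le>o r"
proof -
  have "|A| <o natLeq" using assms(2) finite_iff_ordLess_natLeq by blast
  then show ?thesis
    using natLeq_ordLeq_cinfinite[OF assms(1)] ordLess_imp_ordLeq ordLeq_transitive by blast
qed

lemma countable_ordLeq_Cinfinite:
  assumes "Cinfinite r" "countable A" shows "|A| \<le>o r"
proof -
  have "|A| \<le>o |UNIV :: nat set|" using assms(2) by (simp add: countable_card_of_nat)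
  also have "|UNIV :: nat set| \<le>o r" by (rule nat_ordLeq_Cinfinite[OF assms(1)])
  finally show ?thesis .
qed

lemma Times_ordLeq_Cinfinite: "Cinfinite r \<Longrightarrow> |A| \<le>o r \<Longrightarrow> |B| \<le>o r \<Longrightarrow> |A \<times> B| \<le>o r"
  by (intro card_of_Times_ordLeq_infinite_Field) (auto simp: cinfinite_def)

lemma image_ordLeq: "|A| \<le>o r \<Longrightarrow> |f ` A| \<le>o r"
  using card_of_image ordLeq_transitive by blast

lemma subset_ordLeq: "B \<subseteq> A \<Longrightarrow> |A| \<le>o r \<Longrightarrow> |B| \<le>o r"
  using card_of_mono1 ordLeq_transitive by blast

lemma PiE_ordLeq:
  fixes n :: nat
  assumes r: "Cinfinite r" and "\<And>i. i < n \<Longrightarrow> |B i| \<le>o r"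
  shows "|PiE {..<n} B| \<le>o r"
  using assms(2)
proof (induction n)
  case 0
  show ?case by (rule finite_ordLeq_Cinfinite[OF r]) simp
next
  case (Suc n)
  have "PiE {..<Suc n} B \<subseteq> (\<lambda>(f, b). f(n := b)) ` (PiE {..<n} B \<times> B n)"
  proof
    fix f assume f: "f \<in> PiE {..<Suc n} B"
    have "restrict f {..<n} \<in> PiE {..<n} B" "f n \<in> B n"
      using PiE_mem[OF f] by (simp_all add: PiE_iff)
    moreover have "f = (restrict f {..<n})(n := f n)"
    proof
      show "f x = ((restrict f {..<n})(n := f n)) x" for x
        using PiE_arb[OF f, of x] by (cases "x < n") auto
    qed
    ultimately show "f \<in> (\<lambda>(f, b). f(n := b)) ` (PiE {..<n} B \<times> B n)"
      by (intro image_eqI[of _ _ "(restrict f {..<n}, f n)"]) simp_all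
  qed
  moreover have "|PiE {..<n} B \<times> B n| \<le>o r"
    using Suc by (intro Times_ordLeq_Cinfinite[OF r]) auto
  ultimately show ?case by (meson subset_ordLeq image_ordLeq)
qed

lemma card_zspan_ordLeq:
  assumes r: "Cinfinite r" and S: "|S| \<le>o r"
  shows "|Z.span S| \<le>o r"
proof -
  define T where "T = rec_nat {0} (\<lambda>_ T. (\<lambda>((c, x), u). zscale c x + u) ` (((UNIV :: int set) \<times> S) \<times> T))"
  have T: "T 0 = {0}" "\<And>k. T (Suc k) = (\<lambda>((c, x), u). zscale c x + u) ` (((UNIV :: int set) \<times> S) \<times> T k)"
    by (simp_all add: T_def)
  have "|T k| \<le>o r" for k
  proof (induction k)
    case 0
    show ?case by (simp add: T finite_ordLeq_Cinfinite[OF r])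
  next
    case (Suc k)
    show ?case unfolding T
      by (intro image_ordLeq Times_ordLeq_Cinfinite r S Suc nat_ordLeq_Cinfinite)
  qed
  then have "|\<Union>k. T k| \<le>o r"
    using r by (intro UNION_Cinfinite_bound nat_ordLeq_Cinfinite) auto
  moreover have "u \<in> (\<Union>k. T k)" if "u \<in> Z.span S" for u
    using that
  proof (induction rule: Z.span_induct_alt)
    case base
    have "0 \<in> T 0" by (simp add: T)
    then show ?case by blast
  next
    case (step c x u)
    then obtain k where "u \<in> T k" by blast
    then have "zscale c x + u \<in> T (Suc k)" unfolding T using step by force
    then show ?case by blast
  qed
  ultimately show ?thesis by (meson subset_ordLeq subsetI)
qed

text \<open>A lexicographic order whose second component may vary with the fibre: take the least
  value of \<open>f\<close> on the set, then a minimal element inside that fibre.\<close>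

lemma wf_rank_lex:
  fixes f :: "'a \<Rightarrow> 'b"
  assumes "wf r" "\<And>i. wf (Q i)"
  shows "wf {(x, y). (f x, f y) \<in> r \<or> f x = f y \<and> (x, y) \<in> Q (f x)}"
proof (rule wfI_min)
  fix z Z assume "z \<in> (Z :: 'a set)"
  then have "f z \<in> f ` Z" by (rule imageI)
  then obtain i where i: "i \<in> f ` Z" "\<And>j. (j, i) \<in> r \<Longrightarrow> j \<notin> f ` Z"
    using assms(1)[unfolded wf_eq_minimal, THEN spec[of _ "f ` Z"]] by blast
  then obtain z' where "z' \<in> {x \<in> Z. f x = i}" by blast
  then obtain x where x: "x \<in> {x \<in> Z. f x = i}" "\<And>y. (y, x) \<in> Q i \<Longrightarrow> y \<notin> {x \<in> Z. f x = i}"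
    using assms(2)[unfolded wf_eq_minimal, THEN spec[of _ "{x \<in> Z. f x = i}"], of i] by blast
  show "\<exists>x\<in>Z. \<forall>y. (y, x) \<in> {(x, y). (f x, f y) \<in> r \<or> f x = f y \<and> (x, y) \<in> Q (f x)} \<longrightarrow> y \<notin> Z"
  proof (intro bexI allI impI notI)
    fix y assume "(y, x) \<in> {(x, y). (f x, f y) \<in> r \<or> f x = f y \<and> (x, y) \<in> Q (f x)}" "y \<in> Z"
    then show False using x i(2)[of "f y"] by auto
  qed (use x in blast)
qed

lemma finite_max_Well_order:
  assumes "Well_order r" "finite F" "F \<noteq> {}" "F \<subseteq> Field r"
  shows "\<exists>i\<in>F. \<forall>j\<in>F. (j, i) \<in> r"
  using assms(2-4)
proof (induction F rule: finite_ne_induct)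
  case (singleton x)
  then show ?case using assms(1) by (auto simp: order_on_defs refl_on_def)
next
  case (insert x F)
  then obtain i where i: "i \<in> F" "\<forall>j\<in>F. (j, i) \<in> r" by blast
  have wo: "wo_rel r" using assms(1) by (simp add: wo_rel_def)
  have "x \<in> Field r" "i \<in> Field r" using insert.prems i(1) by auto
  then have *: "(x, i) \<in> r \<or> (i, x) \<in> r" "(x, x) \<in> r"
    using wo_rel.TOTALS[OF wo] by blast+
  from *(1) show ?case
  proof
    assume "(i, x) \<in> r"
    then have "(j, x) \<in> r" if "j \<in> F" for j
      using i(2) that transD[OF wo_rel.TRANS[OF wo]] by blast
    then show ?thesis using *(2) by blast
  qed (use i in blast)
qed

section \<open>Conflicts between tuples of branches\<close>

text \<open>
  Setting coordinate \<^term>\<open>m\<close> to \<^const>\<open>undefined\<close> forgets the branch that is cut at \<^term>\<open>k\<close>.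
\<close>

definition coord :: "nat \<Rightarrow> (nat \<Rightarrow> nat \<Rightarrow> 'a) \<Rightarrow> nat \<Rightarrow> nat \<times> (nat \<Rightarrow> nat \<Rightarrow> 'a) \<times> 'a list" where
  "coord m \<eta> k = (m, \<eta>(m := undefined), map (\<eta> m) [0..<k])"

text \<open>The index to be killed is a function of the last branch alone, the same branch by which
  the filtration measures a tuple.\<close>

locale branch_system =
  fixes n :: nat and A :: "(nat \<Rightarrow> 'a) \<Rightarrow> nat \<times> (nat \<Rightarrow> nat \<Rightarrow> 'a) \<times> 'a list"
    and g :: "(nat \<Rightarrow> nat \<Rightarrow> 'a) \<Rightarrow> bool"
  assumes n_pos: "n > 0"
begin

sublocale root_system n coord "\<lambda>\<eta>. A (\<eta> (n - 1))" g
  by unfold_locales (auto simp: coord_def dest: arg_cong[where f = length])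

text \<open>If the branches at \<open>m\<close> agree, the tuples differ elsewhere and no cut at
  \<open>m\<close> is shared. If they differ at \<open>i\<close>, cuts longer than \<open>i\<close>
  record this. The remaining index of \<open>\<eta>'\<close> has one fixed length and is
  outgrown.\<close>

lemma coord_eventually_fresh:
  assumes "\<eta> \<in> extensional {..<n}" "\<eta>' \<in> extensional {..<n}" "\<eta> \<noteq> \<eta>'" "m < n"
  shows "\<forall>\<^sub>F k in sequentially. coord m \<eta> k \<notin> supp \<eta>'"
proof -
  obtain i where i: "coord m \<eta> k = coord m \<eta>' j \<Longrightarrow> k \<le> i" for k j
  proof (cases "\<eta> m = \<eta>' m")
    case True
    have "\<eta>(m := undefined) \<noteq> \<eta>'(m := undefined)"
      using assms(3) True by (metis fun_upd_triv fun_upd_upd)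
    then show ?thesis using that by (auto simp: coord_def)
  next
    case False
    then obtain i where i: "\<eta> m i \<noteq> \<eta>' m i" by blast
    have "k \<le> i" if *: "coord m \<eta> k = coord m \<eta>' j" for k j
    proof (rule ccontr)
      assume "\<not> k \<le> i"
      moreover have l: "map (\<eta> m) [0..<k] = map (\<eta>' m) [0..<j]" using * by (simp add: coord_def)
      moreover have "j = k" using arg_cong[OF l, of length] by simp
      ultimately show False using i by (auto dest!: arg_cong[where f = "\<lambda>l. l ! i"])
    qed
    then show ?thesis using that by blast
  qed
  have "coord m \<eta> k \<notin> supp \<eta>'" if k: "k \<ge> max (Suc i) (Suc (length (snd (snd (A (\<eta>' (n - 1)))))))" for k
  proof
    assume "coord m \<eta> k \<in> supp \<eta>'"
    then consider m' j where "coord m \<eta> k = coord m' \<eta>' j" | "coord m \<eta> k = A (\<eta>' (n - 1))"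
      unfolding supp_def by blast
    then show False
    proof cases
      case 1
      then have "m' = m" by (simp add: coord_def)
      then show ?thesis using i[of k j] 1 k by simp
    next
      case 2
      have "length (snd (snd (coord m \<eta> k))) = k" by (simp add: coord_def)
      then show ?thesis using k 2 by simp
    qed
  qed
  then show ?thesis by (meson eventually_sequentiallyI)
qed

text \<open>
  Closure of a set of branches under the branches occurring in \<^term>\<open>A b\<close>; as this is a unary
  operation, it does not increase infinite cardinals.
\<close>

definition clos :: "(nat \<Rightarrow> 'a) set \<Rightarrow> (nat \<Rightarrow> 'a) set" where
  "clos S = (\<lambda>(w, b). foldr (\<lambda>m b. fst (snd (A b)) m) w b) ` ((UNIV :: nat list set) \<times> S)"

lemma clos_superset: "S \<subseteq> clos S"
proof
  fix b assume "b \<in> S"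
  then show "b \<in> clos S"
    unfolding clos_def by (intro image_eqI[of _ _ "([], b)"]) auto
qed

lemma clos_closed: "b \<in> clos S \<Longrightarrow> fst (snd (A b)) m \<in> clos S"
proof -
  assume "b \<in> clos S"
  then obtain w b' where "b' \<in> S" "b = foldr (\<lambda>m b. fst (snd (A b)) m) w b'"
    unfolding clos_def by auto
  then show ?thesis
    unfolding clos_def by (intro image_eqI[of _ _ "(m # w, b')"]) auto
qed

lemma clos_mono: "S \<subseteq> T \<Longrightarrow> clos S \<subseteq> clos T"
  unfolding clos_def by auto

lemma clos_ordLeq: "Cinfinite r \<Longrightarrow> |S| \<le>o r \<Longrightarrow> |clos S| \<le>o r"
  unfolding clos_def by (intro image_ordLeq Times_ordLeq_Cinfinite nat_ordLeq_Cinfinite)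

text \<open>The sets \<open>P \<eta>\<close> of coordinates still allowed carry the induction: the
  step to the next aleph removes the coordinate \<open>m0 \<eta>\<close> from
  \<open>P \<eta>\<close> and therefore has to start with one more.\<close>

lemma well_founded_conflicts:
  fixes \<mu> :: "'k rel"
  assumes "is_aleph j \<mu>" "|U| \<le>o \<mu>" "U \<subseteq> extensional {..<n}" "\<And>\<eta>. \<eta> \<in> U \<Longrightarrow> P \<eta> \<subseteq> {..<n} \<and> j < card (P \<eta>)"
  shows "\<exists>M K. (\<forall>\<eta>\<in>U. M \<eta> \<in> P \<eta>) \<and>
    wf {(\<eta>, \<eta>'). \<eta> \<in> U \<and> \<eta>' \<in> U \<and> \<eta> \<noteq> \<eta>' \<and> (\<exists>k\<ge>K \<eta>. coord (M \<eta>) \<eta> k \<in> supp \<eta>')}"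
  using assms
proof (induction j arbitrary: \<mu> U P)
  case 0
  have "|U| \<le>o natLeq" using 0 ordLeq_ordIso_trans by auto
  then have "|U| \<le>o |UNIV :: nat set|" using card_of_nat ordIso_symmetric ordLeq_ordIso_trans by blast
  then have cU: "countable U" by (simp add: countable_card_of_nat)
  define idx where "idx = to_nat_on U"
  have idx: "inj_on idx U" using inj_on_to_nat_on[OF cU] by (simp add: idx_def)
  define M where "M \<eta> = (SOME m. m \<in> P \<eta>)" for \<eta>
  have M: "M \<eta> \<in> P \<eta>" if "\<eta> \<in> U" for \<eta>
  proof -
    have "P \<eta> \<noteq> {}" using "0.prems"(4)[OF that] by auto
    then show ?thesis unfolding M_def by (simp add: some_in_eq)
  qed
  \<comment> \<open>Only finitely many tuples precede \<open>\<eta>\<close> in the enumeration, so a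
    single threshold serves for all of them.\<close>
  have "\<exists>K. \<forall>k\<ge>K. \<forall>\<eta>'\<in>{\<eta>' \<in> U. idx \<eta>' < idx \<eta>}. coord (M \<eta>) \<eta> k \<notin> supp \<eta>'" if \<eta>: "\<eta> \<in> U" for \<eta>
  proof -
    have "finite {\<eta>' \<in> U. idx \<eta>' < idx \<eta>}"
      by (rule finite_imageD[of idx])
        (auto intro: finite_subset[of _ "{..<idx \<eta>}"] inj_on_subset[OF idx])
    moreover have "\<forall>\<^sub>F k in sequentially. coord (M \<eta>) \<eta> k \<notin> supp \<eta>'" if "\<eta>' \<in> {\<eta>' \<in> U. idx \<eta>' < idx \<eta>}" for \<eta>'
      by (rule coord_eventually_fresh) (use that \<eta> "0.prems" M[OF \<eta>] in auto)
    ultimately have "\<forall>\<^sub>F k in sequentially. \<forall>\<eta>'\<in>{\<eta>' \<in> U. idx \<eta>' < idx \<eta>}. coord (M \<eta>) \<eta> k \<notin> supp \<eta>'"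
      by (intro eventually_ball_finite) auto
    then show ?thesis by (simp add: eventually_sequentially)
  qed
  then have "\<forall>\<eta>\<in>U. \<exists>K. \<forall>k\<ge>K. \<forall>\<eta>'\<in>{\<eta>' \<in> U. idx \<eta>' < idx \<eta>}. coord (M \<eta>) \<eta> k \<notin> supp \<eta>'"
    by (rule ballI)
  from bchoice[OF this] obtain K where
    K: "\<And>\<eta> k \<eta>'. \<eta> \<in> U \<Longrightarrow> k \<ge> K \<eta> \<Longrightarrow> \<eta>' \<in> U \<Longrightarrow> idx \<eta>' < idx \<eta> \<Longrightarrow> coord (M \<eta>) \<eta> k \<notin> supp \<eta>'"
    by blast
  have W: "wf {(\<eta>, \<eta>'). \<eta> \<in> U \<and> \<eta>' \<in> U \<and> \<eta> \<noteq> \<eta>' \<and> (\<exists>k\<ge>K \<eta>. coord (M \<eta>) \<eta> k \<in> supp \<eta>')}"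
  proof (rule wf_subset[OF wf_measure[of idx]], rule subrelI)
    fix \<eta> \<eta>' assume "(\<eta>, \<eta>') \<in> {(\<eta>, \<eta>'). \<eta> \<in> U \<and> \<eta>' \<in> U \<and> \<eta> \<noteq> \<eta>' \<and> (\<exists>k\<ge>K \<eta>. coord (M \<eta>) \<eta> k \<in> supp \<eta>')}"
    then obtain k where *: "\<eta> \<in> U" "\<eta>' \<in> U" "\<eta> \<noteq> \<eta>'" "K \<eta> \<le> k" "coord (M \<eta>) \<eta> k \<in> supp \<eta>'"
      by blast
    then have "\<not> idx \<eta>' < idx \<eta>" using K by blast
    moreover have "idx \<eta>' \<noteq> idx \<eta>" using * idx by (auto dest: inj_onD)
    ultimately show "(\<eta>, \<eta>') \<in> measure idx" by simp
  qed
  show ?case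
  proof (intro exI conjI)
    show "\<forall>\<eta>\<in>U. M \<eta> \<in> P \<eta>" using M by blast
  qed (rule W)
next
  case (Suc j)
  obtain \<mu>0 :: "'k rel" where \<mu>0: "is_aleph j \<mu>0" "\<mu> =o cardSuc \<mu>0"
    using Suc.prems(1) by auto
  have inf: "Cinfinite \<mu>0" by (rule is_aleph_Cinfinite[OF \<mu>0(1)])
  define r where "r = |U|"
  have r: "Well_order r" "Card_order r" "Field r = U"
    by (auto simp: r_def card_of_Well_order card_of_Card_order Field_card_of)
  then have wo: "wo_rel r" by (simp add: wo_rel_def)
  have under: "|under r i| \<le>o \<mu>0" if "i \<in> U" for i
  proof -
    have "|underS r i| <o r" using card_of_underS[OF r(2)] that r(3) by simp
    also have "r \<le>o cardSuc \<mu>0"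
      unfolding r_def using Suc.prems(2) \<mu>0(2) ordLeq_ordIso_trans by blast
    finally have "|underS r i| \<le>o \<mu>0"
      using cardSuc_ordLeq_ordLess[of \<mu>0 "|underS r i|"] inf by (simp add: card_of_Card_order)
    then have "|insert i (underS r i)| \<le>o \<mu>0"
      unfolding insert_is_Un[of i "underS r i"]
      using finite_ordLeq_Cinfinite[OF inf, of "{i}"] inf by (intro Un_Cinfinite_bound) simp_all
    moreover have "under r i \<subseteq> insert i (underS r i)" by (auto simp: under_def underS_def)
    ultimately show ?thesis by (rule subset_ordLeq[rotated])
  qed
  \<comment> \<open>The branches of all tuples up to \<open>i\<close>, together with those recorded
    in the indices these tuples kill: at most \<open>\<mu>0\<close> many, and increasing with
    \<open>i\<close>.\<close>
  define C where "C i = clos (\<Union>\<eta>\<in>under r i. \<eta> ` {..<n})" for i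
  have CleqI: "|C i| \<le>o \<mu>0" if "i \<in> U" for i
    unfolding C_def
    by (intro clos_ordLeq[OF inf] UNION_Cinfinite_bound[OF under[OF that] _ inf] ballI finite_ordLeq_Cinfinite[OF inf]) simp
  have Cmono: "C i \<subseteq> C i'" if "(i, i') \<in> r" for i i'
  proof -
    have "under r i \<subseteq> under r i'"
      using that r(1) by (intro under_incr) (auto simp: order_on_defs)
    then show ?thesis unfolding C_def by (intro clos_mono) blast
  qed
  define D where "D i = {\<eta> \<in> U. \<forall>m<n. \<eta> m \<in> C i}" for i
  have Dcard: "|D i| \<le>o \<mu>0" if "i \<in> U" for i
  proof (rule subset_ordLeq)
    show "D i \<subseteq> PiE {..<n} (\<lambda>_. C i)"
      using Suc.prems(3) by (auto simp: D_def PiE_def)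
    show "|PiE {..<n} (\<lambda>_. C i)| \<le>o \<mu>0"
      by (rule PiE_ordLeq[OF inf CleqI[OF that]])
  qed
  have Dself: "\<eta> \<in> D \<eta>" if "\<eta> \<in> U" for \<eta>
  proof -
    have "(\<eta>, \<eta>) \<in> r" using wo_rel.REFL[OF wo] that r(3) by (simp add: refl_on_def)
    then have "\<eta> ` {..<n} \<subseteq> C \<eta>"
      unfolding C_def by (intro order_trans[OF _ clos_superset]) (auto simp: under_def)
    then show ?thesis using that by (auto simp: D_def)
  qed
  define rank where "rank \<eta> = wo_rel.minim r {i \<in> U. \<eta> \<in> D i}" for \<eta>
  have rank: "rank \<eta> \<in> U" "\<eta> \<in> D (rank \<eta>)" if "\<eta> \<in> U" for \<eta>
    using wo_rel.minim_in[OF wo, of "{i \<in> U. \<eta> \<in> D i}"] Dself[OF that] that r(3)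
    by (auto simp: rank_def)
  have rank_least: "(rank \<eta>, i) \<in> r" if "i \<in> U" "\<eta> \<in> D i" for \<eta> i
    using wo_rel.minim_least[OF wo, of "{i \<in> U. \<eta> \<in> D i}" i] that r(3) by (auto simp: rank_def)
  \<comment> \<open>If each branch of \<open>\<eta>\<close> appeared at some earlier stage, the
    largest of these finitely many stages would contain them all, against the minimality of the
    rank.\<close>
  have "\<exists>m<n. \<forall>i\<in>underS r (rank \<eta>). \<eta> m \<notin> C i" if \<eta>: "\<eta> \<in> U" for \<eta>
  proof (rule ccontr)
    assume "\<not> ?thesis"
    then obtain f where f: "\<And>m. m < n \<Longrightarrow> f m \<in> underS r (rank \<eta>) \<and> \<eta> m \<in> C (f m)"
      by metis
    have fU: "f m \<in> U" if "m < n" for m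
      using f[OF that] r(3) by (auto simp: underS_def Field_def)
    obtain i where i: "i \<in> f ` {..<n}" "\<forall>j\<in>f ` {..<n}. (j, i) \<in> r"
      using finite_max_Well_order[OF r(1), of "f ` {..<n}"] n_pos fU r(3) by auto
    have "\<eta> \<in> D i"
      unfolding D_def using \<eta> i(2) f Cmono by blast
    then have "(rank \<eta>, i) \<in> r" using rank_least i(1) fU by auto
    moreover have "(i, rank \<eta>) \<in> r" "i \<noteq> rank \<eta>" using i(1) f by (auto simp: underS_def)
    ultimately show False using r(1) by (auto simp: order_on_defs antisym_def)
  qed
  then obtain m0 where m0: "\<And>\<eta>. \<eta> \<in> U \<Longrightarrow> m0 \<eta> < n"
    "\<And>\<eta> i. \<eta> \<in> U \<Longrightarrow> i \<in> underS r (rank \<eta>) \<Longrightarrow> \<eta> (m0 \<eta>) \<notin> C i"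
    by metis
  define R where "R i = {\<eta> \<in> U. rank \<eta> = i}" for i
  define good where "good i M K \<longleftrightarrow> (\<forall>\<eta>\<in>R i. M \<eta> \<in> P \<eta> - {m0 \<eta>}) \<and>
    wf {(\<eta>, \<eta>'). \<eta> \<in> R i \<and> \<eta>' \<in> R i \<and> \<eta> \<noteq> \<eta>' \<and> (\<exists>k\<ge>K \<eta>. coord (M \<eta>) \<eta> k \<in> supp \<eta>')}" for i M K
  have "\<exists>M K. good i M K" for i
  proof (cases "i \<in> U")
    case True
    show ?thesis
      unfolding good_def
    proof (rule Suc.IH[OF \<mu>0(1)])
      show "|R i| \<le>o \<mu>0"
        by (rule subset_ordLeq[OF _ Dcard[OF True]]) (use rank in \<open>auto simp: R_def\<close>)
      show "R i \<subseteq> extensional {..<n}" using Suc.prems(3) by (auto simp: R_def)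
      fix \<eta> assume "\<eta> \<in> R i"
      then have P: "P \<eta> \<subseteq> {..<n}" "Suc j < card (P \<eta>)" using Suc.prems(4) by (auto simp: R_def)
      obtain c where "card (P \<eta>) = Suc c" "j < c"
        using P(2) by (cases "card (P \<eta>)") auto
      then have "j < card (P \<eta> - {m0 \<eta>})"
        by (simp add: card_Diff_singleton_if)
      then show "P \<eta> - {m0 \<eta>} \<subseteq> {..<n} \<and> j < card (P \<eta> - {m0 \<eta>})" using P by auto
    qed
  next
    case False
    then have "R i = {}" using rank by (auto simp: R_def)
    then have *: "{(\<eta>, \<eta>'). \<eta> \<in> R i \<and> \<eta>' \<in> R i \<and> \<eta> \<noteq> \<eta>' \<and> (\<exists>k\<ge>K \<eta>. coord (M \<eta>) \<eta> k \<in> supp \<eta>')} = {}" for M K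
      by blast
    show ?thesis unfolding good_def * using \<open>R i = {}\<close> by simp
  qed
  then obtain M K where MK: "\<And>i. good i (M i) (K i)" by metis
  have M: "M i \<eta> \<in> P \<eta> - {m0 \<eta>}" if "\<eta> \<in> R i" for i \<eta>
    using MK[of i] that unfolding good_def by blast
  have wf: "wf {(\<eta>, \<eta>'). \<eta> \<in> R i \<and> \<eta>' \<in> R i \<and> \<eta> \<noteq> \<eta>' \<and> (\<exists>k\<ge>K i \<eta>. coord (M i \<eta>) \<eta> k \<in> supp \<eta>')}" (is "wf (?Q i)") for i
    using MK[of i] unfolding good_def by (rule conjunct2)
  define M' K' where "M' \<eta> = M (rank \<eta>) \<eta>" and "K' \<eta> = K (rank \<eta>) \<eta>" for \<eta>
  have M': "M' \<eta> \<in> P \<eta> - {m0 \<eta>}" if "\<eta> \<in> U" for \<eta>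
    unfolding M'_def by (rule M) (use that in \<open>simp add: R_def\<close>)
  have sub: "{(\<eta>, \<eta>'). \<eta> \<in> U \<and> \<eta>' \<in> U \<and> \<eta> \<noteq> \<eta>' \<and> (\<exists>k\<ge>K' \<eta>. coord (M' \<eta>) \<eta> k \<in> supp \<eta>')}
      \<subseteq> {(\<eta>, \<eta>'). (rank \<eta>, rank \<eta>') \<in> r - Id \<or> rank \<eta> = rank \<eta>' \<and> (\<eta>, \<eta>') \<in> ?Q (rank \<eta>)}"
  proof clarify
    fix \<eta> \<eta>' k assume *: "\<eta> \<in> U" "\<eta>' \<in> U" "\<eta> \<noteq> \<eta>'" "K' \<eta> \<le> k" "coord (M' \<eta>) \<eta> k \<in> supp \<eta>'"
      and no: "\<not> (rank \<eta> = rank \<eta>' \<and> (\<eta>, \<eta>') \<in> ?Q (rank \<eta>))"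
    have neq: "rank \<eta> \<noteq> rank \<eta>'"
      using no * by (auto simp: R_def M'_def K'_def)
    \<comment> \<open>Cutting at \<open>M' \<eta>\<close> leaves the branch at
      \<open>m0 \<eta>\<close> intact. Whether a tuple \<open>\<eta>'\<close> of lower rank has the
      index as a cut or kills it, that branch would already lie in
      \<open>C (rank \<eta>')\<close>.\<close>
    show "(rank \<eta>, rank \<eta>') \<in> r - Id"
    proof (rule ccontr)
      assume "(rank \<eta>, rank \<eta>') \<notin> r - Id"
      then have "(rank \<eta>', rank \<eta>) \<in> r"
        using neq wo_rel.TOTALS[OF wo] rank(1)[OF *(1)] rank(1)[OF *(2)] r(3) by blast
      then have "rank \<eta>' \<in> underS r (rank \<eta>)" using neq by (simp add: underS_def)
      then have no: "\<eta> (m0 \<eta>) \<notin> C (rank \<eta>')" by (rule m0(2)[OF *(1)])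
      have neq: "M' \<eta> \<noteq> m0 \<eta>" using M'[OF *(1)] by auto
      have \<eta>'C: "\<eta>' m \<in> C (rank \<eta>')" if "m < n" for m
        using rank(2)[OF *(2)] that by (auto simp: D_def)
      consider m' j where "m' < n" "coord (M' \<eta>) \<eta> k = coord m' \<eta>' j" | "coord (M' \<eta>) \<eta> k = A (\<eta>' (n - 1))"
        using *(5) unfolding supp_def by blast
      then show False
      proof cases
        case 1
        then have "m' = M' \<eta>" "\<eta>(M' \<eta> := undefined) = \<eta>'(m' := undefined)" by (auto simp: coord_def)
        then have "\<eta> (m0 \<eta>) = \<eta>' (m0 \<eta>)" using neq by (metis fun_upd_other)
        then show ?thesis using no \<eta>'C m0(1)[OF *(1)] by simp
      next
        case 2
        then have "fst (snd (A (\<eta>' (n - 1)))) = \<eta>(M' \<eta> := undefined)"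
          by (metis coord_def fst_conv snd_conv)
        then have "fst (snd (A (\<eta>' (n - 1)))) (m0 \<eta>) = \<eta> (m0 \<eta>)" using neq by simp
        moreover have "\<eta>' (n - 1) \<in> C (rank \<eta>')" using \<eta>'C n_pos by simp
        ultimately show ?thesis
          using no clos_closed[of "\<eta>' (n - 1)" _ "m0 \<eta>"] unfolding C_def by simp
      qed
    qed
  qed
  have "wf (r - Id)" using r(1) by (simp add: well_order_on_def)
  note W = wf_subset[OF wf_rank_lex[OF this wf] sub]
  show ?case
  proof (intro exI conjI)
    show "\<forall>\<eta>\<in>U. M' \<eta> \<in> P \<eta>" using M' by blast
  qed (rule W)
qed

end

section \<open>The filtered group\<close>

text \<open>
  The additive group \<^term>\<open>V\<close> carried over to another type along a map \<^term>\<open>\<theta>\<close> that is injective on \<^term>\<open>S\<close>.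
\<close>

definition vgroup :: "(('z \<Rightarrow> rat) \<Rightarrow> 'b) \<Rightarrow> ('z \<Rightarrow> rat) set \<Rightarrow> ('z \<Rightarrow> rat) set \<Rightarrow> 'b monoid" where
  "vgroup \<theta> S V = \<lparr>carrier = \<theta> ` V, mult = (\<lambda>a b. \<theta> (inv_into S \<theta> a + inv_into S \<theta> b)), one = \<theta> 0\<rparr>"

locale transported =
  fixes \<theta> :: "('z \<Rightarrow> rat) \<Rightarrow> 'b" and S :: "('z \<Rightarrow> rat) set"
  assumes inj: "inj_on \<theta> S"
begin

lemma carrier_vgroup [simp]: "carrier (vgroup \<theta> S V) = \<theta> ` V"
  and one_vgroup [simp]: "\<one>\<^bsub>vgroup \<theta> S V\<^esub> = \<theta> 0"
  and carrier_update_vgroup [simp]: "vgroup \<theta> S V\<lparr>carrier := \<theta> ` W\<rparr> = vgroup \<theta> S W"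
  by (simp_all add: vgroup_def)

lemma mult_vgroup: "u \<in> S \<Longrightarrow> v \<in> S \<Longrightarrow> \<theta> u \<otimes>\<^bsub>vgroup \<theta> S V\<^esub> \<theta> v = \<theta> (u + v)"
  using inj by (simp add: vgroup_def)

lemma comm_group_vgroup:
  assumes V: "Z.subspace V" "V \<subseteq> S"
  shows "comm_group (vgroup \<theta> S V)"
proof (rule comm_groupI)
  note in_S = subsetD[OF V(2)]
  note add = Z.subspace_add[OF V(1)] and neg = Z.subspace_neg[OF V(1)] and zero = Z.subspace_0[OF V(1)]
  fix x assume "x \<in> carrier (vgroup \<theta> S V)"
  then obtain u where u: "u \<in> V" "x = \<theta> u" by auto
  show "\<one>\<^bsub>vgroup \<theta> S V\<^esub> \<otimes>\<^bsub>vgroup \<theta> S V\<^esub> x = x"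
    using u zero by (simp add: mult_vgroup in_S)
  show "\<exists>y\<in>carrier (vgroup \<theta> S V). y \<otimes>\<^bsub>vgroup \<theta> S V\<^esub> x = \<one>\<^bsub>vgroup \<theta> S V\<^esub>"
    using u neg[OF u(1)] by (intro bexI[of _ "\<theta> (- u)"]) (simp_all add: mult_vgroup in_S)
  fix y assume "y \<in> carrier (vgroup \<theta> S V)"
  then obtain v where v: "v \<in> V" "y = \<theta> v" by auto
  show "x \<otimes>\<^bsub>vgroup \<theta> S V\<^esub> y \<in> carrier (vgroup \<theta> S V)"
    using u v add[of u v] by (simp add: mult_vgroup in_S)
  show "x \<otimes>\<^bsub>vgroup \<theta> S V\<^esub> y = y \<otimes>\<^bsub>vgroup \<theta> S V\<^esub> x"
    using u v by (simp add: mult_vgroup in_S add.commute)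
  fix z assume "z \<in> carrier (vgroup \<theta> S V)"
  then obtain w where w: "w \<in> V" "z = \<theta> w" by auto
  show "x \<otimes>\<^bsub>vgroup \<theta> S V\<^esub> y \<otimes>\<^bsub>vgroup \<theta> S V\<^esub> z = x \<otimes>\<^bsub>vgroup \<theta> S V\<^esub> (y \<otimes>\<^bsub>vgroup \<theta> S V\<^esub> z)"
    using u v w add[of u v] add[of v w] by (simp add: mult_vgroup in_S add.assoc)
next
  show "\<one>\<^bsub>vgroup \<theta> S V\<^esub> \<in> carrier (vgroup \<theta> S V)"
    using Z.subspace_0[OF V(1)] by simp
qed

lemma subgroup_vgroup:
  assumes V: "Z.subspace V" "V \<subseteq> S" and W: "Z.subspace W" "W \<subseteq> V"
  shows "subgroup (\<theta> ` W) (vgroup \<theta> S V)"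
proof -
  interpret V: comm_group "vgroup \<theta> S V"
    by (rule comm_group_vgroup[OF V])
  have WS: "w \<in> W \<Longrightarrow> w \<in> S" for w using V W by blast
  show ?thesis
  proof (rule V.subgroupI)
    show "\<theta> ` W \<noteq> {}" using Z.subspace_0[OF W(1)] by blast
    fix x assume "x \<in> \<theta> ` W"
    then obtain u where u: "u \<in> W" "x = \<theta> u" by auto
    have "inv\<^bsub>vgroup \<theta> S V\<^esub> x = \<theta> (- u)"
      using u Z.subspace_neg[OF W(1) u(1)] W(2) by (intro V.inv_equality) (auto simp: mult_vgroup WS)
    then show "inv\<^bsub>vgroup \<theta> S V\<^esub> x \<in> \<theta> ` W"
      using Z.subspace_neg[OF W(1) u(1)] by simp
    fix y assume "y \<in> \<theta> ` W"
    then show "x \<otimes>\<^bsub>vgroup \<theta> S V\<^esub> y \<in> \<theta> ` W"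
      using u Z.subspace_add[OF W(1)] by (auto simp: mult_vgroup WS)
  qed (use W in auto)
qed

lemma hom_lincomb:
  assumes V: "Z.subspace V" "V \<subseteq> S" and v: "\<forall>i\<in>I. v i \<in> V"
  shows "\<theta> \<circ> lincomb v \<in> hom (free_Abelian_group I) (vgroup \<theta> S V)"
proof (rule homI)
  have l: "lincomb v p \<in> V" if "p \<in> carrier (free_Abelian_group I)" for p
    using lincomb_in_subspace[OF V(1), of I v p] v that by simp
  fix p q assume *: "p \<in> carrier (free_Abelian_group I)" "q \<in> carrier (free_Abelian_group I)"
  show "(\<theta> \<circ> lincomb v) p \<in> carrier (vgroup \<theta> S V)" using l[OF *(1)] by simp
  show "(\<theta> \<circ> lincomb v) (p \<otimes>\<^bsub>free_Abelian_group I\<^esub> q)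
      = (\<theta> \<circ> lincomb v) p \<otimes>\<^bsub>vgroup \<theta> S V\<^esub> (\<theta> \<circ> lincomb v) q"
    using l[OF *(1)] l[OF *(2)] V(2) by (simp add: lincomb_add mult_vgroup subset_iff)
qed

lemma free_abelian_vgroup_Mod:
  assumes V: "Z.subspace V" "V \<subseteq> S" and W: "Z.subspace W" "W \<subseteq> V"
    and v: "\<forall>i\<in>I. v i \<in> V"
    and gen: "\<forall>u\<in>V. \<exists>p. Poly_Mapping.keys p \<subseteq> I \<and> (\<exists>w\<in>W. u = w + lincomb v p)"
    and ind: "\<forall>p. Poly_Mapping.keys p \<subseteq> I \<longrightarrow> lincomb v p \<in> W \<longrightarrow> p = 0"
  shows "free_abelian (vgroup \<theta> S V Mod \<theta> ` W)"
proof (rule free_abelian_ModI[OF comm_group_vgroup[OF V] subgroup_vgroup[OF V W] hom_lincomb[OF V v]])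
  have l: "lincomb v p \<in> V" if "Poly_Mapping.keys p \<subseteq> I" for p
    using lincomb_in_subspace[OF V(1), of I v p] v that by simp
  show "\<exists>p\<in>carrier (free_Abelian_group I). \<exists>u\<in>\<theta> ` W. h = u \<otimes>\<^bsub>vgroup \<theta> S V\<^esub> (\<theta> \<circ> lincomb v) p"
    if h: "h \<in> carrier (vgroup \<theta> S V)" for h
  proof -
    obtain u where "u \<in> V" "h = \<theta> u" using h unfolding carrier_vgroup by blast
    moreover from this obtain p w where "Poly_Mapping.keys p \<subseteq> I" "w \<in> W" "u = w + lincomb v p"
      using gen by blast
    moreover from this have "w \<in> S" "lincomb v p \<in> S" using l V W by auto
    ultimately have "p \<in> carrier (free_Abelian_group I)" "\<theta> w \<in> \<theta> ` W"
      "h = \<theta> w \<otimes>\<^bsub>vgroup \<theta> S V\<^esub> (\<theta> \<circ> lincomb v) p"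
      by (auto simp: mult_vgroup)
    then show ?thesis by blast
  qed
  show "p = 0" if p: "p \<in> carrier (free_Abelian_group I)" "(\<theta> \<circ> lincomb v) p \<in> \<theta> ` W" for p
  proof -
    have "\<theta> (lincomb v p) \<in> \<theta> ` W" "lincomb v p \<in> V" using p l by simp_all
    moreover have "W \<subseteq> S" using V(2) W(2) by (rule order_trans[rotated])
    ultimately have "lincomb v p \<in> W"
      using inj_on_image_mem_iff[OF inj _ \<open>W \<subseteq> S\<close>] V(2) by blast
    then show ?thesis using ind p(1) by simp
  qed
qed

lemma free_abelian_vgroup:
  assumes V: "Z.subspace V" "V \<subseteq> S" and v: "\<forall>i\<in>I. v i \<in> V"
    and gen: "\<forall>u\<in>V. \<exists>p. Poly_Mapping.keys p \<subseteq> I \<and> u = lincomb v p"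
    and ind: "\<forall>p. Poly_Mapping.keys p \<subseteq> I \<longrightarrow> lincomb v p = 0 \<longrightarrow> p = 0"
  shows "free_abelian (vgroup \<theta> S V)"
proof (rule free_abelianI)
  show G: "group (vgroup \<theta> S V)"
    using comm_group_vgroup[OF V] by (rule comm_group.axioms(2))
  have l: "lincomb v p \<in> V" if "Poly_Mapping.keys p \<subseteq> I" for p
    using lincomb_in_subspace[OF V(1), of I v p] v that by simp
  have "inj_on (\<theta> \<circ> lincomb v) (carrier (free_Abelian_group I))"
  proof (rule inj_onI)
    fix p q assume *: "p \<in> carrier (free_Abelian_group I)" "q \<in> carrier (free_Abelian_group I)"
      "(\<theta> \<circ> lincomb v) p = (\<theta> \<circ> lincomb v) q"
    have "lincomb v (p - q) + lincomb v q = lincomb v p"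
      using lincomb_add[of v "p - q" q] by simp
    also have "\<dots> = lincomb v q"
      by (rule inj_onD[OF inj]) (use * l V(2) in auto)
    finally have "lincomb v (p - q) = 0" by (simp only: add_cancel_left_left)
    moreover have "Poly_Mapping.keys (p - q) \<subseteq> I" using * keys_diff[of p q] by auto
    ultimately have "p - q = 0" using ind by blast
    then show "p = q" by simp
  qed
  moreover have "(\<theta> \<circ> lincomb v) ` carrier (free_Abelian_group I) = carrier (vgroup \<theta> S V)"
  proof
    show "(\<theta> \<circ> lincomb v) ` carrier (free_Abelian_group I) \<subseteq> carrier (vgroup \<theta> S V)"
      using l by auto
    show "carrier (vgroup \<theta> S V) \<subseteq> (\<theta> \<circ> lincomb v) ` carrier (free_Abelian_group I)"
    proof
      fix h assume "h \<in> carrier (vgroup \<theta> S V)"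
      then obtain u where u: "u \<in> V" "h = \<theta> u" unfolding carrier_vgroup by blast
      then obtain p where "Poly_Mapping.keys p \<subseteq> I" "u = lincomb v p" using gen by blast
      then show "h \<in> (\<theta> \<circ> lincomb v) ` carrier (free_Abelian_group I)"
        using u(2) by (intro image_eqI[of _ _ p]) simp_all
    qed
  qed
  ultimately show "\<theta> \<circ> lincomb v \<in> iso (free_Abelian_group I) (vgroup \<theta> S V)"
    using hom_lincomb[OF V v] by (simp add: iso_def bij_betw_def)
qed

end

section \<open>Successor cardinals and their initial segments\<close>

locale successor_cardinal =
  fixes \<kappa> :: "'a rel" and \<mu> :: "'a rel"
  assumes \<mu>: "Cinfinite \<mu>" and \<kappa>: "Card_order \<kappa>" "\<kappa> =o cardSuc \<mu>"
begin

lemma wo: "wo_rel \<kappa>"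
  unfolding wo_rel_def using \<kappa>(1) by (rule card_order_on_well_order_on)

lemmas total = wo_rel.TOTALS[OF wo, rule_format]
lemmas trans = transD[OF wo_rel.TRANS[OF wo]]
lemmas antisym = antisymD[OF wo_rel.ANTISYM[OF wo]]

lemma refl: "z \<in> Field \<kappa> \<Longrightarrow> (z, z) \<in> \<kappa>"
  using total[of z z] by blast

lemma Cinfinite_\<kappa>: "Cinfinite \<kappa>"
  by (rule Cinfinite_cong[OF ordIso_symmetric[OF \<kappa>(2)] Cinfinite_cardSuc[OF \<mu>]])

lemma ordLess_iff: "|A| <o \<kappa> \<longleftrightarrow> |A| \<le>o \<mu>"
proof -
  have "|A| <o \<kappa> \<longleftrightarrow> |A| <o cardSuc \<mu>"
    using ordLess_ordIso_trans[OF _ \<kappa>(2)] ordLess_ordIso_trans[OF _ ordIso_symmetric[OF \<kappa>(2)]] by blast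
  then show ?thesis
    using cardSuc_ordLeq_ordLess[of \<mu> "|A|"] \<mu> by (simp add: card_of_Card_order)
qed

lemma \<mu>_less: "\<mu> <o \<kappa>"
  using cardSuc_greater \<mu> \<kappa>(2) ordIso_symmetric ordLess_ordIso_trans by blast

lemma underS_ordLeq: "z \<in> Field \<kappa> \<Longrightarrow> |underS \<kappa> z| \<le>o \<mu>"
  using card_of_underS[OF \<kappa>(1)] ordLess_iff by blast

lemma under_ordLeq: "z \<in> Field \<kappa> \<Longrightarrow> |under \<kappa> z| \<le>o \<mu>"
proof -
  assume z: "z \<in> Field \<kappa>"
  have "under \<kappa> z \<subseteq> {z} \<union> underS \<kappa> z" by (auto simp: under_def underS_def)
  moreover have "|{z} \<union> underS \<kappa> z| \<le>o \<mu>"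
    using finite_ordLeq_Cinfinite[OF \<mu>, of "{z}"] \<mu> underS_ordLeq[OF z] by (intro Un_Cinfinite_bound) simp_all
  ultimately show ?thesis by (rule subset_ordLeq)
qed

text \<open>Regularity of a successor cardinal: at most \<open>\<mu>\<close> many initial segments,
  each of size at most \<open>\<mu>\<close>, do not cover \<open>\<kappa>\<close>.\<close>

lemma strict_bound:
  assumes "K \<subseteq> Field \<kappa>" "|K| \<le>o \<mu>"
  obtains u where "u \<in> Field \<kappa>" "\<And>z. z \<in> K \<Longrightarrow> z \<in> underS \<kappa> u"
proof -
  have "|\<Union>z\<in>K. under \<kappa> z| \<le>o \<mu>"
    using assms under_ordLeq by (intro UNION_Cinfinite_bound[OF _ _ \<mu>]) auto
  then have "|\<Union>z\<in>K. under \<kappa> z| <o \<kappa>" by (simp add: ordLess_iff)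
  moreover have "\<not> |Field \<kappa>| <o \<kappa>"
    using card_of_Field_ordIso[OF \<kappa>(1)] not_ordLess_ordIso by blast
  ultimately have "\<not> Field \<kappa> \<subseteq> (\<Union>z\<in>K. under \<kappa> z)"
    using card_of_mono1 ordLeq_ordLess_trans by blast
  then obtain u where u: "u \<in> Field \<kappa>" "\<And>z. z \<in> K \<Longrightarrow> (u, z) \<notin> \<kappa>"
    by (auto simp: under_def)
  have "z \<in> underS \<kappa> u" if "z \<in> K" for z
    using total[of z u] u that assms(1) refl[OF u(1)] by (auto simp: underS_def)
  then show ?thesis using that u(1) by blast
qed

lemma underS_Field: "z \<in> underS \<kappa> u \<Longrightarrow> z \<in> Field \<kappa> \<and> u \<in> Field \<kappa> \<and> (z, u) \<in> \<kappa> \<and> z \<noteq> u"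
  by (auto simp: underS_def Field_def)

lemma underS_trans1: "(w, u) \<in> \<kappa> \<Longrightarrow> u \<in> underS \<kappa> \<nu> \<Longrightarrow> w \<in> underS \<kappa> \<nu>"
  using trans[of w u \<nu>] antisym[of u \<nu>] by (auto simp: underS_def)

lemma underS_trans2: "w \<in> underS \<kappa> \<nu> \<Longrightarrow> (\<nu>, \<rho>) \<in> \<kappa> \<Longrightarrow> w \<in> underS \<kappa> \<rho>"
  using trans[of w \<nu> \<rho>] antisym[of w \<nu>] by (auto simp: underS_def)

end

text \<open>The ordinals by which the filtration measures an index.\<close>

definition entries :: "nat \<Rightarrow> nat \<times> (nat \<Rightarrow> nat \<Rightarrow> 'a) \<times> 'a list \<Rightarrow> 'a set" where
  "entries n x = (case x of (m, \<zeta>, l) \<Rightarrow> if m = n - 1 then set l else range (\<zeta> (n - 1)))"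

lemma entries_coord_subset: "m < n \<Longrightarrow> entries n (coord m \<eta> k) \<subseteq> range (\<eta> (n - 1))"
  by (auto simp: entries_def coord_def)

lemma in_entries_coord: "m < n \<Longrightarrow> j < k \<Longrightarrow> \<eta> (n - 1) j \<in> entries n (coord m \<eta> k)"
  by (auto simp: entries_def coord_def)

section \<open>From predictions to a strongly free group with trivial dual\<close>

text \<open>This is what both constructions of branches have to deliver. Ordinals name indices
  through \<open>code\<close>, and the first entry of the last branch names the index to be killed.
  By \<open>code_bounded\<close> the entries of that index do not exceed the branch, so a bound for
  the branch bounds them as well; \<open>bounded_ordLeq\<close> keeps every stage of the filtration
  small.\<close>

locale prediction_system =
  successor_cardinal \<kappa> \<mu> + branch_system n "\<lambda>b. code (b 0)" g
  for \<kappa> \<mu> :: "'a rel" and n :: nat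
    and code :: "'a \<Rightarrow> nat \<times> (nat \<Rightarrow> nat \<Rightarrow> 'a) \<times> 'a list" and g +
  fixes B :: "nat \<Rightarrow> (nat \<Rightarrow> 'a) set"
  assumes \<mu>_aleph: "is_aleph (n - 1) \<mu>"
    and range_last: "b \<in> B (n - 1) \<Longrightarrow> range b \<subseteq> Field \<kappa>"
    and B_ordLeq: "m < n - 1 \<Longrightarrow> |B m| \<le>o \<mu>"
    and bounded_ordLeq: "\<nu> \<in> Field \<kappa> \<Longrightarrow> |{b \<in> B (n - 1). \<exists>u\<in>underS \<kappa> \<nu>. \<forall>k. (b k, u) \<in> \<kappa>}| \<le>o \<mu>"
    and code_bounded: "b \<in> B (n - 1) \<Longrightarrow> \<exists>k. \<forall>z\<in>entries n (code (b 0)). (z, b k) \<in> \<kappa>"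
    and coord_coded: "\<eta> \<in> PiE {..<n} B \<Longrightarrow> m < n \<Longrightarrow> coord m \<eta> k \<in> code ` Field \<kappa>"
    and prediction: "\<xi> \<in> Field \<kappa> \<Longrightarrow>
      \<exists>\<eta>\<in>PiE {..<n} B. \<eta> (n - 1) 0 = \<xi> \<and> (g \<eta> \<longleftrightarrow> solvable (\<lambda>k. \<Sum>m<n. f (coord m \<eta> k)))"
begin

(* The locale parameters contain n - 1, which the simplifier must not turn into n - Suc 0. *)
declare One_nat_def [simp del]

definition L where "L = PiE {..<n} B"

text \<open>The bound \<open>u\<close> has to lie strictly below \<open>\<nu>\<close>. A branch
  cofinal in a limit therefore joins only beyond that limit, and the stages are continuous.\<close>

definition L_below where "L_below \<nu> = {\<eta> \<in> L. \<exists>u\<in>underS \<kappa> \<nu>. \<forall>k. (\<eta> (n - 1) k, u) \<in> \<kappa>}"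

lemma L_last: "\<eta> \<in> L \<Longrightarrow> \<eta> (n - 1) \<in> B (n - 1)"
  using n_pos unfolding L_def by (simp add: PiE_mem)

lemma range_L: "\<eta> \<in> L \<Longrightarrow> \<eta> (n - 1) k \<in> Field \<kappa>"
  using range_last[OF L_last] by blast

lemma L_below_subset: "L_below \<nu> \<subseteq> L"
  by (auto simp: L_below_def)

lemma L_below_ordLeq:
  assumes "\<nu> \<in> Field \<kappa>" shows "|L_below \<nu>| \<le>o \<mu>"
proof (rule subset_ordLeq)
  define C where "C m = (if m = n - 1 then {b \<in> B (n - 1). \<exists>u\<in>underS \<kappa> \<nu>. \<forall>k. (b k, u) \<in> \<kappa>} else B m)" for m
  show "L_below \<nu> \<subseteq> PiE {..<n} C"
  proof
    fix \<eta> assume "\<eta> \<in> L_below \<nu>"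
    then have \<eta>: "\<eta> \<in> L" "\<exists>u\<in>underS \<kappa> \<nu>. \<forall>k. (\<eta> (n - 1) k, u) \<in> \<kappa>" by (auto simp: L_below_def)
    show "\<eta> \<in> PiE {..<n} C"
    proof (rule PiE_I)
      show "\<eta> m \<in> C m" if "m \<in> {..<n}" for m
        using PiE_mem[OF \<eta>(1)[unfolded L_def] that] \<eta>(2) by (cases "m = n - 1") (simp_all add: C_def)
      show "\<eta> m = undefined" if "m \<notin> {..<n}" for m
        using PiE_arb[OF \<eta>(1)[unfolded L_def] that] .
    qed
  qed
  show "|PiE {..<n} C| \<le>o \<mu>"
  proof (rule PiE_ordLeq[OF \<mu>])
    fix m assume "m < n"
    then show "|C m| \<le>o \<mu>"
      unfolding C_def using bounded_ordLeq[OF assms] B_ordLeq[of m] by (cases "m = n - 1") simp_all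
  qed
qed

lemma L_below_mono:
  assumes "(\<nu>, \<rho>) \<in> \<kappa>" shows "L_below \<nu> \<subseteq> L_below \<rho>"
proof -
  have "underS \<kappa> \<nu> \<subseteq> underS \<kappa> \<rho>"
    using assms underS_trans2 by blast
  then show ?thesis unfolding L_below_def by blast
qed

lemma L_below_limit:
  assumes "limit_elem \<kappa> \<nu>" shows "L_below \<nu> = (\<Union>u\<in>underS \<kappa> \<nu>. L_below u)"
proof
  show "(\<Union>u\<in>underS \<kappa> \<nu>. L_below u) \<subseteq> L_below \<nu>"
    using L_below_mono underS_Field by blast
  show "L_below \<nu> \<subseteq> (\<Union>u\<in>underS \<kappa> \<nu>. L_below u)"
  proof
    fix \<eta> assume "\<eta> \<in> L_below \<nu>"
    then obtain u where u: "\<eta> \<in> L" "u \<in> underS \<kappa> \<nu>" "\<forall>k. (\<eta> (n - 1) k, u) \<in> \<kappa>"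
      unfolding L_below_def by blast
    have uF: "u \<in> Field \<kappa>" using u(2) underS_Field by blast
    have "\<not> succ_elem \<kappa> \<nu>" using assms by (simp add: limit_elem_def)
    then have "underS \<kappa> \<nu> \<noteq> under \<kappa> u"
      using uF by (auto simp only: succ_elem_def)
    moreover have "under \<kappa> u \<subseteq> underS \<kappa> \<nu>"
      using u(2) underS_trans1 unfolding under_def by blast
    ultimately obtain w where w: "w \<in> underS \<kappa> \<nu>" "(w, u) \<notin> \<kappa>"
      unfolding under_def by auto
    have "(u, w) \<in> \<kappa>" using total[of u w] uF underS_Field[OF w(1)] w(2) by blast
    moreover have "u \<noteq> w" using w(2) refl[OF uF] by blast
    ultimately have "u \<in> underS \<kappa> w" by (simp add: underS_def)
    then have "\<eta> \<in> L_below w" unfolding L_below_def using u by blast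
    then show "\<eta> \<in> (\<Union>u\<in>underS \<kappa> \<nu>. L_below u)" using w(1) by blast
  qed
qed

lemma L_below_union: "L = (\<Union>\<nu>\<in>Field \<kappa>. L_below \<nu>)"
proof
  show "L \<subseteq> (\<Union>\<nu>\<in>Field \<kappa>. L_below \<nu>)"
  proof
    fix \<eta> assume \<eta>: "\<eta> \<in> L"
    have "range (\<eta> (n - 1)) \<subseteq> Field \<kappa>" using range_L[OF \<eta>] by blast
    moreover have "|range (\<eta> (n - 1))| \<le>o \<mu>"
      by (rule countable_ordLeq_Cinfinite[OF \<mu>]) simp
    ultimately obtain u where u: "u \<in> Field \<kappa>" "\<And>z. z \<in> range (\<eta> (n - 1)) \<Longrightarrow> z \<in> underS \<kappa> u"
      by (rule strict_bound) blast
    have "{u} \<subseteq> Field \<kappa>" "|{u}| \<le>o \<mu>"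
      using u(1) finite_ordLeq_Cinfinite[OF \<mu>, of "{u}"] by simp_all
    then obtain \<nu> where \<nu>: "\<nu> \<in> Field \<kappa>" "\<And>z. z \<in> {u} \<Longrightarrow> z \<in> underS \<kappa> \<nu>"
      by (rule strict_bound) blast
    have "\<forall>k. (\<eta> (n - 1) k, u) \<in> \<kappa>" using u(2) underS_Field by blast
    then have "\<eta> \<in> L_below \<nu>" unfolding L_below_def using \<eta> \<nu>(2) by blast
    then show "\<eta> \<in> (\<Union>\<nu>\<in>Field \<kappa>. L_below \<nu>)" using \<nu>(1) by blast
  qed
qed (use L_below_subset in blast)

lemma L_ordLeq: "|L| \<le>o \<kappa>"
  unfolding L_below_union
proof (rule UNION_Cinfinite_bound[OF _ _ Cinfinite_\<kappa>])
  show "|Field \<kappa>| \<le>o \<kappa>" using card_of_Field_ordIso[OF \<kappa>(1)] ordIso_imp_ordLeq by blast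
  show "\<forall>\<nu>\<in>Field \<kappa>. |L_below \<nu>| \<le>o \<kappa>"
    using L_below_ordLeq ordLeq_transitive ordLess_imp_ordLeq[OF \<mu>_less] by blast
qed

lemma span_of_ordLeq:
  assumes "Cinfinite r" "|U| \<le>o r" shows "|span_of U| \<le>o r"
proof -
  have "countable (supp \<eta>)" for \<eta>
  proof -
    have "{coord m \<eta> k | m k. m < n} \<subseteq> (\<lambda>(m, k). coord m \<eta> k) ` UNIV" by force
    then have "countable {coord m \<eta> k | m k. m < n}" by (rule countable_subset) simp
    then show ?thesis unfolding supp_def by simp
  qed
  then have "|\<Union>(supp ` U)| \<le>o r"
    using assms countable_ordLeq_Cinfinite by (intro UNION_Cinfinite_bound) auto
  moreover have "{y \<eta> k | \<eta> k. \<eta> \<in> U} = (\<lambda>(\<eta>, k). y \<eta> k) ` (U \<times> UNIV)" by auto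
  then have "|{y \<eta> k | \<eta> k. \<eta> \<in> U}| \<le>o r"
    using assms by (simp only:) (intro image_ordLeq Times_ordLeq_Cinfinite nat_ordLeq_Cinfinite)
  ultimately show ?thesis
    unfolding span_of_def using assms(1) by (intro card_zspan_ordLeq Un_Cinfinite_bound image_ordLeq)
qed

lemma span_of_Union:
  assumes "I \<noteq> {}" "\<And>i j. i \<in> I \<Longrightarrow> j \<in> I \<Longrightarrow> U i \<subseteq> U j \<or> U j \<subseteq> U i"
  shows "span_of (\<Union>i\<in>I. U i) = (\<Union>i\<in>I. span_of (U i))"
proof
  show "(\<Union>i\<in>I. span_of (U i)) \<subseteq> span_of (\<Union>i\<in>I. U i)"
    by (intro UN_least span_of_mono) blast
  show "span_of (\<Union>i\<in>I. U i) \<subseteq> (\<Union>i\<in>I. span_of (U i))"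
  proof (rule span_of_least)
    show "Z.subspace (\<Union>i\<in>I. span_of (U i))"
    proof (rule Z.subspaceI)
      show "0 \<in> (\<Union>i\<in>I. span_of (U i))" using assms(1) Z.subspace_0[OF subspace_span_of] by blast
      show "u + v \<in> (\<Union>i\<in>I. span_of (U i))" if uv: "u \<in> (\<Union>i\<in>I. span_of (U i))" "v \<in> (\<Union>i\<in>I. span_of (U i))" for u v
      proof -
        obtain i j where ij: "i \<in> I" "j \<in> I" "u \<in> span_of (U i)" "v \<in> span_of (U j)" using uv by blast
        show ?thesis
          using assms(2)[OF ij(1,2)]
        proof
          assume "U i \<subseteq> U j"
          then have "u \<in> span_of (U j)" using span_of_mono ij(3) by blast
          then show ?thesis using Z.subspace_add[OF subspace_span_of _ ij(4)] ij(2) by blast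
        next
          assume "U j \<subseteq> U i"
          then have "v \<in> span_of (U i)" using span_of_mono ij(4) by blast
          then show ?thesis using Z.subspace_add[OF subspace_span_of ij(3)] ij(1) by blast
        qed
      qed
      show "zscale c u \<in> (\<Union>i\<in>I. span_of (U i))" if "u \<in> (\<Union>i\<in>I. span_of (U i))" for c u
        using that Z.subspace_scale[OF subspace_span_of] by blast
    qed
    show "e x \<in> (\<Union>i\<in>I. span_of (U i))" if "\<eta> \<in> (\<Union>i\<in>I. U i)" "x \<in> supp \<eta>" for x \<eta>
      using that e_span_of by blast
    show "y \<eta> k \<in> (\<Union>i\<in>I. span_of (U i))" if "\<eta> \<in> (\<Union>i\<in>I. U i)" for \<eta> k
      using that y_span_of by blast
  qed
qed

lemma carrier_ordIso: "|span_of L| =o \<kappa>"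
proof -
  have "|span_of L| \<le>o \<kappa>" by (rule span_of_ordLeq[OF Cinfinite_\<kappa> L_ordLeq])
  moreover have "\<kappa> \<le>o |span_of L|"
  proof -
    have "\<forall>\<xi>\<in>Field \<kappa>. \<exists>\<eta>. \<eta> \<in> L \<and> \<eta> (n - 1) 0 = \<xi>"
      using prediction unfolding L_def by blast
    then obtain \<eta> where \<eta>: "\<forall>\<xi>\<in>Field \<kappa>. \<eta> \<xi> \<in> L \<and> \<eta> \<xi> (n - 1) 0 = \<xi>" by (rule bchoice[THEN exE])
    have "inj_on (\<lambda>\<xi>. y (\<eta> \<xi>) 0) (Field \<kappa>)"
    proof (rule inj_onI)
      fix \<xi> \<xi>' assume *: "\<xi> \<in> Field \<kappa>" "\<xi>' \<in> Field \<kappa>" "y (\<eta> \<xi>) 0 = y (\<eta> \<xi>') 0"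
      have "y (\<eta> \<xi>') 0 (Inr (\<eta> \<xi>)) \<noteq> 0" unfolding *(3)[symmetric] by (simp add: y_Inr)
      then have "\<eta> \<xi> = \<eta> \<xi>'" by (simp add: y_Inr split: if_splits)
      then show "\<xi> = \<xi>'" using \<eta> *(1,2) by metis
    qed
    moreover have "(\<lambda>\<xi>. y (\<eta> \<xi>) 0) ` Field \<kappa> \<subseteq> span_of L"
      using \<eta> y_span_of by blast
    ultimately have "|Field \<kappa>| \<le>o |span_of L|" using card_of_ordLeq by blast
    then show ?thesis
      using card_of_Field_ordIso[OF \<kappa>(1)] ordIso_ordLeq_trans ordIso_symmetric by blast
  qed
  ultimately show ?thesis by (simp add: ordIso_iff_ordLeq)
qed

text \<open>At aleph-(n - 1) the induction on conflicts consumes \<open>n - 1\<close> coordinates,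
  so having all \<open>n\<close> of them available is just enough. Raising the thresholds to get
  past \<open>U\<close> and the killed index only shrinks the conflict relation.\<close>

lemma root_free_L:
  assumes "V \<subseteq> L" "|V| \<le>o \<mu>"
    and fresh: "\<And>\<eta> m. \<eta> \<in> V - U \<Longrightarrow> m < n \<Longrightarrow> \<exists>k0. \<forall>k\<ge>k0. coord m \<eta> k \<notin> \<Union>(supp ` U)"
  shows "root_free U V"
proof -
  have "\<exists>M K. (\<forall>\<eta>\<in>V - U. M \<eta> \<in> {..<n}) \<and>
    wf {(\<eta>, \<eta>'). \<eta> \<in> V - U \<and> \<eta>' \<in> V - U \<and> \<eta> \<noteq> \<eta>' \<and> (\<exists>k\<ge>K \<eta>. coord (M \<eta>) \<eta> k \<in> supp \<eta>')}"
  proof (rule well_founded_conflicts[OF \<mu>_aleph])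
    show "|V - U| \<le>o \<mu>" by (rule subset_ordLeq[OF _ assms(2)]) blast
    show "V - U \<subseteq> extensional {..<n}" using assms(1) by (auto simp: L_def PiE_def)
  qed (use n_pos in simp)
  then obtain M K where M: "\<And>\<eta>. \<eta> \<in> V - U \<Longrightarrow> M \<eta> < n"
    and wf: "wf {(\<eta>, \<eta>'). \<eta> \<in> V - U \<and> \<eta>' \<in> V - U \<and> \<eta> \<noteq> \<eta>' \<and> (\<exists>k\<ge>K \<eta>. coord (M \<eta>) \<eta> k \<in> supp \<eta>')}"
    by blast
  have "\<forall>\<eta>\<in>V - U. \<exists>k0. \<forall>k\<ge>k0. coord (M \<eta>) \<eta> k \<notin> insert (code (\<eta> (n - 1) 0)) (\<Union>(supp ` U))"
  proof
    fix \<eta> assume \<eta>: "\<eta> \<in> V - U"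
    obtain k0 where k0: "\<forall>k\<ge>k0. coord (M \<eta>) \<eta> k \<notin> \<Union>(supp ` U)" using fresh[OF \<eta> M[OF \<eta>]] by blast
    have "coord (M \<eta>) \<eta> k \<notin> insert (code (\<eta> (n - 1) 0)) (\<Union>(supp ` U))"
      if k: "k \<ge> max k0 (Suc (length (snd (snd (code (\<eta> (n - 1) 0))))))" for k
    proof -
      have "length (snd (snd (coord (M \<eta>) \<eta> k))) = k" by (simp add: coord_def)
      then have "coord (M \<eta>) \<eta> k \<noteq> code (\<eta> (n - 1) 0)" using k by auto
      then show ?thesis using k0 k by simp
    qed
    then show "\<exists>k0. \<forall>k\<ge>k0. coord (M \<eta>) \<eta> k \<notin> insert (code (\<eta> (n - 1) 0)) (\<Union>(supp ` U))"
      by blast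
  qed
  from bchoice[OF this] obtain K' where
    K': "\<forall>\<eta>\<in>V - U. \<forall>k\<ge>K' \<eta>. coord (M \<eta>) \<eta> k \<notin> insert (code (\<eta> (n - 1) 0)) (\<Union>(supp ` U))" ..
  let ?K = "\<lambda>\<eta>. max (K \<eta>) (K' \<eta>)"
  show ?thesis
    unfolding root_free_def
  proof (intro exI conjI ballI)
    fix \<eta> assume "\<eta> \<in> V - U"
    then show "M \<eta> < n" "\<forall>k\<ge>?K \<eta>. coord (M \<eta>) \<eta> k \<notin> insert (code (\<eta> (n - 1) 0)) (\<Union>(supp ` U))"
      using M K' by simp_all
  next
    show "wf {(\<eta>, \<eta>'). \<eta> \<in> V - U \<and> \<eta>' \<in> V - U \<and> \<eta> \<noteq> \<eta>' \<and> (\<exists>k\<ge>?K \<eta>. coord (M \<eta>) \<eta> k \<in> supp \<eta>')}"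
    proof (rule wf_subset[OF wf], rule subrelI)
      fix \<eta> \<eta>' assume "(\<eta>, \<eta>') \<in> {(\<eta>, \<eta>'). \<eta> \<in> V - U \<and> \<eta>' \<in> V - U \<and> \<eta> \<noteq> \<eta>' \<and> (\<exists>k\<ge>?K \<eta>. coord (M \<eta>) \<eta> k \<in> supp \<eta>')}"
      then have "\<eta> \<in> V - U \<and> \<eta>' \<in> V - U \<and> \<eta> \<noteq> \<eta>' \<and> (\<exists>k\<ge>K \<eta>. coord (M \<eta>) \<eta> k \<in> supp \<eta>')" by auto
      then show "(\<eta>, \<eta>') \<in> {(\<eta>, \<eta>'). \<eta> \<in> V - U \<and> \<eta>' \<in> V - U \<and> \<eta> \<noteq> \<eta>' \<and> (\<exists>k\<ge>K \<eta>. coord (M \<eta>) \<eta> k \<in> supp \<eta>')}"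
        by simp
    qed
  qed
qed

lemma root_free_below:
  assumes "\<nu> \<in> Field \<kappa>" shows "root_free {} (L_below \<nu>)"
  by (rule root_free_L[OF L_below_subset L_below_ordLeq[OF assms]]) simp

text \<open>
  Beyond a successor \<open>\<nu>\<close> the last branch of \<open>\<eta>\<close> has an entry that exceeds every entry used below \<open>\<nu>\<close>.
\<close>

lemma root_free_above:
  assumes succ: "succ_elem \<kappa> \<nu>" and \<rho>: "\<nu> \<in> underS \<kappa> \<rho>"
  shows "root_free (L_below \<nu>) (L_below \<rho>)"
proof (rule root_free_L[OF L_below_subset L_below_ordLeq])
  show "\<rho> \<in> Field \<kappa>" using \<rho> underS_Field by blast
  fix \<eta> m assume \<eta>: "\<eta> \<in> L_below \<rho> - L_below \<nu>" and m: "m < n"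
  obtain u where u: "u \<in> Field \<kappa>" "underS \<kappa> \<nu> = under \<kappa> u"
    using succ unfolding succ_elem_def by blast
  have "u \<in> underS \<kappa> \<nu>" unfolding u(2) under_def using refl[OF u(1)] by simp
  then obtain j where j: "(\<eta> (n - 1) j, u) \<notin> \<kappa>"
    using \<eta> L_below_subset unfolding L_below_def by blast
  have below: "entries n x \<subseteq> under \<kappa> u" if \<eta>': "\<eta>' \<in> L_below \<nu>" and x: "x \<in> supp \<eta>'" for \<eta>' x
  proof -
    obtain u' where "u' \<in> underS \<kappa> \<nu>" "\<forall>k. (\<eta>' (n - 1) k, u') \<in> \<kappa>"
      using \<eta>' unfolding L_below_def by blast
    then have le: "(\<eta>' (n - 1) k, u) \<in> \<kappa>" for k
      unfolding u(2) under_def using trans by blast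
    consider m' k where "m' < n" "x = coord m' \<eta>' k" | "x = code (\<eta>' (n - 1) 0)"
      using x unfolding supp_def by blast
    then show ?thesis
    proof cases
      case 1
      then show ?thesis using entries_coord_subset[of m' n \<eta>' k] le unfolding under_def by blast
    next
      case 2
      obtain k where "\<forall>z\<in>entries n (code (\<eta>' (n - 1) 0)). (z, \<eta>' (n - 1) k) \<in> \<kappa>"
        using code_bounded[OF L_last] \<eta>' L_below_subset by blast
      then show ?thesis unfolding 2 under_def using le trans by blast
    qed
  qed
  \<comment> \<open>A cut at \<open>k > j\<close>, in whichever coordinate, still shows the entry
    \<open>\<eta> (n - 1) j\<close>: either within the remaining prefix or because the last branch
    is kept whole.\<close>
  have "coord m \<eta> k \<notin> \<Union>(supp ` L_below \<nu>)" if "k \<ge> Suc j" for k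
  proof
    assume "coord m \<eta> k \<in> \<Union>(supp ` L_below \<nu>)"
    then have "entries n (coord m \<eta> k) \<subseteq> under \<kappa> u" using below by blast
    then show False using in_entries_coord[OF m, of j k \<eta>] that j unfolding under_def by auto
  qed
  then show "\<exists>k0. \<forall>k\<ge>k0. coord m \<eta> k \<notin> \<Union>(supp ` L_below \<nu>)" by blast
qed

lemma strongly_free_trivial_dual: "\<exists>G :: 'a monoid. strongly_free \<kappa> G \<and> trivial_dual G"
proof -
  let ?S = "span_of L"
  have "|?S| =o |Field \<kappa>|"
    using carrier_ordIso card_of_Field_ordIso[OF \<kappa>(1)] ordIso_symmetric ordIso_transitive by blast
  \<comment> \<open>The group consists of functions; this bijection carries it over to the field of
    \<open>\<kappa>\<close>, on whose type it is wanted.\<close>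
  then obtain \<theta> where \<theta>: "bij_betw \<theta> ?S (Field \<kappa>)" using card_of_ordIso by blast
  interpret transported \<theta> ?S
    by unfold_locales (rule bij_betw_imp_inj_on[OF \<theta>])
  define G where "G = vgroup \<theta> ?S ?S"
  define F where "F \<nu> = span_of (L_below \<nu>)" for \<nu>
  have FS: "F \<nu> \<subseteq> ?S" for \<nu> unfolding F_def by (rule span_of_mono[OF L_below_subset])
  have subF: "Z.subspace (F \<nu>)" for \<nu> by (simp add: F_def subspace_span_of)
  have subS: "Z.subspace ?S" by (rule subspace_span_of)
  have Fmono: "F \<nu> \<subseteq> F \<rho>" if "(\<nu>, \<rho>) \<in> \<kappa>" for \<nu> \<rho>
    unfolding F_def by (rule span_of_mono[OF L_below_mono[OF that]])
  have chain: "L_below i \<subseteq> L_below j \<or> L_below j \<subseteq> L_below i" if "i \<in> Field \<kappa>" "j \<in> Field \<kappa>" for i j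
    using total[of i j] that L_below_mono by blast
  have filt: "filtration \<kappa> G (\<lambda>\<nu>. \<theta> ` F \<nu>)"
    unfolding filtration_def
  proof (intro conjI ballI allI impI)
    fix \<nu> assume "\<nu> \<in> Field \<kappa>"
    show "subgroup (\<theta> ` F \<nu>) G"
      unfolding G_def by (rule subgroup_vgroup[OF subS subset_refl subF FS])
    show "|\<theta> ` F \<nu>| <o \<kappa>"
      unfolding ordLess_iff F_def by (intro image_ordLeq span_of_ordLeq[OF \<mu>] L_below_ordLeq) fact
  next
    fix \<nu> \<rho> assume "(\<nu>, \<rho>) \<in> \<kappa>"
    then show "\<theta> ` F \<nu> \<subseteq> \<theta> ` F \<rho>" by (intro image_mono Fmono)
  next
    fix \<nu> assume lim: "limit_elem \<kappa> \<nu>"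
    have "F \<nu> = (\<Union>u\<in>underS \<kappa> \<nu>. F u)"
      unfolding F_def L_below_limit[OF lim]
    proof (rule span_of_Union)
      show "underS \<kappa> \<nu> \<noteq> {}" using lim by (simp add: limit_elem_def)
    qed (use chain underS_Field in blast)
    then show "\<theta> ` F \<nu> = (\<Union>u\<in>underS \<kappa> \<nu>. \<theta> ` F u)" by (simp add: image_UN)
  next
    have "Field \<kappa> \<noteq> {}" using Cinfinite_\<kappa> by (auto simp: cinfinite_def)
    then have "?S = (\<Union>\<nu>\<in>Field \<kappa>. F \<nu>)"
      unfolding F_def by (subst L_below_union) (rule span_of_Union[OF _ chain])
    then have "\<theta> ` ?S = (\<Union>\<nu>\<in>Field \<kappa>. \<theta> ` F \<nu>)" by (metis image_UN)
    then show "(\<Union>\<nu>\<in>Field \<kappa>. \<theta> ` F \<nu>) = carrier G" by (simp add: G_def)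
  qed
  have free: "free_abelian (G\<lparr>carrier := \<theta> ` F \<nu>\<rparr>)" if \<nu>: "\<nu> \<in> Field \<kappa>" for \<nu>
  proof -
    \<comment> \<open>Freeness of a stage is the case of a quotient by the trivial group, spanned by
      no tuples.\<close>
    have "span_of {} = {0}" by (simp add: span_of_def)
    then obtain I v where v: "\<forall>i\<in>(I :: ((nat \<Rightarrow> nat \<Rightarrow> 'a) \<times> nat + nat \<times> (nat \<Rightarrow> nat \<Rightarrow> 'a) \<times> 'a list) set). v i \<in> F \<nu>"
      "\<forall>u\<in>F \<nu>. \<exists>p. Poly_Mapping.keys p \<subseteq> I \<and> (\<exists>w\<in>{0}. u = w + lincomb v p)"
      "\<forall>p. Poly_Mapping.keys p \<subseteq> I \<longrightarrow> lincomb v p \<in> {0} \<longrightarrow> p = 0"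
      using root_free_basis[OF _ root_free_below[OF \<nu>]] unfolding F_def by auto
    then show ?thesis
      unfolding G_def carrier_update_vgroup
      by (intro free_abelian_vgroup[OF subF FS]) simp_all
  qed
  have free_quot: "free_abelian (G\<lparr>carrier := \<theta> ` F \<rho>\<rparr> Mod \<theta> ` F \<nu>)"
    if succ: "succ_elem \<kappa> \<nu>" "\<nu> \<in> underS \<kappa> \<rho>" for \<nu> \<rho>
  proof -
    have "L_below \<nu> \<subseteq> L_below \<rho>" using L_below_mono succ(2) underS_Field by blast
    then obtain I v where v: "\<forall>i\<in>(I :: ((nat \<Rightarrow> nat \<Rightarrow> 'a) \<times> nat + nat \<times> (nat \<Rightarrow> nat \<Rightarrow> 'a) \<times> 'a list) set). v i \<in> F \<rho>"
      "\<forall>u\<in>F \<rho>. \<exists>p. Poly_Mapping.keys p \<subseteq> I \<and> (\<exists>w\<in>F \<nu>. u = w + lincomb v p)"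
      "\<forall>p. Poly_Mapping.keys p \<subseteq> I \<longrightarrow> lincomb v p \<in> F \<nu> \<longrightarrow> p = 0"
      using root_free_basis[OF _ root_free_above[OF succ]] unfolding F_def by auto
    then show ?thesis
      unfolding G_def carrier_update_vgroup
      using succ(2) underS_Field Fmono
      by (intro free_abelian_vgroup_Mod[OF subF FS subF _ v]) blast
  qed
  have "strongly_free \<kappa> G"
    unfolding strongly_free_def
  proof (intro conjI exI ballI allI impI)
    show "comm_group G" unfolding G_def by (rule comm_group_vgroup[OF subS subset_refl])
    show "natLeq <o \<kappa>"
      using natLeq_ordLeq_cinfinite[OF \<mu>] \<mu>_less ordLeq_ordLess_trans by blast
    have "carrier G = Field \<kappa>" using \<theta> by (simp add: G_def bij_betw_def)
    then show "|carrier G| =o \<kappa>" using card_of_Field_ordIso[OF \<kappa>(1)] by simp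
  qed (use \<kappa>(1) filt free free_quot in auto)
  moreover have "trivial_dual G"
    unfolding trivial_dual_def
  proof (intro ballI)
    fix h x assume h: "h \<in> hom G integer_group" and "x \<in> carrier G"
    then obtain v where v: "v \<in> ?S" "x = \<theta> v" by (auto simp: G_def)
    have "(h \<circ> \<theta>) v = 0"
    proof (rule hom_vanishes[OF _ _ v(1)])
      fix u w assume uw: "u \<in> ?S" "w \<in> ?S"
      then have "h (\<theta> u \<otimes>\<^bsub>G\<^esub> \<theta> w) = h (\<theta> u) + h (\<theta> w)"
        using hom_mult[OF h, of "\<theta> u" "\<theta> w"] by (simp add: G_def)
      then show "(h \<circ> \<theta>) (u + w) = (h \<circ> \<theta>) u + (h \<circ> \<theta>) w"
        using uw by (simp add: G_def mult_vgroup)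
    next
      fix f \<eta> x assume \<eta>: "\<eta> \<in> L" and x: "x \<in> supp \<eta>"
      have "x \<in> code ` Field \<kappa>"
        using x coord_coded[OF \<eta>[unfolded L_def]] range_L[OF \<eta>] unfolding supp_def by blast
      then obtain \<xi> where "\<xi> \<in> Field \<kappa>" "x = code \<xi>" by blast
      then show "\<exists>\<eta>'\<in>L. code (\<eta>' (n - 1) 0) = x \<and> g \<eta>' = solvable (\<lambda>k. \<Sum>m<n. f (coord m \<eta>' k))"
        using prediction[of \<xi> f] unfolding L_def by blast
    qed
    then show "h x = 0" using v(2) by simp
  qed
  ultimately show ?thesis by blast
qed

end

section \<open>Prediction\<close>

text \<open>A cardinal of the form 2 to the power \<open>\<mu>\<close> does not grow under exponents
  up to \<open>\<mu>\<close>, because \<open>\<mu>\<close> times \<open>\<mu>\<close> is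
  \<open>\<mu>\<close>. The exponent law asks for a nonempty exponent, hence the case
  distinction.\<close>

lemma PiE_const_ordLeq:
  assumes exp: "ctwo ^c \<mu> =o \<mu>'" and \<mu>: "Cinfinite \<mu>" and X: "|X| \<le>o \<mu>" and Y: "|Y| \<le>o \<mu>'"
  shows "|PiE X (\<lambda>_. Y)| \<le>o \<mu>'"
proof (cases "X = {}")
  case True
  have "natLeq \<le>o \<mu>" by (rule natLeq_ordLeq_cinfinite[OF \<mu>])
  also have "\<mu> \<le>o ctwo ^c \<mu>" by (rule ordLeq_cexp2[OF ordLeq_refl[OF Card_order_ctwo]]) (use \<mu> in blast)
  also have "ctwo ^c \<mu> =o \<mu>'" by (rule exp)
  finally have "natLeq \<le>o \<mu>'" .
  moreover have "|PiE X (\<lambda>_. Y)| \<le>o natLeq"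
    unfolding True PiE_empty_domain by (rule finite_ordLeq_Cinfinite[OF natLeq_Cinfinite]) simp
  ultimately show ?thesis by (rule ordLeq_transitive[rotated])
next
  case False
  have nz: "Cnotzero |X|" using False by (simp add: card_of_ordIso_czero_iff_empty card_of_Card_order)
  have eq: "PiE X (\<lambda>_. Y) = Func X Y"
    by (auto simp: Func_def PiE_def Pi_def extensional_def)
  have "|Y| \<le>o ctwo ^c \<mu>" using Y exp ordIso_symmetric ordLeq_ordIso_trans by blast
  then have "|Y| ^c |X| \<le>o (ctwo ^c \<mu>) ^c |X|"
    by (rule cexp_mono1) (rule card_of_Card_order)
  also have "(ctwo ^c \<mu>) ^c |X| =o ctwo ^c \<mu>"
    by (rule cexp_cprod_ordLeq[OF Card_order_ctwo \<mu> nz X])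
  also have "ctwo ^c \<mu> =o \<mu>'" by (rule exp)
  finally show ?thesis by (simp add: eq cexp_def Field_card_of)
qed

section \<open>Blocks between consecutive limits\<close>

context successor_cardinal
begin

lemma Field_nonempty: "Field \<kappa> \<noteq> {}"
  using Cinfinite_\<kappa> by (auto simp: cinfinite_def)

lemma finite_max:
  assumes "finite K" "K \<noteq> {}" "K \<subseteq> Field \<kappa>"
  obtains z where "z \<in> K" "K \<subseteq> under \<kappa> z"
  using finite_max_Well_order[of \<kappa> K] assms wo unfolding wo_rel_def under_def by blast

text \<open>For a limit \<^term>\<open>\<delta>\<close> these are the elements below the next limit.\<close>

definition finitely_above :: "'a \<Rightarrow> 'a set" where
  "finitely_above \<delta> = {z \<in> Field \<kappa>. finite {w. (\<delta>, w) \<in> \<kappa> \<and> (w, z) \<in> \<kappa>}}"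

lemma under_finitely_above: "\<delta> \<in> Field \<kappa> \<Longrightarrow> under \<kappa> \<delta> \<subseteq> finitely_above \<delta>"
proof
  fix z assume "\<delta> \<in> Field \<kappa>" and z: "z \<in> under \<kappa> \<delta>"
  have "{w. (\<delta>, w) \<in> \<kappa> \<and> (w, z) \<in> \<kappa>} \<subseteq> {\<delta>}"
    using z trans[of _ z \<delta>] antisym[of \<delta>] unfolding under_def by blast
  then have "finite {w. (\<delta>, w) \<in> \<kappa> \<and> (w, z) \<in> \<kappa>}" by (rule finite_subset) simp
  moreover have "z \<in> Field \<kappa>" using z unfolding under_def Field_def by blast
  ultimately show "z \<in> finitely_above \<delta>" by (simp add: finitely_above_def)
qed

lemma finitely_above_mono: "(\<delta>, \<delta>') \<in> \<kappa> \<Longrightarrow> finitely_above \<delta> \<subseteq> finitely_above \<delta>'"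
proof
  fix z assume "(\<delta>, \<delta>') \<in> \<kappa>" "z \<in> finitely_above \<delta>"
  moreover from this have "{w. (\<delta>', w) \<in> \<kappa> \<and> (w, z) \<in> \<kappa>} \<subseteq> {w. (\<delta>, w) \<in> \<kappa> \<and> (w, z) \<in> \<kappa>}"
    using trans[of \<delta> \<delta>'] by blast
  ultimately show "z \<in> finitely_above \<delta>'"
    using finite_subset unfolding finitely_above_def by blast
qed

text \<open>Starting the interval at the predecessor adds just one point to it. This will prevent a
  least stage of disagreement from being a successor.\<close>

lemma finitely_above_pred:
  assumes "z \<in> Field \<kappa>" "\<delta> \<in> Field \<kappa>" "underS \<kappa> \<delta> = under \<kappa> z"
  shows "finitely_above \<delta> \<subseteq> finitely_above z"
proof
  fix x assume x: "x \<in> finitely_above \<delta>"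
  have "{w. (z, w) \<in> \<kappa> \<and> (w, x) \<in> \<kappa>} \<subseteq> insert z {w. (\<delta>, w) \<in> \<kappa> \<and> (w, x) \<in> \<kappa>}"
  proof
    fix w assume w: "w \<in> {w. (z, w) \<in> \<kappa> \<and> (w, x) \<in> \<kappa>}"
    show "w \<in> insert z {w. (\<delta>, w) \<in> \<kappa> \<and> (w, x) \<in> \<kappa>}"
    proof (cases "w = z")
      case False
      have wF: "w \<in> Field \<kappa>" using w by (auto simp: Field_def)
      have "w \<notin> under \<kappa> z" using w False antisym[of w z] unfolding under_def by blast
      then have "w \<notin> underS \<kappa> \<delta>" using assms(3) by simp
      then have "(\<delta>, w) \<in> \<kappa>" using total[of w \<delta>] wF assms(2) refl[OF wF] by (auto simp: underS_def)
      then show ?thesis using w by simp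
    qed simp
  qed
  then show "x \<in> finitely_above z"
    using x finite_subset unfolding finitely_above_def by auto
qed

lemma underS_inject:
  assumes "underS \<kappa> \<delta> = underS \<kappa> \<delta>'" "\<delta> \<in> Field \<kappa>" "\<delta>' \<in> Field \<kappa>"
  shows "\<delta> = \<delta>'"
  using assms total[of \<delta> \<delta>'] by (auto simp: underS_def)

lemma limit_not_le:
  assumes "limit_elem \<kappa> \<delta>" "u \<in> Field \<kappa>" "underS \<kappa> \<delta> \<subseteq> under \<kappa> u"
  shows "(\<delta>, u) \<in> \<kappa>"
proof (rule ccontr)
  assume no: "(\<delta>, u) \<notin> \<kappa>"
  have \<delta>: "\<delta> \<in> Field \<kappa>" "\<not> succ_elem \<kappa> \<delta>" using assms(1) by (simp_all add: limit_elem_def)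
  have "u \<in> underS \<kappa> \<delta>" using total[of \<delta> u] \<delta>(1) assms(2) no refl[OF \<delta>(1)] by (auto simp: underS_def)
  then have "under \<kappa> u \<subseteq> underS \<kappa> \<delta>" using underS_trans1 unfolding under_def by blast
  then show False using assms(2,3) \<delta>(2) unfolding succ_elem_def by blast
qed

end

text \<open>
  Weak diamond of Devlin and Shelah. If the principle failed, then from \<open>f\<close> one could pass to functions
  \<open>h s\<close> whose restrictions below a limit \<open>\<delta>\<close> determine, through \<open>\<Phi>\<close>, the bits of all \<open>h s\<close> on the
  next countable block, so that \<open>f\<close> would be determined by a countable amount of data.
\<close>

lemma (in successor_cardinal) weak_diamond:
  fixes \<Phi> :: "'a \<Rightarrow> 'a \<Rightarrow> ('a list \<Rightarrow> int) \<Rightarrow> bool"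
  assumes \<mu>0: "\<mu> =o natLeq" and exp: "ctwo ^c \<mu> =o \<kappa>"
    and \<beta>: "\<And>\<xi>. \<xi> \<in> Field \<kappa> \<Longrightarrow> \<beta> \<xi> \<in> Field \<kappa>"
    and local: "\<And>\<delta> \<xi> f f'. limit_elem \<kappa> \<delta> \<Longrightarrow> \<xi> \<in> Field \<kappa> \<Longrightarrow> \<beta> \<xi> \<in> underS \<kappa> \<delta> \<Longrightarrow>
      (\<And>l. set l \<subseteq> underS \<kappa> \<delta> \<Longrightarrow> f l = f' l) \<Longrightarrow> \<Phi> \<delta> \<xi> f = \<Phi> \<delta> \<xi> f'"
  shows "\<exists>g. \<forall>f. \<forall>\<xi>\<in>Field \<kappa>. \<exists>\<delta>. limit_elem \<kappa> \<delta> \<and> \<beta> \<xi> \<in> underS \<kappa> \<delta> \<and> g \<delta> = \<Phi> \<delta> \<xi> f"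
proof (rule ccontr)
  assume neg: "\<not> ?thesis"
  have ctbl: "countable X" if "|X| \<le>o \<mu>" for X :: "'a set"
  proof -
    have "|X| \<le>o natLeq" using that \<mu>0 ordLeq_ordIso_trans by blast
    then have "|X| \<le>o |UNIV :: nat set|" using card_of_nat ordIso_symmetric ordLeq_ordIso_trans by blast
    then show ?thesis by (simp add: countable_card_of_nat)
  qed
  let ?N = finitely_above
  have N_countable: "countable (?N \<delta>)" if \<delta>: "\<delta> \<in> Field \<kappa>" for \<delta>
  proof -
    let ?seg = "\<lambda>z. {w. (\<delta>, w) \<in> \<kappa> \<and> (w, z) \<in> \<kappa>}"
    let ?R = "{z. (\<delta>, z) \<in> \<kappa> \<and> finite (?seg z)}"
    have "inj_on (\<lambda>z. card (?seg z)) ?R"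
    proof (rule inj_onI)
      have less: "card (?seg z) < card (?seg z')" if "finite (?seg z')" "(z, z') \<in> \<kappa>" "z \<noteq> z'" "(\<delta>, z') \<in> \<kappa>" for z z'
      proof (rule psubset_card_mono[OF that(1)])
        have "z' \<in> ?seg z'" using that refl[of z'] by (auto simp: Field_def)
        moreover have "z' \<notin> ?seg z" using that antisym[of z z'] by blast
        moreover have "?seg z \<subseteq> ?seg z'" using trans[of _ z z'] that(2) by blast
        ultimately show "?seg z \<subset> ?seg z'" by blast
      qed
      fix z z' assume *: "z \<in> ?R" "z' \<in> ?R" "card (?seg z) = card (?seg z')"
      show "z = z'"
      proof (rule ccontr)
        assume "z \<noteq> z'"
        moreover have "(z, z') \<in> \<kappa> \<or> (z', z) \<in> \<kappa>" using * total[of z z'] by (auto simp: Field_def)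
        ultimately show False using less[of z' z] less[of z z'] * by auto
      qed
    qed
    then have "countable ?R" by (rule countableI')
    moreover have "countable (underS \<kappa> \<delta>)" by (rule ctbl[OF underS_ordLeq[OF \<delta>]])
    moreover have "?N \<delta> \<subseteq> underS \<kappa> \<delta> \<union> ?R"
    proof
      fix z assume z: "z \<in> ?N \<delta>"
      then have "z \<in> Field \<kappa>" "finite (?seg z)" by (simp_all add: finitely_above_def)
      then show "z \<in> underS \<kappa> \<delta> \<union> ?R"
        using total[of z \<delta>] \<delta> refl[OF \<delta>] by (cases "z = \<delta>") (auto simp: underS_def)
    qed
    ultimately show ?thesis by (meson countable_subset countable_Un)
  qed
  have "\<forall>g. \<exists>p. snd p \<in> Field \<kappa> \<and> (\<forall>\<delta>. limit_elem \<kappa> \<delta> \<and> \<beta> (snd p) \<in> underS \<kappa> \<delta> \<longrightarrow> g \<delta> \<noteq> \<Phi> \<delta> (snd p) (fst p))"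
  proof
    fix g
    have "\<exists>f \<xi>. \<xi> \<in> Field \<kappa> \<and> (\<forall>\<delta>. limit_elem \<kappa> \<delta> \<and> \<beta> \<xi> \<in> underS \<kappa> \<delta> \<longrightarrow> g \<delta> \<noteq> \<Phi> \<delta> \<xi> f)"
      using neg by blast
    then obtain f \<xi> where "\<xi> \<in> Field \<kappa>" "\<forall>\<delta>. limit_elem \<kappa> \<delta> \<and> \<beta> \<xi> \<in> underS \<kappa> \<delta> \<longrightarrow> g \<delta> \<noteq> \<Phi> \<delta> \<xi> f"
      by blast
    then show "\<exists>p. snd p \<in> Field \<kappa> \<and> (\<forall>\<delta>. limit_elem \<kappa> \<delta> \<and> \<beta> (snd p) \<in> underS \<kappa> \<delta> \<longrightarrow> g \<delta> \<noteq> \<Phi> \<delta> (snd p) (fst p))"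
      by (intro exI[of _ "(f, \<xi>)"]) simp
  qed
  \<comment> \<open>Where \<open>g\<close> fails as a predictor it differs from
    \<open>\<Phi>\<close> at every limit above a bound. So \<open>W g\<close> stores
    \<open>g\<close>: as the negation of \<open>\<Phi>\<close> applied to the stored function and
    point.\<close>
  from choice[OF this] obtain W where
    W: "\<And>g. snd (W g) \<in> Field \<kappa>"
    "\<And>g \<delta>. limit_elem \<kappa> \<delta> \<Longrightarrow> \<beta> (snd (W g)) \<in> underS \<kappa> \<delta> \<Longrightarrow> g \<delta> \<noteq> \<Phi> \<delta> (snd (W g)) (fst (W g))"
    by blast
  define w where "w \<delta> = from_nat_into (lists (?N \<delta>) \<times> (UNIV :: int set))" for \<delta>
  have w: "\<exists>m. w \<delta> m = (l, c)" if "\<delta> \<in> Field \<kappa>" "set l \<subseteq> ?N \<delta>" for \<delta> l c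
  proof -
    have "countable (lists (?N \<delta>) \<times> (UNIV :: int set))"
      using N_countable[OF that(1)] by (intro countable_SIGMA countable_lists) auto
    moreover have "(l, c) \<in> lists (?N \<delta>) \<times> (UNIV :: int set)" using that(2) by auto
    ultimately show ?thesis unfolding w_def by (rule from_nat_into_surj)
  qed
  \<comment> \<open>Countably many bits describe an integer-valued function on the lists over
    \<open>?N \<delta>\<close>: the bit of \<open>m\<close> asks whether the \<open>m\<close>-th
    pair of a list and a value belongs to its graph.\<close>
  define bit where "bit f m \<delta> = (f (fst (w \<delta> m)) = snd (w \<delta> m))" for f m \<delta>
  \<comment> \<open>The closure of \<open>f0\<close> under storing: \<open>h f0 (m # s)\<close>
    stores the \<open>m\<close>-th bits of \<open>h f0 s\<close>, so every bit of every function in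
    the family is stored by another member.\<close>
  define h where "h f0 = rec_list f0 (\<lambda>m s f. fst (W (bit f m)))" for f0
  have h: "h f0 [] = f0" "h f0 (m # s) = fst (W (bit (h f0 s) m))" for f0 m s
    by (simp_all add: h_def)
  define x where "x f0 = (\<lambda>(s, m). snd (W (bit (h f0 s) m)))" for f0
  have xF: "x f0 sm \<in> Field \<kappa>" for f0 sm
    by (cases sm) (simp add: x_def W)
  have "\<exists>D. D \<in> Field \<kappa> \<and> (\<forall>sm. \<beta> (x f0 sm) \<in> underS \<kappa> D)" for f0
  proof -
    have "range (\<lambda>sm. \<beta> (x f0 sm)) \<subseteq> Field \<kappa>" using \<beta>[OF xF] by blast
    moreover have "|range (\<lambda>sm. \<beta> (x f0 sm))| \<le>o \<mu>"
      by (rule countable_ordLeq_Cinfinite[OF \<mu>]) simp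
    ultimately obtain D where "D \<in> Field \<kappa>" "\<And>z. z \<in> range (\<lambda>sm. \<beta> (x f0 sm)) \<Longrightarrow> z \<in> underS \<kappa> D"
      by (rule strict_bound) blast
    then show ?thesis by blast
  qed
  then have "\<forall>f0. \<exists>D. D \<in> Field \<kappa> \<and> (\<forall>sm. \<beta> (x f0 sm) \<in> underS \<kappa> D)" by blast
  from choice[OF this] obtain D where D: "\<And>f0. D f0 \<in> Field \<kappa>" "\<And>f0 sm. \<beta> (x f0 sm) \<in> underS \<kappa> (D f0)"
    by blast
  \<comment> \<open>All stored points, a stage \<open>D f0\<close> above their bounds, and the
    values of the whole family up to the end of its block. From there on the stored bits determine
    everything.\<close>
  define data where "data f0 = (D f0, x f0, restrict (\<lambda>(s, l). h f0 s l) (UNIV \<times> lists (?N (D f0))))" for f0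
  have determined: "h f0 s l = h f1 s l" if same: "data f0 = data f1" and l: "set l \<subseteq> Field \<kappa>" for f0 f1 s l
  proof (rule ccontr)
    assume neq: "h f0 s l \<noteq> h f1 s l"
    have D1: "D f1 = D f0" and x1: "x f1 = x f0" using same by (simp_all add: data_def)
    have start: "h f0 s l = h f1 s l" if "set l \<subseteq> ?N (D f0)" for s l
    proof -
      have "restrict (\<lambda>(s, l). h f0 s l) (UNIV \<times> lists (?N (D f0))) (s, l)
          = restrict (\<lambda>(s, l). h f1 s l) (UNIV \<times> lists (?N (D f0))) (s, l)"
        using same D1 by (simp only: data_def prod.inject)
      moreover have "l \<in> lists (?N (D f0))" using that by (simp add: in_lists_conv_set subset_iff)
      ultimately show ?thesis by simp
    qed
    \<comment> \<open>Agreement is tested on the whole block after \<open>\<delta>\<close>, since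
      the bits at \<open>\<delta>\<close> describe the functions that far; a least disagreement can
      then occur only at a limit.\<close>
    define bad where "bad = {\<delta> \<in> Field \<kappa>. \<exists>s l. set l \<subseteq> ?N \<delta> \<and> h f0 s l \<noteq> h f1 s l}"
    have "bad \<noteq> {}"
    proof (cases "l = []")
      case True
      then show ?thesis using start[of l s] neq by simp
    next
      case False
      obtain z where z: "z \<in> set l" "set l \<subseteq> under \<kappa> z"
        using finite_max[of "set l"] l False by auto
      then have "set l \<subseteq> ?N z" using under_finitely_above[of z] l by blast
      then have "z \<in> bad" unfolding bad_def using z(1) l neq by blast
      then show ?thesis by blast
    qed
    define \<delta> where "\<delta> = wo_rel.minim \<kappa> bad"
    have badF: "bad \<subseteq> Field \<kappa>" by (auto simp: bad_def)
    have \<delta>: "\<delta> \<in> bad" unfolding \<delta>_def by (rule wo_rel.minim_in[OF wo badF \<open>bad \<noteq> {}\<close>])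
    have least: "(\<delta>, z) \<in> \<kappa>" if "z \<in> bad" for z
      unfolding \<delta>_def by (rule wo_rel.minim_least[OF wo badF that])
    have \<delta>F: "\<delta> \<in> Field \<kappa>" using \<delta> badF by blast
    have good: "h f0 s l = h f1 s l" if z: "z \<in> underS \<kappa> \<delta>" and l: "set l \<subseteq> ?N z" for z s l
    proof (rule ccontr)
      assume "h f0 s l \<noteq> h f1 s l"
      then have "z \<in> bad" unfolding bad_def using l underS_Field[OF z] by blast
      then have "(\<delta>, z) \<in> \<kappa>" by (rule least)
      then show False using underS_Field[OF z] antisym[of z \<delta>] by blast
    qed
    obtain s1 l1 where l1: "set l1 \<subseteq> ?N \<delta>" "h f0 s1 l1 \<noteq> h f1 s1 l1"
      using \<delta> unfolding bad_def by blast
    have "(\<delta>, D f0) \<notin> \<kappa>"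
    proof
      assume "(\<delta>, D f0) \<in> \<kappa>"
      then have "set l1 \<subseteq> ?N (D f0)" using finitely_above_mono l1(1) by blast
      then show False using start l1(2) by blast
    qed
    then have D\<delta>: "D f0 \<in> underS \<kappa> \<delta>"
      using total[of \<delta> "D f0"] \<delta>F D(1) refl[OF \<delta>F] by (auto simp: underS_def)
    have "\<not> succ_elem \<kappa> \<delta>"
    proof
      assume "succ_elem \<kappa> \<delta>"
      then obtain z where z: "z \<in> Field \<kappa>" "underS \<kappa> \<delta> = under \<kappa> z" unfolding succ_elem_def by blast
      have "z \<in> underS \<kappa> \<delta>" unfolding z(2) using refl[OF z(1)] by (simp add: under_def)
      moreover have "set l1 \<subseteq> ?N z" using finitely_above_pred[OF z(1) \<delta>F z(2)] l1(1) by blast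
      ultimately show False using good l1(2) by blast
    qed
    then have lim: "limit_elem \<kappa> \<delta>" using \<delta>F D\<delta> unfolding limit_elem_def by blast
    have below: "h f0 s l = h f1 s l" if l: "set l \<subseteq> underS \<kappa> \<delta>" for s l
    proof (cases "l = []")
      case True
      then show ?thesis using good[OF D\<delta>, of l s] by simp
    next
      case False
      have lF: "set l \<subseteq> Field \<kappa>" using l underS_Field by blast
      obtain z where z: "z \<in> set l" "set l \<subseteq> under \<kappa> z"
        using finite_max[of "set l"] lF False by auto
      then have "set l \<subseteq> ?N z" using under_finitely_above[of z] lF by blast
      then show ?thesis using good[of z l s] z(1) l by blast
    qed
    \<comment> \<open>By minimality of \<open>\<delta>\<close> both families agree below it, so
      locality gives \<open>\<Phi>\<close> the same value on them; each bit is the negation of that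
      value.\<close>
    have bits: "bit (h f0 s) m \<delta> = bit (h f1 s) m \<delta>" for s m
    proof -
      let ?\<xi> = "snd (W (bit (h f0 s) m))"
      have eq: "snd (W (bit (h f1 s) m)) = ?\<xi>"
        using fun_cong[OF x1, of "(s, m)"] by (simp add: x_def)
      have \<beta>\<delta>: "\<beta> ?\<xi> \<in> underS \<kappa> \<delta>"
      proof (rule underS_trans1[OF _ D\<delta>])
        show "(\<beta> ?\<xi>, D f0) \<in> \<kappa>" using D(2)[of f0 "(s, m)"] underS_Field by (simp add: x_def)
      qed
      have "\<Phi> \<delta> ?\<xi> (h f0 (m # s)) = \<Phi> \<delta> ?\<xi> (h f1 (m # s))"
        by (rule local[OF lim W(1) \<beta>\<delta>]) (rule below)
      moreover have "bit (h f0 s) m \<delta> \<noteq> \<Phi> \<delta> ?\<xi> (h f0 (m # s))"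
        unfolding h by (rule W(2)[OF lim \<beta>\<delta>])
      moreover have "bit (h f1 s) m \<delta> \<noteq> \<Phi> \<delta> ?\<xi> (h f1 (m # s))"
        unfolding h using W(2)[OF lim, of "bit (h f1 s) m"] \<beta>\<delta> unfolding eq by blast
      ultimately show ?thesis by blast
    qed
    obtain m where m: "w \<delta> m = (l1, h f0 s1 l1)" using w[OF \<delta>F l1(1)] by blast
    show False using bits[of s1 m] m l1(2) unfolding bit_def by simp
  qed
  \<comment> \<open>Subsets of \<open>\<kappa>\<close> become functions through the first entry of a
    list. Their data would then embed the power set of \<open>\<kappa>\<close> into a set of size at
    most \<open>\<kappa>\<close>.\<close>
  define F where "F S = (\<lambda>l :: 'a list. of_bool (hd l \<in> S) :: int)" for S :: "'a set"
  have "inj_on (data \<circ> F) (Pow (Field \<kappa>))"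
  proof (rule inj_onI)
    fix S T assume ST: "S \<in> Pow (Field \<kappa>)" "T \<in> Pow (Field \<kappa>)" "(data \<circ> F) S = (data \<circ> F) T"
    have "z \<in> S \<longleftrightarrow> z \<in> T" if "z \<in> Field \<kappa>" for z
    proof -
      have "h (F S) [] [z] = h (F T) [] [z]" by (rule determined) (use ST that in simp_all)
      then show ?thesis by (simp add: h F_def of_bool_def split: if_splits)
    qed
    then show "S = T" using ST by blast
  qed
  moreover define Z where "Z = (\<Union>d\<in>Field \<kappa>. {d} \<times> PiE (UNIV :: (nat list \<times> nat) set) (\<lambda>_. Field \<kappa>)
    \<times> PiE ((UNIV :: nat list set) \<times> lists (?N d)) (\<lambda>_. UNIV :: int set))"
  have "(data \<circ> F) ` Pow (Field \<kappa>) \<subseteq> Z"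
    unfolding Z_def data_def using D(1) xF by auto
  \<comment> \<open>All exponents are countable, and \<open>\<kappa>\<close>, being 2 to the power
    \<open>\<mu>\<close>, is stable under them.\<close>
  moreover have "|Z| \<le>o \<kappa>"
    unfolding Z_def
  proof (intro UNION_Cinfinite_bound[OF _ _ Cinfinite_\<kappa>] ballI Times_ordLeq_Cinfinite Cinfinite_\<kappa>)
    show "|Field \<kappa>| \<le>o \<kappa>" using card_of_Field_ordIso[OF \<kappa>(1)] ordIso_imp_ordLeq by blast
    then show "|PiE (UNIV :: (nat list \<times> nat) set) (\<lambda>_. Field \<kappa>)| \<le>o \<kappa>"
      by (intro PiE_const_ordLeq[OF exp \<mu>] nat_ordLeq_Cinfinite[OF \<mu>])
    show "|{d}| \<le>o \<kappa>" for d :: 'a by (rule finite_ordLeq_Cinfinite[OF Cinfinite_\<kappa>]) simp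
    fix d assume "d \<in> Field \<kappa>"
    then have "countable ((UNIV :: nat list set) \<times> lists (?N d))"
      using N_countable by (intro countable_SIGMA countable_lists) auto
    then show "|PiE ((UNIV :: nat list set) \<times> lists (?N d)) (\<lambda>_. UNIV :: int set)| \<le>o \<kappa>"
      by (intro PiE_const_ordLeq[OF exp \<mu>] countable_ordLeq_Cinfinite[OF \<mu>] nat_ordLeq_Cinfinite[OF Cinfinite_\<kappa>])
  qed
  ultimately have "|Pow (Field \<kappa>)| \<le>o \<kappa>" using card_of_ordLeqI ordLeq_transitive by (metis card_of_ordLeq)
  also have "\<kappa> =o |Field \<kappa>|" using card_of_Field_ordIso[OF \<kappa>(1)] ordIso_symmetric by blast
  finally show False using card_of_Pow[of "Field \<kappa>"] not_ordLess_ordLeq by blast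
qed

section \<open>Chains of alephs and codes for indices\<close>

lemma is_aleph_chain:
  fixes \<kappa> :: "'a rel"
  assumes "is_aleph n \<kappa>"
  shows "\<exists>al :: nat \<Rightarrow> 'a rel. al n = \<kappa> \<and> (\<forall>i\<le>n. is_aleph i (al i))"
  using assms
proof (induction n arbitrary: \<kappa>)
  case 0
  then show ?case by (intro exI[of _ "\<lambda>_. \<kappa>"]) simp
next
  case (Suc n)
  then obtain \<mu> :: "'a rel" where "is_aleph n \<mu>" by auto
  then obtain al :: "nat \<Rightarrow> 'a rel" where al: "\<And>i. i \<le> n \<Longrightarrow> is_aleph i (al i)" using Suc.IH by blast
  show ?case
    using al Suc.prems by (intro exI[of _ "al(Suc n := \<kappa>)"]) (simp add: le_Suc_eq del: is_aleph.simps)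
qed

lemma is_aleph_Suc_ordIso:
  fixes \<mu> \<mu>' :: "'a rel"
  assumes "is_aleph n \<mu>" "is_aleph (Suc n) \<mu>'" shows "\<mu>' =o cardSuc \<mu>"
proof -
  obtain \<mu>0 :: "'a rel" where *: "is_aleph n \<mu>0" "\<mu>' =o cardSuc \<mu>0" using assms(2) by auto
  have "\<mu>0 =o \<mu>" by (rule is_aleph_unique[OF *(1) assms(1)])
  then have "cardSuc \<mu>0 =o cardSuc \<mu>"
    using cardSuc_invar_ordIso[of \<mu>0 \<mu>] is_aleph_Card_order[OF *(1)] is_aleph_Card_order[OF assms(1)] by simp
  then show ?thesis using *(2) ordIso_transitive by blast
qed

text \<open>Course-of-values recursion, by which a branch can record facts about its own initial
  segments.\<close>

lemma exists_from_prefix: "\<exists>b. \<forall>k. b k = F (map b [0..<k])" for F :: "'a list \<Rightarrow> 'a"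
proof -
  define l where "l = rec_nat [] (\<lambda>_ l. l @ [F l])"
  have l: "l 0 = []" "l (Suc k) = l k @ [F (l k)]" for k by (simp_all add: l_def)
  define b where "b = (\<lambda>k. F (l k))"
  have *: "map b [0..<k] = l k" for k
  proof (induction k)
    case (Suc k)
    then show ?case unfolding l(2) by (simp add: b_def)
  qed (simp add: l(1))
  have "b k = F (map b [0..<k])" for k unfolding * by (simp add: b_def)
  then show ?thesis by (intro exI[of _ b] allI)
qed

text \<open>Codes are provided for cuts of arbitrary sequences in \<open>S m\<close>. The admissible
  branches are selected later by a condition that mentions \<open>code\<close>, so
  \<open>code\<close> must not depend on that selection.\<close>

lemma exists_code:
  fixes S :: "nat \<Rightarrow> 'a set"
  assumes \<kappa>: "Cinfinite \<kappa>" and n: "n > 0" and S: "\<And>m. m < n \<Longrightarrow> |{b :: nat \<Rightarrow> 'a. range b \<subseteq> S m}| \<le>o \<kappa>"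
    and ne: "\<And>m. m < n \<Longrightarrow> S m \<noteq> {}"
  shows "\<exists>code. code ` Field \<kappa> = {coord m \<eta> k | m \<eta> k. m < n \<and> \<eta> \<in> PiE {..<n} (\<lambda>m. {b. range b \<subseteq> S m})}"
proof -
  let ?P = "PiE {..<n} (\<lambda>m. {b :: nat \<Rightarrow> 'a. range b \<subseteq> S m})"
  let ?X = "{coord m \<eta> k | m \<eta> k. m < n \<and> \<eta> \<in> ?P}"
  have "?X \<subseteq> (\<lambda>((m, \<eta>), k). coord m \<eta> k) ` (({..<n} \<times> ?P) \<times> (UNIV :: nat set))"
  proof
    fix x assume "x \<in> ?X"
    then obtain m \<eta> k where "x = coord m \<eta> k" "m < n" "\<eta> \<in> ?P" by blast
    then show "x \<in> (\<lambda>((m, \<eta>), k). coord m \<eta> k) ` (({..<n} \<times> ?P) \<times> (UNIV :: nat set))"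
      by (intro image_eqI[of _ _ "((m, \<eta>), k)"]) simp_all
  qed
  moreover have "|({..<n} \<times> ?P) \<times> (UNIV :: nat set)| \<le>o \<kappa>"
    using S by (intro Times_ordLeq_Cinfinite \<kappa> nat_ordLeq_Cinfinite PiE_ordLeq)
  ultimately have "|?X| \<le>o \<kappa>" by (meson subset_ordLeq image_ordLeq)
  then have X: "|?X| \<le>o |Field \<kappa>|"
    using card_of_Field_ordIso[of \<kappa>] \<kappa> ordIso_symmetric ordLeq_ordIso_trans by blast
  have "\<forall>m\<in>{..<n}. \<exists>b :: nat \<Rightarrow> 'a. range b \<subseteq> S m"
  proof
    fix m assume "m \<in> {..<n}"
    then obtain s where "s \<in> S m" using ne by blast
    then have "range (\<lambda>_ :: nat. s) \<subseteq> S m" by blast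
    then show "\<exists>b :: nat \<Rightarrow> 'a. range b \<subseteq> S m" by (intro exI[of _ "\<lambda>_. s"])
  qed
  then have "?P \<noteq> {}" by (simp add: PiE_eq_empty_iff)
  then obtain \<eta> where "\<eta> \<in> ?P" by (meson all_not_in_conv)
  then have "coord 0 \<eta> 0 \<in> ?X" using n by blast
  then have "?X \<noteq> {}" by (metis empty_iff)
  from iffD2[OF card_of_ordLeq2[OF this] X] show ?thesis .
qed

lemma card_seqs:
  assumes "ctwo ^c \<mu> =o \<mu>'" "Cinfinite \<mu>" "|S| \<le>o \<mu>'"
  shows "|{b :: nat \<Rightarrow> 'a. range b \<subseteq> S}| \<le>o \<mu>'"
proof -
  have "{b :: nat \<Rightarrow> 'a. range b \<subseteq> S} \<subseteq> PiE UNIV (\<lambda>_. S)" by auto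
  then show ?thesis
    by (rule subset_ordLeq) (intro PiE_const_ordLeq[OF assms(1,2) _ assms(3)] nat_ordLeq_Cinfinite assms)
qed

lemma (in successor_cardinal) entries_bound:
  assumes code: "code ` Field \<kappa> = {coord m \<eta> k | m \<eta> k. m < n \<and> \<eta> \<in> PiE {..<n} (\<lambda>m. {b. range b \<subseteq> S m})}"
    and n: "n > 0" and S: "S (n - 1) = Field \<kappa>" and \<xi>: "\<xi> \<in> Field \<kappa>"
  shows "\<exists>u\<in>Field \<kappa>. \<forall>z\<in>insert \<xi> (entries n (code \<xi>)). z \<in> underS \<kappa> u"
proof -
  have "code \<xi> \<in> {coord m \<eta> k | m \<eta> k. m < n \<and> \<eta> \<in> PiE {..<n} (\<lambda>m. {b. range b \<subseteq> S m})}"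
    using code \<xi> by blast
  then obtain m \<eta> k where c: "code \<xi> = coord m \<eta> k" "m < n" "\<eta> \<in> PiE {..<n} (\<lambda>m. {b. range b \<subseteq> S m})"
    by blast
  have sub: "entries n (code \<xi>) \<subseteq> range (\<eta> (n - 1))"
    unfolding c(1) by (rule entries_coord_subset[OF c(2)])
  have "n - 1 \<in> {..<n}" using n by simp
  from PiE_mem[OF c(3) this] have "range (\<eta> (n - 1)) \<subseteq> Field \<kappa>" unfolding S by simp
  then have "insert \<xi> (range (\<eta> (n - 1))) \<subseteq> Field \<kappa>" using \<xi> by simp
  moreover have "|insert \<xi> (range (\<eta> (n - 1)))| \<le>o \<mu>"
    by (rule countable_ordLeq_Cinfinite[OF \<mu>]) simp
  ultimately obtain u where "u \<in> Field \<kappa>" "\<And>z. z \<in> insert \<xi> (range (\<eta> (n - 1))) \<Longrightarrow> z \<in> underS \<kappa> u"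
    by (rule strict_bound) blast
  then show ?thesis using sub by blast
qed

section \<open>A single branch and the weak diamond\<close>

lemma aleph_one_case:
  fixes \<kappa> \<mu> :: "'a rel"
  assumes aleph0: "is_aleph 0 \<mu>" and aleph1: "is_aleph 1 \<kappa>" and exp: "ctwo ^c \<mu> =o \<kappa>"
  shows "\<exists>G :: 'a monoid. strongly_free \<kappa> G \<and> trivial_dual G"
proof -
  interpret successor_cardinal \<kappa> \<mu>
  proof
    show "Cinfinite \<mu>" by (rule is_aleph_Cinfinite[OF aleph0])
    show "Card_order \<kappa>" by (rule is_aleph_Card_order[OF aleph1])
    show "\<kappa> =o cardSuc \<mu>" by (rule is_aleph_Suc_ordIso[OF aleph0]) (use aleph1 in simp)
  qed
  have Field_\<kappa>: "|Field \<kappa>| \<le>o \<kappa>" using card_of_Field_ordIso[OF is_aleph_Card_order[OF aleph1]] ordIso_imp_ordLeq by blast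
  have "\<exists>code. code ` Field \<kappa> = {coord m \<eta> k | m \<eta> k. m < 1 \<and> \<eta> \<in> PiE {..<1} (\<lambda>m. {b. range b \<subseteq> Field \<kappa>})}"
    by (rule exists_code[OF Cinfinite_\<kappa>])
      (use card_seqs[OF exp is_aleph_Cinfinite[OF aleph0] Field_\<kappa>] Field_nonempty in simp_all)
  then obtain code where code: "code ` Field \<kappa> = {coord m \<eta> k | m \<eta> k. m < 1 \<and> \<eta> \<in> PiE {..<1} (\<lambda>m. {b. range b \<subseteq> Field \<kappa>})}"
    by blast
  have "\<forall>\<xi>\<in>Field \<kappa>. \<exists>u. u \<in> Field \<kappa> \<and> (\<forall>z\<in>insert \<xi> (entries 1 (code \<xi>)). z \<in> underS \<kappa> u)"
    using entries_bound[where n = 1 and S = "\<lambda>_. Field \<kappa>", OF code] by (simp add: Bex_def)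
  from bchoice[OF this] obtain \<beta> where
    \<beta>: "\<And>\<xi>. \<xi> \<in> Field \<kappa> \<Longrightarrow> \<beta> \<xi> \<in> Field \<kappa>"
    "\<And>\<xi> z. \<xi> \<in> Field \<kappa> \<Longrightarrow> z \<in> insert \<xi> (entries 1 (code \<xi>)) \<Longrightarrow> z \<in> underS \<kappa> (\<beta> \<xi>)"
    by blast
  \<comment> \<open>Entry 0 names the index to be killed; the rest enumerates the ordinals below the
    limit, so that the branch determines the limit.\<close>
  define b where "b \<delta> \<xi> = case_nat \<xi> (from_nat_into (underS \<kappa> \<delta>))" for \<delta> \<xi>
  have range_e: "range (from_nat_into (underS \<kappa> \<delta>)) = underS \<kappa> \<delta>" if "limit_elem \<kappa> \<delta>" for \<delta>
  proof (rule range_from_nat_into)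
    show "underS \<kappa> \<delta> \<noteq> {}" using that by (simp add: limit_elem_def)
    have "|underS \<kappa> \<delta>| \<le>o \<mu>" by (rule underS_ordLeq) (use that in \<open>simp add: limit_elem_def\<close>)
    also have "\<mu> =o natLeq" using aleph0 by simp
    also have "natLeq =o |UNIV :: nat set|" using card_of_nat ordIso_symmetric by blast
    finally show "countable (underS \<kappa> \<delta>)" by (simp add: countable_card_of_nat)
  qed
  have range_b: "range (b \<delta> \<xi>) = insert \<xi> (underS \<kappa> \<delta>)" if "limit_elem \<kappa> \<delta>" for \<delta> \<xi>
  proof
    show "range (b \<delta> \<xi>) \<subseteq> insert \<xi> (underS \<kappa> \<delta>)"
      using range_e[OF that] by (auto simp: b_def split: nat.splits)
    show "insert \<xi> (underS \<kappa> \<delta>) \<subseteq> range (b \<delta> \<xi>)"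
    proof
      fix z assume z: "z \<in> insert \<xi> (underS \<kappa> \<delta>)"
      show "z \<in> range (b \<delta> \<xi>)"
      proof (cases "z = \<xi>")
        case True
        then show ?thesis by (intro range_eqI[of _ _ 0]) (simp add: b_def)
      next
        case False
        then have "z \<in> range (from_nat_into (underS \<kappa> \<delta>))" using z unfolding range_e[OF that] by simp
        then obtain k where "z = from_nat_into (underS \<kappa> \<delta>) k" by blast
        then show ?thesis by (intro range_eqI[of _ _ "Suc k"]) (simp add: b_def)
      qed
    qed
  qed
  have \<xi>_below: "\<xi> \<in> underS \<kappa> \<delta>" if "\<xi> \<in> Field \<kappa>" "\<beta> \<xi> \<in> underS \<kappa> \<delta>" for \<delta> \<xi>
  proof -
    have "(\<xi>, \<beta> \<xi>) \<in> \<kappa>" using \<beta>(2)[OF that(1), of \<xi>] underS_Field by blast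
    then show ?thesis by (rule underS_trans1) (rule that(2))
  qed
  \<comment> \<open>Once \<open>\<beta> \<xi>\<close> lies below \<open>\<delta>\<close>, so does
    \<open>\<xi>\<close>, and all cuts are lists below \<open>\<delta>\<close>; this gives the
    locality needed for the weak diamond.\<close>
  define \<Phi> where "\<Phi> \<delta> \<xi> f = solvable (\<lambda>k. f (map (b \<delta> \<xi>) [0..<k]))" for \<delta> \<xi> f
  have "\<exists>g. \<forall>f. \<forall>\<xi>\<in>Field \<kappa>. \<exists>\<delta>. limit_elem \<kappa> \<delta> \<and> \<beta> \<xi> \<in> underS \<kappa> \<delta> \<and> g \<delta> = \<Phi> \<delta> \<xi> f"
  proof (rule weak_diamond[OF _ exp \<beta>(1)])
    show "\<mu> =o natLeq" using aleph0 by simp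
    fix \<delta> \<xi> and f f' :: "'a list \<Rightarrow> int"
    assume *: "limit_elem \<kappa> \<delta>" "\<xi> \<in> Field \<kappa>" "\<beta> \<xi> \<in> underS \<kappa> \<delta>" "\<And>l. set l \<subseteq> underS \<kappa> \<delta> \<Longrightarrow> f l = f' l"
    have "f (map (b \<delta> \<xi>) [0..<k]) = f' (map (b \<delta> \<xi>) [0..<k])" for k
    proof (rule *(4))
      show "set (map (b \<delta> \<xi>) [0..<k]) \<subseteq> underS \<kappa> \<delta>"
      proof -
        have "range (b \<delta> \<xi>) \<subseteq> underS \<kappa> \<delta>"
          unfolding range_b[OF *(1)] using \<xi>_below[OF *(2,3)] by simp
        then show ?thesis by auto
      qed
    qed
    then show "\<Phi> \<delta> \<xi> f = \<Phi> \<delta> \<xi> f'" by (simp add: \<Phi>_def)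
  qed
  then obtain gg where gg: "\<And>f \<xi>. \<xi> \<in> Field \<kappa> \<Longrightarrow> \<exists>\<delta>. limit_elem \<kappa> \<delta> \<and> \<beta> \<xi> \<in> underS \<kappa> \<delta> \<and> gg \<delta> = \<Phi> \<delta> \<xi> f"
    by blast
  define B :: "nat \<Rightarrow> (nat \<Rightarrow> 'a) set"
    where "B = (\<lambda>_. {b \<delta> \<xi> | \<delta> \<xi>. limit_elem \<kappa> \<delta> \<and> \<xi> \<in> Field \<kappa> \<and> \<beta> \<xi> \<in> underS \<kappa> \<delta>})"
  \<comment> \<open>A bit guessed for a limit becomes a bit for a tuple: by \<open>b_inj\<close> the
    branch and its first entry leave only one possible \<open>\<delta>\<close>.\<close>
  define g where "g \<eta> = (\<exists>\<delta>. limit_elem \<kappa> \<delta> \<and> \<eta> 0 = b \<delta> (\<eta> 0 0) \<and> gg \<delta>)" for \<eta> :: "nat \<Rightarrow> nat \<Rightarrow> 'a"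
  have b_inj: "\<delta> = \<delta>'" if "limit_elem \<kappa> \<delta>" "limit_elem \<kappa> \<delta>'" "b \<delta> \<xi> = b \<delta>' \<xi>" for \<delta> \<delta>' \<xi>
  proof -
    have "from_nat_into (underS \<kappa> \<delta>) k = from_nat_into (underS \<kappa> \<delta>') k" for k
      using fun_cong[OF that(3), of "Suc k"] by (simp add: b_def)
    then have "from_nat_into (underS \<kappa> \<delta>) = from_nat_into (underS \<kappa> \<delta>')" by (rule ext)
    then have "underS \<kappa> \<delta> = underS \<kappa> \<delta>'" using range_e[OF that(1)] range_e[OF that(2)] by metis
    then show ?thesis by (rule underS_inject) (use that in \<open>simp_all add: limit_elem_def\<close>)
  qed
  have range_B: "range c \<subseteq> Field \<kappa>" if cB: "c \<in> B m" for c m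
  proof -
    obtain \<delta> \<xi> where "c = b \<delta> \<xi>" "limit_elem \<kappa> \<delta>" "\<xi> \<in> Field \<kappa>"
      using cB unfolding B_def by auto
    then have "range c = insert \<xi> (underS \<kappa> \<delta>)" "\<xi> \<in> Field \<kappa>" by (simp_all add: range_b)
    then show ?thesis using underS_Field by auto
  qed
  have "prediction_system \<kappa> \<mu> 1 code g B"
  proof unfold_locales
    show "is_aleph (1 - 1) \<mu>" using aleph0 by simp
    show "range c \<subseteq> Field \<kappa>" if "c \<in> B (1 - 1)" for c by (rule range_B[OF that])
    show "|{c \<in> B (1 - 1). \<exists>u\<in>underS \<kappa> \<nu>. \<forall>k. (c k, u) \<in> \<kappa>}| \<le>o \<mu>" if \<nu>: "\<nu> \<in> Field \<kappa>" for \<nu>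
    proof (rule subset_ordLeq)
      show "|(\<lambda>(\<delta>, \<xi>). b \<delta> \<xi>) ` (underS \<kappa> \<nu> \<times> underS \<kappa> \<nu>)| \<le>o \<mu>"
        using underS_ordLeq[OF \<nu>] by (intro image_ordLeq Times_ordLeq_Cinfinite is_aleph_Cinfinite[OF aleph0])
      show "{c \<in> B (1 - 1). \<exists>u\<in>underS \<kappa> \<nu>. \<forall>k. (c k, u) \<in> \<kappa>} \<subseteq> (\<lambda>(\<delta>, \<xi>). b \<delta> \<xi>) ` (underS \<kappa> \<nu> \<times> underS \<kappa> \<nu>)"
      proof
        fix c assume "c \<in> {c \<in> B (1 - 1). \<exists>u\<in>underS \<kappa> \<nu>. \<forall>k. (c k, u) \<in> \<kappa>}"
        then obtain \<delta> \<xi> u where c: "c = b \<delta> \<xi>" "limit_elem \<kappa> \<delta>" "\<xi> \<in> Field \<kappa>" "\<beta> \<xi> \<in> underS \<kappa> \<delta>"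
          "u \<in> underS \<kappa> \<nu>" "\<forall>k. (c k, u) \<in> \<kappa>" unfolding B_def by blast
        have "range c \<subseteq> under \<kappa> u" using c(6) by (auto simp: under_def)
        then have sub: "underS \<kappa> \<delta> \<subseteq> under \<kappa> u"
          unfolding c(1) range_b[OF c(2)] by simp
        have uF: "u \<in> Field \<kappa>" using underS_Field[OF c(5)] by blast
        \<comment> \<open>The branch passes through all ordinals below \<open>\<delta>\<close>, so a
          bound \<open>u\<close> for it satisfies \<open>\<delta> \<le> u\<close>. Only countably
          many choices of \<open>\<delta>\<close> and \<open>\<xi>\<close> remain.\<close>
        have "\<delta> \<in> underS \<kappa> \<nu>"
          by (rule underS_trans1[OF limit_not_le[OF c(2) uF sub] c(5)])
        moreover have "\<xi> \<in> underS \<kappa> \<nu>"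
        proof (rule underS_trans1)
          show "(\<xi>, \<delta>) \<in> \<kappa>" using underS_Field[OF \<xi>_below[OF c(3,4)]] by blast
        qed fact
        ultimately show "c \<in> (\<lambda>(\<delta>, \<xi>). b \<delta> \<xi>) ` (underS \<kappa> \<nu> \<times> underS \<kappa> \<nu>)" using c(1) by blast
      qed
    qed
    show "\<exists>k. \<forall>z\<in>entries 1 (code (c 0)). (z, c k) \<in> \<kappa>" if cB: "c \<in> B (1 - 1)" for c
    proof -
      obtain \<delta> \<xi> where c: "c = b \<delta> \<xi>" "limit_elem \<kappa> \<delta>" "\<xi> \<in> Field \<kappa>" "\<beta> \<xi> \<in> underS \<kappa> \<delta>"
        using cB unfolding B_def by auto
      have "c 0 = \<xi>" by (simp add: c(1) b_def)
      moreover obtain k where "c k = \<beta> \<xi>" using range_b[OF c(2), of \<xi>] c(1,4) by (metis image_iff insertCI)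
      ultimately show ?thesis using \<beta>(2)[OF c(3)] underS_Field by (intro exI[of _ k]) auto
    qed
    show "coord m \<eta> k \<in> code ` Field \<kappa>" if "\<eta> \<in> PiE {..<1} B" "m < 1" for \<eta> m k
    proof -
      have "\<eta> \<in> PiE {..<1} (\<lambda>m. {b. range b \<subseteq> Field \<kappa>})"
        using that(1) range_B by (auto simp: PiE_iff)
      then show ?thesis unfolding code using that(2) by blast
    qed
    show "\<exists>\<eta>\<in>PiE {..<1} B. \<eta> (1 - 1) 0 = \<xi> \<and> g \<eta> = solvable (\<lambda>k. \<Sum>m<1. f (coord m \<eta> k))"
      if \<xi>: "\<xi> \<in> Field \<kappa>" for \<xi> f
    proof -
      \<comment> \<open>With one branch, indices differ only in their list, so \<open>f\<close>
        reduces to a function on lists.\<close>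
      obtain \<delta> where \<delta>: "limit_elem \<kappa> \<delta>" "\<beta> \<xi> \<in> underS \<kappa> \<delta>" "gg \<delta> = \<Phi> \<delta> \<xi> (\<lambda>l. f (0, \<lambda>_. undefined, l))"
        using gg[OF \<xi>] by blast
      define \<eta> where "\<eta> = (\<lambda>i :: nat. if i = 0 then b \<delta> \<xi> else undefined)"
      have \<eta>0: "\<eta> 0 = b \<delta> \<xi>" "\<eta> 0 0 = \<xi>" by (simp_all add: \<eta>_def b_def)
      have "\<eta> \<in> PiE {..<1} B"
        using \<delta>(1,2) \<xi> by (auto simp: PiE_iff \<eta>_def B_def extensional_def)
      moreover have "g \<eta> = gg \<delta>"
      proof -
        have "b \<delta> \<xi> 0 = \<xi>" by (simp add: b_def)
        then show ?thesis unfolding g_def \<eta>0(1) using b_inj[OF \<delta>(1)] \<delta>(1) by metis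
      qed
      moreover have "\<eta>(0 := undefined) = (\<lambda>_. undefined)" by (auto simp: \<eta>_def)
      then have "(\<lambda>k. \<Sum>m<1. f (coord m \<eta> k)) = (\<lambda>k. f (0, \<lambda>_. undefined, map (b \<delta> \<xi>) [0..<k]))"
        by (simp add: coord_def \<eta>0)
      then have "\<Phi> \<delta> \<xi> (\<lambda>l. f (0, \<lambda>_. undefined, l)) = solvable (\<lambda>k. \<Sum>m<1. f (coord m \<eta> k))"
        by (simp add: \<Phi>_def)
      ultimately show ?thesis using \<delta>(3) \<eta>0(2) by (intro bexI[of _ \<eta>]) simp_all
    qed
  qed simp_all
  then show ?thesis by (rule prediction_system.strongly_free_trivial_dual)
qed

section \<open>Several branches and the black box\<close>

lemma aleph_ge_two_case:
  fixes n :: nat and \<kappa> :: "'a rel"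
  assumes n: "n \<ge> 2" and aleph: "is_aleph n \<kappa>"
    and gch: "\<And>i (\<mu> :: 'a rel) (\<mu>' :: 'a rel).
      i < n \<Longrightarrow> is_aleph i \<mu> \<Longrightarrow> is_aleph (Suc i) \<mu>' \<Longrightarrow> ctwo ^c \<mu> =o \<mu>'"
  shows "\<exists>G :: 'a monoid. strongly_free \<kappa> G \<and> trivial_dual G"
proof -
  obtain al :: "nat \<Rightarrow> 'a rel" where al_n: "al n = \<kappa>" and al: "\<And>i. i \<le> n \<Longrightarrow> is_aleph i (al i)"
    using is_aleph_chain[OF aleph] by blast
  define \<mu> where "\<mu> = al (n - 1)"
  have n1: "Suc (n - 1) = n" using n by simp
  have \<mu>_aleph: "is_aleph (n - 1) \<mu>" unfolding \<mu>_def by (rule al) simp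
  interpret successor_cardinal \<kappa> \<mu>
  proof
    show "Cinfinite \<mu>" by (rule is_aleph_Cinfinite[OF \<mu>_aleph])
    show "Card_order \<kappa>" by (rule is_aleph_Card_order[OF aleph])
    show "\<kappa> =o cardSuc \<mu>" by (rule is_aleph_Suc_ordIso[OF \<mu>_aleph]) (simp only: n1 aleph)
  qed
  have inf: "Cinfinite (al i)" if "i \<le> n" for i
    by (rule is_aleph_Cinfinite[OF al[OF that]])
  have exp: "ctwo ^c (al i) =o al (Suc i)" if "i < n" for i
    by (rule gch[OF that al al]) (use that in simp_all)
  have al_step: "al i \<le>o al (Suc i)" if "i < n" for i
  proof -
    have "al (Suc i) =o cardSuc (al i)"
      by (rule is_aleph_Suc_ordIso[OF al al]) (use that in simp_all)
    moreover have "al i \<le>o cardSuc (al i)" by (rule cardSuc_ordLeq) (use inf that in simp)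
    ultimately show ?thesis using ordIso_symmetric ordLeq_ordIso_trans by blast
  qed
  have al_mono: "al i \<le>o al j" if "i \<le> j" "j \<le> n" for i j
    using that
  proof (induction j rule: dec_induct)
    case base
    then show ?case using inf ordLeq_refl by blast
  next
    case (step j)
    then show ?case using al_step[of j] ordLeq_transitive by (meson Suc_le_lessD less_imp_le)
  qed
  \<comment> \<open>Branch \<open>m\<close> has entries in aleph-(m + 1), which is just enough room
    to encode functions of the earlier branches.\<close>
  define S where "S m = Field (al (Suc m))" for m
  have S_last: "S (n - 1) = Field \<kappa>" by (simp only: S_def n1 al_n)
  have S_card: "|S m| =o al (Suc m)" if "m < n" for m
    unfolding S_def by (rule card_of_Field_ordIso) (use inf that in \<open>simp add: Suc_le_eq\<close>)
  have S_ne: "S m \<noteq> {}" if "m < n" for m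
    using inf[of "Suc m"] that unfolding S_def by (auto simp: cinfinite_def)
  define P where "P m = {b :: nat \<Rightarrow> 'a. range b \<subseteq> S m}" for m
  have P_card: "|P m| \<le>o al (Suc m)" if "m < n" for m
    unfolding P_def
    by (rule card_seqs[OF exp inf]) (use that S_card ordIso_imp_ordLeq in auto)
  have "\<exists>code. code ` Field \<kappa> = {coord m \<eta> k | m \<eta> k. m < n \<and> \<eta> \<in> PiE {..<n} (\<lambda>m. {b. range b \<subseteq> S m})}"
  proof (rule exists_code[OF Cinfinite_\<kappa>])
    fix m assume m: "m < n"
    have "|P m| \<le>o al (Suc m)" by (rule P_card[OF m])
    also have "al (Suc m) \<le>o \<kappa>" using al_mono[of "Suc m" n] m al_n by simp
    finally show "|{b :: nat \<Rightarrow> 'a. range b \<subseteq> S m}| \<le>o \<kappa>" by (simp only: P_def)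
    show "S m \<noteq> {}" by (rule S_ne[OF m])
  qed (use n in simp)
  then obtain code where code: "code ` Field \<kappa> = {coord m \<eta> k | m \<eta> k. m < n \<and> \<eta> \<in> PiE {..<n} (\<lambda>m. {b. range b \<subseteq> S m})}"
    by blast
  have bound: "\<exists>u\<in>Field \<kappa>. \<forall>z\<in>insert \<xi> (entries n (code \<xi>)). z \<in> underS \<kappa> u" if "\<xi> \<in> Field \<kappa>" for \<xi>
    by (rule entries_bound[OF code _ S_last that]) (use n in simp)
  define B where "B m = {b \<in> P m. m = n - 1 \<longrightarrow> (\<exists>k. \<forall>z\<in>entries n (code (b 0)). (z, b k) \<in> \<kappa>)}" for m
  have BP: "B m \<subseteq> P m" for m by (auto simp: B_def)
  have B_card: "|B m| \<le>o al (Suc m)" if "m < n" for m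
    by (rule subset_ordLeq[OF BP P_card[OF that]])
  \<comment> \<open>There are at most aleph-m tuples of branches before \<open>m\<close>, so the
    hypothesis at \<open>m\<close> leaves at most aleph-(m + 1) integer-valued functions of them:
    one entry can encode such a function.\<close>
  define E where "E m = PiE (PiE {..<m} B) (\<lambda>_. UNIV :: int set)" for m
  have "\<exists>c. inj_on c (E m) \<and> c ` E m \<subseteq> S m" if m: "m < n" for m
  proof -
    have "|PiE {..<m} B| \<le>o al m"
    proof (rule PiE_ordLeq[OF inf])
      fix i assume i: "i < m"
      have "|B i| \<le>o al (Suc i)" by (rule B_card) (use i m in simp)
      also have "al (Suc i) \<le>o al m" by (rule al_mono) (use i m in simp_all)
      finally show "|B i| \<le>o al m" .
    qed (use m in simp)
    then have "|E m| \<le>o al (Suc m)"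
      unfolding E_def
      by (intro PiE_const_ordLeq[OF exp inf] nat_ordLeq_Cinfinite inf) (use m in simp_all)
    then have "|E m| \<le>o |S m|" using S_card[OF m] ordIso_symmetric ordLeq_ordIso_trans by blast
    then show ?thesis by (simp add: card_of_ordLeq)
  qed
  then have "\<forall>m\<in>{..<n}. \<exists>c. inj_on c (E m) \<and> c ` E m \<subseteq> S m" by blast
  from bchoice[OF this] obtain enc where
    enc: "\<And>m. m < n \<Longrightarrow> inj_on (enc m) (E m)" "\<And>m \<psi>. m < n \<Longrightarrow> \<psi> \<in> E m \<Longrightarrow> enc m \<psi> \<in> S m"
    by blast
  define dec where "dec m = inv_into (E m) (enc m)" for m
  have dec: "dec m (enc m \<psi>) = \<psi>" if "m < n" "\<psi> \<in> E m" for m \<psi>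
    unfolding dec_def by (rule inv_into_f_f[OF enc(1)[OF that(1)] that(2)])
  \<comment> \<open>Entry \<open>k + 2\<close> of branch \<open>m\<close> encodes the values at its cut at \<open>k\<close>, as a function of the branches
    before \<open>m\<close>. Entries 0 and 1 are kept free for the point to be killed and for a bound on its code.\<close>
  define g where "g \<eta> = solvable (\<lambda>k. \<Sum>m<n. dec m (\<eta> m (Suc (Suc k))) (restrict \<eta> {..<m}))" for \<eta>
  \<comment> \<open>The index of a cut at \<open>m\<close> contains all other branches. Those after
    \<open>m\<close> are already fixed by \<open>H\<close>, while those before \<open>m\<close> are
    still open and enter as the argument \<open>\<zeta>\<close> of the encoded function.\<close>
  define glue where "glue m \<zeta> H = (\<lambda>i. if i < m then \<zeta> i else if i < n then H i else undefined)"
    for m and \<zeta> H :: "nat \<Rightarrow> nat \<Rightarrow> 'a"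
  have choose: "\<exists>b\<in>B m. (m = n - 1 \<longrightarrow> b 0 = \<xi>) \<and>
      (\<forall>k. \<forall>\<zeta>\<in>PiE {..<m} B. dec m (b (Suc (Suc k))) \<zeta> = f (m, (glue m \<zeta> H)(m := undefined), map b [0..<k]))"
    if m: "m < n" and \<xi>: "\<xi> \<in> Field \<kappa>" for m \<xi> H and f :: "nat \<times> (nat \<Rightarrow> nat \<Rightarrow> 'a) \<times> 'a list \<Rightarrow> int"
  proof -
    obtain u where u: "u \<in> Field \<kappa>" "\<And>z. z \<in> entries n (code \<xi>) \<Longrightarrow> (z, u) \<in> \<kappa>"
      using bound[OF \<xi>] underS_Field by blast
    obtain s where s: "s \<in> S m" using S_ne[OF m] by blast
    define s0 where "s0 = (if m = n - 1 then \<xi> else s)"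
    define s1 where "s1 = (if m = n - 1 then u else s)"
    have s01: "s0 \<in> S m" "s1 \<in> S m" using s \<xi> u(1) S_last by (auto simp: s0_def s1_def)
    define \<psi> where "\<psi> l = restrict (\<lambda>\<zeta>. f (m, (glue m \<zeta> H)(m := undefined), l)) (PiE {..<m} B)" for l
    have \<psi>E: "\<psi> l \<in> E m" for l unfolding E_def \<psi>_def by simp
    \<comment> \<open>The offset 2 leaves room for \<open>s0\<close> and \<open>s1\<close>: entry
      \<open>k + 2\<close> encodes the values at the cut of length \<open>k\<close>, which is known
      by then.\<close>
    define F where "F l = (if length l = 0 then s0 else if length l = 1 then s1
      else enc m (\<psi> (take (length l - 2) l)))" for l
    obtain b where b: "\<And>k. b k = F (map b [0..<k])" using exists_from_prefix[of F] by blast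
    have b0: "b 0 = s0" and b1: "b 1 = s1" using b[of 0] b[of 1] by (simp_all add: F_def)
    have b2: "b (Suc (Suc k)) = enc m (\<psi> (map b [0..<k]))" for k
    proof -
      have "take k (map b [0..<Suc (Suc k)]) = map b [0..<k]" by (simp add: take_map)
      then show ?thesis using b[of "Suc (Suc k)"] by (simp add: F_def del: upt_Suc)
    qed
    have bS: "b k \<in> S m" for k
    proof (cases k)
      case (Suc j)
      then show ?thesis
        using b1 b2 s01(2) enc(2)[OF m \<psi>E] by (cases j) simp_all
    qed (use b0 s01 in simp)
    have "b \<in> B m"
      unfolding B_def P_def
    proof (intro CollectI conjI impI)
      show "range b \<subseteq> S m" using bS by blast
      assume "m = n - 1"
      then have "\<forall>z\<in>entries n (code (b 0)). (z, b 1) \<in> \<kappa>"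
        unfolding b0 b1 s0_def s1_def using u(2) by simp
      then show "\<exists>k. \<forall>z\<in>entries n (code (b 0)). (z, b k) \<in> \<kappa>" by (rule exI)
    qed
    moreover have "m = n - 1 \<longrightarrow> b 0 = \<xi>" unfolding b0 s0_def by simp
    moreover have "dec m (b (Suc (Suc k))) \<zeta> = f (m, (glue m \<zeta> H)(m := undefined), map b [0..<k])"
      if "\<zeta> \<in> PiE {..<m} B" for k \<zeta>
      unfolding b2 dec[OF m \<psi>E] using that by (simp add: \<psi>_def)
    ultimately show ?thesis by blast
  qed
  \<comment> \<open>Branches are chosen from the last to the first, \<open>j\<close> of them so far,
    because the encoded values at \<open>m\<close> refer to the branches after
    \<open>m\<close>.\<close>
  have build: "\<exists>H. \<forall>m. n - j \<le> m \<and> m < n \<longrightarrow> H m \<in> B m \<and> (m = n - 1 \<longrightarrow> H m 0 = \<xi>) \<and>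
      (\<forall>k. \<forall>\<zeta>\<in>PiE {..<m} B. dec m (H m (Suc (Suc k))) \<zeta> = f (m, (glue m \<zeta> H)(m := undefined), map (H m) [0..<k]))"
    if \<xi>: "\<xi> \<in> Field \<kappa>" and "j \<le> n" for j \<xi> and f :: "nat \<times> (nat \<Rightarrow> nat \<Rightarrow> 'a) \<times> 'a list \<Rightarrow> int"
    using that(2)
  proof (induction j)
    case (Suc j)
    have "j \<le> n" using Suc.prems by simp
    from Suc.IH[OF this] obtain H where H: "\<forall>m. n - j \<le> m \<and> m < n \<longrightarrow> H m \<in> B m \<and> (m = n - 1 \<longrightarrow> H m 0 = \<xi>) \<and>
      (\<forall>k. \<forall>\<zeta>\<in>PiE {..<m} B. dec m (H m (Suc (Suc k))) \<zeta> = f (m, (glue m \<zeta> H)(m := undefined), map (H m) [0..<k]))"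
      ..
    define m0 where "m0 = n - Suc j"
    have m0: "m0 < n" "n - j = Suc m0" using Suc.prems by (simp_all add: m0_def)
    obtain b where b: "b \<in> B m0" "m0 = n - 1 \<longrightarrow> b 0 = \<xi>"
      "\<forall>k. \<forall>\<zeta>\<in>PiE {..<m0} B. dec m0 (b (Suc (Suc k))) \<zeta> = f (m0, (glue m0 \<zeta> H)(m0 := undefined), map b [0..<k])"
      using choose[OF m0(1) \<xi>, of f H] by blast
    define H' where "H' = H(m0 := b)"
    \<comment> \<open>A new branch at \<open>m0\<close> leaves earlier choices valid: for
      \<open>m > m0\<close> this place is filled from \<open>\<zeta>\<close>, and for
      \<open>m = m0\<close> it is erased.\<close>
    have eq: "(glue m \<zeta> H')(m := undefined) = (glue m \<zeta> H)(m := undefined)" if "m0 \<le> m" for m \<zeta>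
      using that by (auto simp: glue_def H'_def fun_eq_iff)
    have new: "H' m \<in> B m \<and> (m = n - 1 \<longrightarrow> H' m 0 = \<xi>) \<and>
      (\<forall>k. \<forall>\<zeta>\<in>PiE {..<m} B. dec m (H' m (Suc (Suc k))) \<zeta> = f (m, (glue m \<zeta> H')(m := undefined), map (H' m) [0..<k]))"
      if "n - Suc j \<le> m \<and> m < n" for m
    proof -
      have m: "n - Suc j \<le> m" "m < n" using that by simp_all
      have le: "m0 \<le> m" using m(1) by (simp add: m0_def)
      show ?thesis
      proof (cases "m = m0")
        case True
        have "H' m = b" by (simp add: H'_def True)
        then show ?thesis unfolding eq[OF le] using b True by (simp only: simp_thms)
      next
        case False
        have H'm: "H' m = H m" by (simp add: H'_def False)
        have "n - j \<le> m" using le False m0(2) by simp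
        from mp[OF spec[OF H, of m] conjI[OF this m(2)]] show ?thesis
          unfolding eq[OF le] H'm .
      qed
    qed
    show ?case by (intro exI[of _ H'] allI impI) (rule new)
  next
    case 0
    have "\<not> (n - 0 \<le> m \<and> m < n)" for m by simp
    then show ?case by blast
  qed
  have range_B: "range b \<subseteq> S m" if "b \<in> B m" for b m using that BP by (auto simp: P_def)
  have "prediction_system \<kappa> \<mu> n code g B"
  proof unfold_locales
    show "n > 0" using n by simp
    show "is_aleph (n - 1) \<mu>" by (rule \<mu>_aleph)
    show "range b \<subseteq> Field \<kappa>" if "b \<in> B (n - 1)" for b
      using range_B[OF that] S_last by simp
    show "|B m| \<le>o \<mu>" if m: "m < n - 1" for m
    proof -
      have "|B m| \<le>o al (Suc m)" by (rule B_card) (use m in simp)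
      also have "al (Suc m) \<le>o \<mu>" unfolding \<mu>_def by (rule al_mono) (use m in simp_all)
      finally show ?thesis .
    qed
    show "|{b \<in> B (n - 1). \<exists>u\<in>underS \<kappa> \<nu>. \<forall>k. (b k, u) \<in> \<kappa>}| \<le>o \<mu>" if \<nu>: "\<nu> \<in> Field \<kappa>" for \<nu>
    proof (rule subset_ordLeq)
      show "{b \<in> B (n - 1). \<exists>u\<in>underS \<kappa> \<nu>. \<forall>k. (b k, u) \<in> \<kappa>} \<subseteq> (\<Union>u\<in>underS \<kappa> \<nu>. {b. range b \<subseteq> under \<kappa> u})"
        unfolding under_def by blast
      show "|\<Union>u\<in>underS \<kappa> \<nu>. {b :: nat \<Rightarrow> 'a. range b \<subseteq> under \<kappa> u}| \<le>o \<mu>"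
      proof (rule UNION_Cinfinite_bound[OF underS_ordLeq[OF \<nu>] _ is_aleph_Cinfinite[OF \<mu>_aleph]], rule ballI)
        fix u assume "u \<in> underS \<kappa> \<nu>"
        then have "u \<in> Field \<kappa>" using underS_Field by blast
        \<comment> \<open>Here \<open>n \<ge> 2\<close> enters: \<open>\<mu>\<close> is 2 to the
          power aleph-(n - 2), so a bound of size at most \<open>\<mu>\<close> admits at most
          \<open>\<mu>\<close> sequences.\<close>
        have n2: "Suc (n - 2) = n - 1" using n by simp
        have "ctwo ^c (al (n - 2)) =o \<mu>" using exp[of "n - 2"] n unfolding n2 \<mu>_def by simp
        then show "|{b :: nat \<Rightarrow> 'a. range b \<subseteq> under \<kappa> u}| \<le>o \<mu>"
          by (rule card_seqs[OF _ inf under_ordLeq]) (simp, fact)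
      qed
    qed
    show "\<exists>k. \<forall>z\<in>entries n (code (b 0)). (z, b k) \<in> \<kappa>" if "b \<in> B (n - 1)" for b
      using that by (simp add: B_def)
    show "coord m \<eta> k \<in> code ` Field \<kappa>" if "\<eta> \<in> PiE {..<n} B" "m < n" for \<eta> m k
    proof -
      have "\<eta> \<in> PiE {..<n} (\<lambda>m. {b. range b \<subseteq> S m})"
        by (rule subsetD[OF PiE_mono that(1)]) (use range_B in blast)
      then show ?thesis unfolding code using that(2) by blast
    qed
    show "\<exists>\<eta>\<in>PiE {..<n} B. \<eta> (n - 1) 0 = \<xi> \<and> g \<eta> = solvable (\<lambda>k. \<Sum>m<n. f (coord m \<eta> k))"
      if \<xi>: "\<xi> \<in> Field \<kappa>" for \<xi> f
    proof -
      obtain H where H: "\<And>m. m < n \<Longrightarrow> H m \<in> B m" "H (n - 1) 0 = \<xi>"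
        "\<And>m k \<zeta>. m < n \<Longrightarrow> \<zeta> \<in> PiE {..<m} B \<Longrightarrow>
          dec m (H m (Suc (Suc k))) \<zeta> = f (m, (glue m \<zeta> H)(m := undefined), map (H m) [0..<k])"
      proof -
        obtain H where *: "\<forall>m. n - n \<le> m \<and> m < n \<longrightarrow> H m \<in> B m \<and> (m = n - 1 \<longrightarrow> H m 0 = \<xi>) \<and>
          (\<forall>k. \<forall>\<zeta>\<in>PiE {..<m} B. dec m (H m (Suc (Suc k))) \<zeta> = f (m, (glue m \<zeta> H)(m := undefined), map (H m) [0..<k]))"
          using build[OF \<xi> order_refl, of f] by blast
        show ?thesis
        proof (rule that[of H])
          show "H m \<in> B m" if "m < n" for m using * that by simp
          show "H (n - 1) 0 = \<xi>" using *[rule_format, of "n - 1"] n by simp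
          show "dec m (H m (Suc (Suc k))) \<zeta> = f (m, (glue m \<zeta> H)(m := undefined), map (H m) [0..<k])"
            if "m < n" "\<zeta> \<in> PiE {..<m} B" for m k \<zeta>
            using *[rule_format, of m] that by simp
        qed
      qed
      define \<eta> where "\<eta> = restrict H {..<n}"
      have \<eta>B: "\<eta> \<in> PiE {..<n} B" using H(1) by (simp add: \<eta>_def)
      have "dec m (\<eta> m (Suc (Suc k))) (restrict \<eta> {..<m}) = f (coord m \<eta> k)" if m: "m < n" for m k
      proof -
        have "restrict \<eta> {..<m} \<in> PiE {..<m} B"
          using H(1) m by (simp add: PiE_iff extensional_def \<eta>_def)
        moreover have "glue m (restrict \<eta> {..<m}) H = \<eta>"
          using m by (auto simp: glue_def \<eta>_def fun_eq_iff)
        moreover have "\<eta> m = H m" using m by (simp add: \<eta>_def)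
        ultimately show ?thesis using H(3)[OF m] by (simp add: coord_def)
      qed
      then have "g \<eta> = solvable (\<lambda>k. \<Sum>m<n. f (coord m \<eta> k))"
        unfolding g_def by simp
      moreover have "\<eta> (n - 1) 0 = \<xi>" using H(2) n by (simp add: \<eta>_def)
      ultimately show ?thesis using \<eta>B by blast
    qed
  qed
  then show ?thesis by (rule prediction_system.strongly_free_trivial_dual)
qed

theorem corollary5p2:
  fixes n :: nat and \<kappa> :: "'a rel"
  assumes "n \<ge> 1"
    and "is_aleph n \<kappa>"
    and "\<And>i (\<mu> :: 'a rel) (\<mu>' :: 'a rel).
           i < n \<Longrightarrow> is_aleph i \<mu> \<Longrightarrow> is_aleph (Suc i) \<mu>' \<Longrightarrow> ctwo ^c \<mu> =o \<mu>'"
  shows "\<exists>G :: 'a monoid. strongly_free \<kappa> G \<and> trivial_dual G"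
proof (cases "n = 1")
  case True
  then obtain \<mu> :: "'a rel" where "is_aleph 0 \<mu>" using assms(2) by auto
  moreover have "is_aleph 1 \<kappa>" using assms(2) True by simp
  moreover from calculation have "ctwo ^c \<mu> =o \<kappa>" using assms(3)[of 0 \<mu> \<kappa>] True by simp
  ultimately show ?thesis by (rule aleph_one_case)
next
  case False
  then have "n \<ge> 2" using assms(1) by simp
  then show ?thesis using assms(2,3) by (rule aleph_ge_two_case)
qed

end
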